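(* Let $m_1\in\mathbb{N}$ be odd and let $m_2\in\mathbb{N}$ be such that $\frac{m_2}{2}$ is an even natural number. Let $\Omega_1$ be a Tricomi domain (of the type described in the context, with boundary $\partial\Omega_1=\sigma_1\cup AC\cup BC$) for the operator $\mathcal{O}(u)=-y^{m_1}u_{xx}-x^{m_2}u_{yy}$, and suppose that $\Omega_1$ is $D$-star-shaped, where $D=-(m_1+2)x\,\partial_x-(m_2+2)y\,\partial_y$. Let $\alpha>0$ satisfy $$\alpha>2^*(m_1,m_2)-1=\frac{m_1+m_2-m_1m_2+8}{m_1+m_2+m_1m_2},$$ and let $u\in C^2(\overline{\Omega_1})$ be a solution of $$\mathcal{O}(u)=u|u|^{\alpha-1}\ \text{ in }\Omega_1,\qquad u=0\ \text{ on } AC\cup\sigma_1\subseteq\partial\Omega_1.$$ Then $u\equiv 0$ a.e. in $\Omega_1$.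
   Context: Here $\mathbb{N}=\{0,1,2,\dots\}$, and $2^*(m_1,m_2):=\frac{2(m_1+m_2)+8}{m_1+m_2+m_1m_2}$. The nonlinearity $s\mapsto s|s|^{\alpha-1}$ takes the value $0$ at $s=0$. Tricomi domain $\Omega_1$ for $\mathcal{O}$ (with $m_1$ odd and $m_2/2$ even): fix $x_0<0$ and put $A=(2x_0,0)$, $B=(0,0)$. $\Omega_1\subset\mathbb{R}^2$ is an open, bounded, simply connected set with piecewise $C^1$ boundary $\partial\Omega_1=\sigma_1\cup AC\cup BC$, where $\sigma_1$ is an arc lying in $\{(x,y):y>0\}$ apart from its endpoints $A$ and $B$ on the $x$-axis, and $AC$, $BC$ are the characteristic curves of $\mathcal{O}$ (i.e. curves satisfying $-y^{m_1}(dy)^2-x^{m_2}(dx)^2=0$) in $\{(x,y): x\le 0,\ y\le 0\}$ passing through $A$ and $B$ respectively and meeting at the point $C$. Explicitly, $$AC=\left\{(x,y):\ x\le0,\ y_C\le y\le 0,\ \tfrac{2}{m_1+2}(-y)^{\frac{m_1+2}{2}}=\tfrac{2}{m_2+2}\left[x^{\frac{m_2+2}{2}}-(2x_0)^{\frac{m_2+2}{2}}\right]\right\},$$ $$BC=\left\{(x,y):\ x\le0,\ y_C\le y\le 0,\ \tfrac{2}{m_1+2}(-y)^{\frac{m_1+2}{2}}=-\tfrac{2}{m_2+2}x^{\frac{m_2+2}{2}}\right\},$$ where $\frac{m_2+2}{2}$ is an odd integer, and $C=\left((\tfrac12)^{\frac{2}{m_2+2}}(2x_0),\,y_C\right)$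 with $y_C=-\left[-\tfrac12\,\tfrac{m_1+2}{m_2+2}\,(2x_0)^{\frac{m_2+2}{2}}\right]^{\frac{2}{m_1+2}}$. An open set $\Omega\subset\mathbb{R}^2$ is $D$-star-shaped, for $D=-(m_1+2)x\,\partial_x-(m_2+2)y\,\partial_y$, if for each $(x_1,y_1)\in\overline{\Omega}$ one has $\mathcal{F}_t(x_1,y_1)\in\overline{\Omega}$ for every $t\in[0,+\infty]$, where $\mathcal{F}_t(x_1,y_1)=(x_1e^{-(m_1+2)t},\,y_1e^{-(m_2+2)t})$ is the flow of $D$ and $\mathcal{F}_{+\infty}(x_1,y_1)=(0,0)$. *)

theory Defs
  imports "HOL-Analysis.Analysis"
begin

definition critical_exponent :: "nat \<Rightarrow> nat \<Rightarrow> real" where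
  "critical_exponent m1 m2 = (2 * (real m1 + real m2) + 8) / (real m1 + real m2 + real m1 * real m2)"

lemma critical_exponent_minus_1:
  assumes "odd m1"
  shows "critical_exponent m1 m2 - 1 =
    (real m1 + real m2 - real m1 * real m2 + 8) / (real m1 + real m2 + real m1 * real m2)"
proof -
  have "real m1 + real m2 + real m1 * real m2 > 0"
    using assms by (simp add: add_pos_nonneg odd_pos)
  then show ?thesis
    unfolding critical_exponent_def by (simp add: field_simps)
qed

definition partial_x :: "(real \<times> real \<Rightarrow> real) \<Rightarrow> real \<times> real \<Rightarrow> real" where
  "partial_x u = (\<lambda>(x, y). deriv (\<lambda>s. u (s, y)) x)"

definition partial_y :: "(real \<times> real \<Rightarrow> real) \<Rightarrow> real \<times> real \<Rightarrow> real" where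
  "partial_y u = (\<lambda>(x, y). deriv (\<lambda>s. u (x, s)) y)"

definition tricomi_operator ::
  "nat \<Rightarrow> nat \<Rightarrow> (real \<times> real \<Rightarrow> real) \<Rightarrow> real \<times> real \<Rightarrow> real" where
  "tricomi_operator m1 m2 u = (\<lambda>(x, y).
     - (y ^ m1) * partial_x (partial_x u) (x, y) - x ^ m2 * partial_y (partial_y u) (x, y))"

definition extends_continuously :: "(real \<times> real) set \<Rightarrow> (real \<times> real \<Rightarrow> real) \<Rightarrow> bool" where
  "extends_continuously \<Omega> f \<longleftrightarrow>
     (\<exists>g. continuous_on (closure \<Omega>) g \<and> (\<forall>z\<in>\<Omega>. g z = f z))"

definition C1_up_to_boundary :: "(real \<times> real) set \<Rightarrow> (real \<times> real \<Rightarrow> real) \<Rightarrow> bool" where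
  "C1_up_to_boundary \<Omega> f \<longleftrightarrow>
     (\<forall>z\<in>\<Omega>. f differentiable (at z)) \<and>
     extends_continuously \<Omega> f \<and>
     extends_continuously \<Omega> (partial_x f) \<and>
     extends_continuously \<Omega> (partial_y f)"

text \<open>For open \<open>\<Omega>\<close>, the class of \<open>C\<^sup>2\<close> functions on the closure of \<open>\<Omega>\<close>: all partial
  derivatives of order at most two exist and are continuous in \<open>\<Omega>\<close> and extend continuously to
  the closure. Boundary values of \<open>u\<close> are used, so \<open>u\<close> itself is required to be continuous on the
  closure; its derivatives are only evaluated in \<open>\<Omega>\<close>.\<close>

definition C2_closure :: "(real \<times> real) set \<Rightarrow> (real \<times> real \<Rightarrow> real) \<Rightarrow> bool" where
  "C2_closure \<Omega> u \<longleftrightarrow>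
     continuous_on (closure \<Omega>) u \<and>
     C1_up_to_boundary \<Omega> u \<and>
     C1_up_to_boundary \<Omega> (partial_x u) \<and>
     C1_up_to_boundary \<Omega> (partial_y u)"

text \<open>An injective path made of finitely many regular arcs, each \<open>C\<^sup>1\<close> up to its endpoints. The
  library's \<open>valid_path\<close> is weaker: it puts no condition on the derivative near the
  break points and allows it to vanish.\<close>

definition piecewise_C1_arc :: "(real \<Rightarrow> real \<times> real) \<Rightarrow> bool" where
  "piecewise_C1_arc g \<longleftrightarrow> arc g \<and>
     (\<exists>(n::nat) s g'. s 0 = (0::real) \<and> s n = 1 \<and>
        (\<forall>i<n. s i < s (Suc i) \<and> continuous_on {s i..s (Suc i)} (g' i) \<and>
           (\<forall>t\<in>{s i..s (Suc i)}. g' i t \<noteq> 0 \<and>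
              (g has_vector_derivative g' i t) (at t within {s i..s (Suc i)}))))"

text \<open>Below, \<open>m2\<close> is a multiple of 4, so \<open>(m2 + 2) div 2\<close> is the exact, odd, quotient. The
  exponent \<open>(m1 + 2) / 2\<close> is not an integer; \<open>powr\<close> is applied to nonnegative bases only.\<close>

definition y_C :: "nat \<Rightarrow> nat \<Rightarrow> real \<Rightarrow> real" where
  "y_C m1 m2 x0 =
     - ((- (1 / 2 * ((real m1 + 2) / (real m2 + 2)) * (2 * x0) ^ ((m2 + 2) div 2)))
          powr (2 / (real m1 + 2)))"

definition char_AC :: "nat \<Rightarrow> nat \<Rightarrow> real \<Rightarrow> (real \<times> real) set" where
  "char_AC m1 m2 x0 = {(x, y). x \<le> 0 \<and> y_C m1 m2 x0 \<le> y \<and> y \<le> 0 \<and>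
     2 / (real m1 + 2) * (- y) powr ((real m1 + 2) / 2) =
     2 / (real m2 + 2) * (x ^ ((m2 + 2) div 2) - (2 * x0) ^ ((m2 + 2) div 2))}"

definition char_BC :: "nat \<Rightarrow> nat \<Rightarrow> real \<Rightarrow> (real \<times> real) set" where
  "char_BC m1 m2 x0 = {(x, y). x \<le> 0 \<and> y_C m1 m2 x0 \<le> y \<and> y \<le> 0 \<and>
     2 / (real m1 + 2) * (- y) powr ((real m1 + 2) / 2) =
     - (2 / (real m2 + 2)) * x ^ ((m2 + 2) div 2)}"

text \<open>The two characteristics are regular \<open>C\<^sup>1\<close> arcs by their equations, so the boundary is piecewise
  \<open>C\<^sup>1\<close> as soon as the elliptic arc \<open>\<sigma>\<close> is.\<close>

definition tricomi_domain ::
  "nat \<Rightarrow> nat \<Rightarrow> real \<Rightarrow> (real \<times> real) set \<Rightarrow> (real \<times> real) set \<Rightarrow> bool" where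
  "tricomi_domain m1 m2 x0 \<sigma> \<Omega> \<longleftrightarrow>
     x0 < 0 \<and> open \<Omega> \<and> bounded \<Omega> \<and> simply_connected \<Omega> \<and>
     (\<exists>g. piecewise_C1_arc g \<and> pathstart g = (2 * x0, 0) \<and> pathfinish g = (0, 0) \<and>
          path_image g = \<sigma>) \<and>
     (\<forall>(x, y) \<in> \<sigma> - {(2 * x0, 0), (0, 0)}. y > 0) \<and>
     frontier \<Omega> = \<sigma> \<union> char_AC m1 m2 x0 \<union> char_BC m1 m2 x0"

text \<open>The flow of the vector field \<open>D = - (m1 + 2) x \<partial>\<^sub>x - (m2 + 2) y \<partial>\<^sub>y\<close>.\<close>

definition D_flow :: "nat \<Rightarrow> nat \<Rightarrow> real \<Rightarrow> real \<times> real \<Rightarrow> real \<times> real" where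
  "D_flow m1 m2 t = (\<lambda>(x, y).
     (x * exp (- (real m1 + 2) * t), y * exp (- (real m2 + 2) * t)))"

text \<open>The last conjunct is the condition at time \<open>t = +\<infinity>\<close>, where the flow is at the origin.\<close>

definition D_star_shaped :: "nat \<Rightarrow> nat \<Rightarrow> (real \<times> real) set \<Rightarrow> bool" where
  "D_star_shaped m1 m2 \<Omega> \<longleftrightarrow>
     (\<forall>z \<in> closure \<Omega>. (\<forall>t\<ge>0. D_flow m1 m2 t z \<in> closure \<Omega>) \<and> (0, 0) \<in> closure \<Omega>)"

end

theory Submission
  imports Defs
begin

text \<open>
  The statement is a nonexistence result of Pohozaev type. Pohozaev's identity comes from the homogeneity of
  the equation under the dilations \<open>dil t (x, y) = (t\<^bsup>wx\<^esup> x, t\<^bsup>wy\<^esup> y)\<close>, where \<open>wx = m1 + 2\<close> and \<open>wy = m2 + 2\<close>, whose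
  generator is \<open>D\<close> up to sign. The usual proof multiplies the equation by \<open>D u\<close> and a multiple of \<open>u\<close> and integrates by
  parts, which produces an integral of the squared normal derivative over \<open>\<sigma>\<close>. Here \<open>u\<close> is compared with
  \<open>v = u \<circ> dil t\<close> for \<open>t < 1\<close> instead, and \<open>t\<close> tends to \<open>1\<close> only at the end. Star-shapedness says that \<open>dil t\<close> maps the
  domain into itself (\<open>dil_in\<close>; the Jordan curve theorem is used to pass from the closure to the domain), so \<open>v\<close>
  is defined on all of \<open>\<Omega>\<close>.

  Let \<open>a(u, v)\<close> be the integral of \<open>y\<^bsup>m1\<^esup> u\<^sub>x v\<^sub>x + x\<^bsup>m2\<^esup> u\<^sub>y v\<^sub>y\<close>, let \<open>F\<close> be the primitive of the nonlinearity \<open>f\<close>, and let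
  \<open>N = m1 + m2 + m1 m2\<close> and \<open>w = wx + wy\<close>. Four facts are combined.

  \<^item> \<open>a(v, v) - 2 a(u, v) + a(u, u) = a(v - u, v - u)\<close> is \<open>O((1 - t)\<^sup>2)\<close>, although the form is indefinite
    (\<open>difference_energy\<close>).
  \<^item> \<open>a(v, v)\<close> is \<open>t\<^bsup>- N\<^esup>\<close> times \<open>a(u, u)\<close> without the energy in the layer \<open>\<Omega> - dil t ` \<Omega>\<close>
    (\<open>energy_scaling\<close>). That energy is at least \<open>- o(1 - t)\<close> (\<open>energy_in_layer\<close>): the density is nonnegative for \<open>y \<ge> 0\<close>;
    for \<open>y < 0\<close> the layer shrinks to \<open>AC\<close>, where the density is zero since \<open>AC\<close> is characteristic and \<open>u = 0\<close> on it.
  \<^item> \<open>a(u, v)\<close> is \<open>t\<^bsup>E\<^esup>\<close> times the integral of \<open>u f(v)\<close> plus a term on \<open>BC\<close>, with \<open>E = w - N\<close> (\<open>green_identity\<close>). This needs the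
    divergence theorem only for functions that vanish on \<open>\<sigma>\<close> and \<open>AC\<close>, which follows from Fubini's theorem and
    a one-dimensional lemma (\<open>has_integral_derivative_vanishing_off_open\<close>).
  \<^item> The integral of \<open>u f(v)\<close> is expanded to first order in \<open>1 - t\<close> by means of \<open>F\<close> (\<open>nonlinear_term\<close>,
    \<open>potential_in_layer\<close>), and so is the term on \<open>BC\<close> (\<open>bdry_expansion\<close>). The latter involves only the trace of \<open>u\<close> on \<open>BC\<close>,
    because \<open>BC\<close> is an orbit of the dilations and conormal derivatives on it are tangential.

  The coefficient of \<open>1 - t\<close> yields \<open>(N (\<alpha> + 1) - 2 w) \<integral>F(u) + 2 S \<le> 0\<close> (\<open>pohozaev_inequality\<close>), where \<open>S\<close> is the
  integral of a square over \<open>BC\<close> (\<open>boundary_nonneg\<close>). Since the critical exponent is \<open>2 w / N\<close>, the first factor is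
  positive in the supercritical case, and \<open>\<integral>F(u) = 0\<close> follows.
\<close>

section \<open>Preliminaries from real analysis\<close>

text \<open>An isolated point of \<open>S\<close> is the only point of \<open>S\<close> between two rationals, and there are countably
  many pairs of rationals.\<close>

lemma countable_isolated_real:
  fixes S :: "real set"
  assumes "\<And>t. t \<in> S \<Longrightarrow> \<exists>e>0. \<forall>s\<in>S. \<bar>s - t\<bar> < e \<longrightarrow> s = t"
  shows "countable S"
proof -
  define W where "W = (\<lambda>(p::rat, q::rat). {t \<in> S. S \<inter> {of_rat p<..<of_rat q} = {t}})"
  have "S \<subseteq> (\<Union>pq. W pq)"
  proof
    fix t assume t: "t \<in> S"
    then obtain e where e: "e > 0" "\<forall>s\<in>S. \<bar>s - t\<bar> < e \<longrightarrow> s = t" using assms by blast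
    obtain p where p: "t - e < of_rat p" "of_rat p < t" using of_rat_dense[of "t - e" t] e by auto
    obtain q where q: "t < of_rat q" "of_rat q < t + e" using of_rat_dense[of t "t + e"] e by auto
    have "S \<inter> {of_rat p<..<of_rat q} = {t}"
    proof (intro equalityI subsetI)
      fix s assume s: "s \<in> S \<inter> {of_rat p<..<of_rat q}"
      then have "\<bar>s - t\<bar> < e" using p q by auto
      then show "s \<in> {t}" using e s by auto
    qed (use t p q in auto)
    then have "t \<in> W (p, q)" using t by (simp add: W_def)
    then show "t \<in> (\<Union>pq. W pq)" by blast
  qed
  moreover have "countable (W pq)" for pq
  proof (cases pq)
    case (Pair p q)
    have "s = t" if "s \<in> W pq" "t \<in> W pq" for s t
      using that unfolding Pair W_def by auto
    then have "W pq \<subseteq> {SOME t. t \<in> W pq}"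
      by (metis singletonI someI_ex subsetI)
    then show ?thesis by (rule countable_subset) simp
  qed
  ultimately show ?thesis
    by (meson countable_UN countable_subset countableI_type)
qed

lemma isolated_simple_zero:
  fixes H :: "real \<Rightarrow> real"
  assumes "(H has_real_derivative l) (at t)" "l \<noteq> 0" "H t = 0"
  shows "\<exists>e>0. \<forall>s. \<bar>s - t\<bar> < e \<and> H s = 0 \<longrightarrow> s = t"
proof -
  have "((\<lambda>s. (H s - H t) / (s - t)) \<longlongrightarrow> l) (at t)"
    using assms(1) by (simp add: has_field_derivative_iff)
  then have "\<forall>\<^sub>F s in at t. (H s - H t) / (s - t) \<noteq> 0"
    using assms(2) by (rule tendsto_imp_eventually_ne)
  then obtain e where "e > 0" "\<And>s. s \<noteq> t \<Longrightarrow> dist s t < e \<Longrightarrow> (H s - H t) / (s - t) \<noteq> 0"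
    unfolding eventually_at by auto
  then show ?thesis using assms(3)
    by (intro exI[of _ e]) (auto simp: dist_real_def)
qed

lemma real_mvt:
  fixes f f' :: "real \<Rightarrow> real"
  assumes "a < b" "continuous_on {a..b} f"
    and "\<And>x. a < x \<Longrightarrow> x < b \<Longrightarrow> (f has_real_derivative f' x) (at x)"
  shows "\<exists>q. a < q \<and> q < b \<and> f b - f a = (b - a) * f' q"
proof -
  obtain q where "q \<in> {a<..<b}" "f b - f a = (*) (f' q) (b - a)"
    using mvt[OF assms(1,2), of "\<lambda>x. (*) (f' x)"] assms(3)
    by (metis greaterThanLessThan_iff has_field_derivative_def)
  then show ?thesis by (auto simp: mult.commute)
qed

text \<open>Between a point of \<open>U\<close> and a point outside \<open>U\<close> there is a nearest point outside \<open>U\<close>. There \<open>H\<close> is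
  \<open>0\<close>, and the mean value theorem applies on the interval in \<open>U\<close> that remains.\<close>

lemma Lipschitz_from_vanishing_set:
  fixes H :: "real \<Rightarrow> real"
  assumes cd: "continuous_on {c..d} H" and zero: "\<And>t. t \<in> {c<..<d} - U \<Longrightarrow> H t = 0"
    and U: "open U"
    and der: "\<And>t. t \<in> U \<Longrightarrow> (H has_real_derivative H' t) (at t)"
    and bd: "\<And>t. t \<in> U \<Longrightarrow> \<bar>H' t\<bar> \<le> L"
    and L: "L \<ge> 0"
    and t: "t \<in> {c<..<d} - U" and s: "s \<in> {c<..<d}"
  shows "\<bar>H s\<bar> \<le> L * \<bar>s - t\<bar>"
proof (cases "s \<in> U")
  case False
  then show ?thesis using zero[of s] s L by auto
next
  case True
  show ?thesis
  proof (cases "t < s")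
    case True
    have "compact ({t..s} - U)" using U by (simp add: compact_diff)
    moreover have "t \<in> {t..s} - U" using True t by auto
    ultimately obtain r where r: "r \<in> {t..s} - U" "\<And>q. q \<in> {t..s} - U \<Longrightarrow> q \<le> r"
      using compact_attains_sup by (metis empty_iff)
    have rs: "r < s" using r \<open>s \<in> U\<close> by (metis DiffE atLeastAtMost_iff le_less)
    have inU: "q \<in> U" if "r < q" "q < s" for q
      using r(2)[of q] that r(1) by auto
    have "continuous_on {r..s} H" by (rule continuous_on_subset[OF cd]) (use t s r in auto)
    then obtain q where q: "r < q" "q < s" "H s - H r = (s - r) * H' q"
      using real_mvt[OF rs _ der[OF inU]] by blast
    have "H r = 0" using zero[of r] r t s rs by auto
    then have "\<bar>H s\<bar> = \<bar>s - r\<bar> * \<bar>H' q\<bar>" using q by (simp add: abs_mult)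
    also have "\<dots> \<le> \<bar>s - t\<bar> * L"
      using bd[OF inU[OF q(1,2)]] r rs by (intro mult_mono) auto
    finally show ?thesis by (simp add: mult.commute)
  next
    case False
    then have True: "s < t" using t \<open>s \<in> U\<close> by (cases "s = t") auto
    have "compact ({s..t} - U)" using U by (simp add: compact_diff)
    moreover have "t \<in> {s..t} - U" using True t by auto
    ultimately obtain r where r: "r \<in> {s..t} - U" "\<And>q. q \<in> {s..t} - U \<Longrightarrow> r \<le> q"
      using compact_attains_inf by (metis empty_iff)
    have rs: "s < r" using r \<open>s \<in> U\<close> by (metis DiffE atLeastAtMost_iff le_less)
    have inU: "q \<in> U" if "s < q" "q < r" for q
      using r(2)[of q] that r(1) by auto
    have "continuous_on {s..r} H" by (rule continuous_on_subset[OF cd]) (use t s r in auto)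
    then obtain q where q: "s < q" "q < r" "H r - H s = (r - s) * H' q"
      using real_mvt[OF rs _ der[OF inU]] by blast
    have "H r = 0" using zero[of r] r t s rs by auto
    then have "\<bar>H s\<bar> = \<bar>r - s\<bar> * \<bar>H' q\<bar>" using q by (metis abs_minus_cancel abs_mult diff_0)
    also have "\<dots> \<le> \<bar>s - t\<bar> * L"
      using bd[OF inU[OF q(1,2)]] r rs by (intro mult_mono) auto
    finally show ?thesis by (simp add: mult.commute)
  qed
qed

text \<open>The fundamental theorem of calculus on a line section of the domain. Such a section may have
  infinitely many components, with endpoints that form a Cantor set, because the curve \<open>\<sigma>\<close> may oscillate
  around the line; what helps is that \<open>H\<close> vanishes at all these endpoints, so that the extension of \<open>H\<close>
  by \<open>0\<close> is Lipschitz.\<close>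

lemma has_integral_derivative_vanishing_off_open:
  fixes H :: "real \<Rightarrow> real"
  assumes cd: "c \<le> d" and cont: "continuous_on {c..d} H"
    and U: "open U" "U \<subseteq> {c<..<d}"
    and zero: "\<And>t. t \<in> {c<..<d} - U \<Longrightarrow> H t = 0"
    and der: "\<And>t. t \<in> U \<Longrightarrow> (H has_real_derivative H' t) (at t)"
    and bd: "\<And>t. t \<in> U \<Longrightarrow> \<bar>H' t\<bar> \<le> L"
  shows "((\<lambda>t. if t \<in> U then H' t else 0) has_integral (H d - H c)) {c..d}"
proof -
  define L' where "L' = max L 0"
  have bd': "\<bar>H' t\<bar> \<le> L'" if "t \<in> U" for t using bd[OF that] by (simp add: L'_def)
  have L': "L' \<ge> 0" by (simp add: L'_def)
  \<comment> \<open>\<open>\<eta> e\<close> approximates the identity and has a triple zero at \<open>0\<close>: this makes \<open>\<eta> e \<circ> H\<close> differentiable also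
      off \<open>U\<close>, where \<open>H\<close> need not be. Its derivative \<open>\<delta> e\<close> is bounded uniformly in \<open>e\<close>.\<close>
  define \<eta> where "\<eta> e s = s ^ 3 / (s\<^sup>2 + e)" for e s :: real
  define \<delta> where "\<delta> e s = ((s\<^sup>2)\<^sup>2 + 3 * e * s\<^sup>2) / (s\<^sup>2 + e)\<^sup>2" for e s :: real
  have pos: "s\<^sup>2 + e > 0" if "e > 0" for s e :: real using that by (simp add: add_nonneg_pos)
  have \<eta>_der: "(\<eta> e has_real_derivative \<delta> e s) (at s)" if "e > 0" for e s
  proof -
    have "(\<eta> e has_real_derivative ((3 * s\<^sup>2) * (s\<^sup>2 + e) - s ^ 3 * (2 * s)) / ((s\<^sup>2 + e) * (s\<^sup>2 + e))) (at s)"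
      unfolding \<eta>_def using pos[OF that, of s]
      by (auto intro!: derivative_eq_intros simp: numeral_2_eq_2)
    moreover have "(3 * s\<^sup>2) * (s\<^sup>2 + e) - s ^ 3 * (2 * s) = (s\<^sup>2)\<^sup>2 + 3 * e * s\<^sup>2"
      by algebra
    ultimately show ?thesis by (simp add: \<delta>_def power2_eq_square)
  qed
  have \<delta>_bd: "\<bar>\<delta> e s\<bar> \<le> 3" if "e > 0" for e s
  proof -
    have "3 * (s\<^sup>2 + e)\<^sup>2 - ((s\<^sup>2)\<^sup>2 + 3 * e * s\<^sup>2) = 2 * (s\<^sup>2)\<^sup>2 + 3 * (e * s\<^sup>2) + 3 * e\<^sup>2"
      by algebra
    moreover have "0 \<le> e * s\<^sup>2" using that by simp
    moreover have "0 \<le> (s\<^sup>2)\<^sup>2" "0 \<le> e\<^sup>2" by simp_all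
    ultimately have "(s\<^sup>2)\<^sup>2 + 3 * e * s\<^sup>2 \<le> 3 * (s\<^sup>2 + e)\<^sup>2" "0 \<le> (s\<^sup>2)\<^sup>2 + 3 * e * s\<^sup>2"
      by linarith+
    then show ?thesis unfolding \<delta>_def using pos[OF that, of s]
      by (simp add: abs_of_nonneg divide_le_eq)
  qed
  define e where "e n = inverse (real (Suc n))" for n
  have e: "e n > 0" for n by (simp add: e_def)
  have e0: "e \<longlonglongrightarrow> 0" unfolding e_def by (rule LIMSEQ_inverse_real_of_nat)
  define f where "f n t = (if t \<in> U then \<delta> (e n) (H t) * H' t else 0)" for n t
  have fint: "(f n has_integral (\<eta> (e n) (H d) - \<eta> (e n) (H c))) {c..d}" for n
  proof (rule fundamental_theorem_of_calculus_interior[OF cd])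
    show "continuous_on {c..d} (\<lambda>t. \<eta> (e n) (H t))"
      unfolding \<eta>_def using pos[OF e] by (intro continuous_intros cont) (metis less_irrefl)
    fix t assume t: "t \<in> {c<..<d}"
    show "((\<lambda>t. \<eta> (e n) (H t)) has_vector_derivative f n t) (at t)"
    proof (cases "t \<in> U")
      case True
      then show ?thesis
        using DERIV_chain2[OF \<eta>_der[OF e] der[OF True]]
        by (simp add: f_def has_real_derivative_iff_has_vector_derivative)
    next
      case False
      have "\<forall>\<^sub>F s in at t. norm (\<eta> (e n) (H s) - \<eta> (e n) (H t)) \<le> L' ^ 3 / e n * \<bar>s - t\<bar> ^ 3"
      proof -
        have "\<forall>\<^sub>F s in at t. s \<in> {c<..<d}"
          using t by (intro eventually_at_in_open') auto
        then show ?thesis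
        proof eventually_elim
          case (elim s)
          have "\<bar>H s\<bar> \<le> L' * \<bar>s - t\<bar>"
            by (rule Lipschitz_from_vanishing_set[OF cont zero U(1) der bd' L']) (use t False elim in auto)
          then have "\<bar>H s\<bar> ^ 3 \<le> (L' * \<bar>s - t\<bar>) ^ 3" by (rule power_mono) simp
          then have "\<bar>H s\<bar> ^ 3 / ((H s)\<^sup>2 + e n) \<le> (L' * \<bar>s - t\<bar>) ^ 3 / e n"
            using e[of n] L' by (intro frac_le) auto
          then show ?case using zero[of t] t False pos[OF e, of "H s" n]
            by (simp add: \<eta>_def power_mult_distrib power_abs)
        qed
      qed
      moreover have "((\<lambda>s. L' ^ 3 / e n * \<bar>s - t\<bar> ^ 3 / \<bar>s - t\<bar>) \<longlongrightarrow> 0) (at t)"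
      proof -
        have "((\<lambda>s. L' ^ 3 / e n * \<bar>s - t\<bar> ^ 2) \<longlongrightarrow> L' ^ 3 / e n * \<bar>t - t\<bar> ^ 2) (at t)"
          by (intro tendsto_intros)
        then have *: "((\<lambda>s. L' ^ 3 / e n * \<bar>s - t\<bar> ^ 2) \<longlongrightarrow> 0) (at t)" by simp
        show ?thesis
          by (rule Lim_transform_eventually[OF *])
            (auto simp: eventually_at_filter power2_eq_square power3_eq_cube)
      qed
      ultimately have "((\<lambda>s. (\<eta> (e n) (H s) - \<eta> (e n) (H t)) / (s - t)) \<longlongrightarrow> 0) (at t)"
      proof (rule_tac Lim_null_comparison[where g = "\<lambda>s. L' ^ 3 / e n * \<bar>s - t\<bar> ^ 3 / \<bar>s - t\<bar>"])
        assume "\<forall>\<^sub>F s in at t. norm (\<eta> (e n) (H s) - \<eta> (e n) (H t)) \<le> L' ^ 3 / e n * \<bar>s - t\<bar> ^ 3"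
        then show "\<forall>\<^sub>F s in at t. norm ((\<eta> (e n) (H s) - \<eta> (e n) (H t)) / (s - t))
            \<le> L' ^ 3 / e n * \<bar>s - t\<bar> ^ 3 / \<bar>s - t\<bar>"
          by eventually_elim (simp only: real_norm_def abs_divide divide_right_mono abs_ge_zero)
      qed simp
      then show ?thesis using False
        by (simp add: f_def has_real_derivative_iff_has_vector_derivative[symmetric] has_field_derivative_iff)
    qed
  qed
  \<comment> \<open>\<open>\<delta> e (H t)\<close> tends to \<open>1\<close> if \<open>H t \<noteq> 0\<close> but is \<open>0\<close> if \<open>H t = 0\<close>; zeros with nonzero derivative are isolated,
      so the pointwise limit differs from the derivative on a countable set only.\<close>
  define g where "g t = (if t \<in> U \<and> H t \<noteq> 0 then H' t else 0)" for t
  have lim: "(\<lambda>n. f n t) \<longlonglongrightarrow> g t" for t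
  proof (cases "t \<in> U \<and> H t \<noteq> 0")
    case True
    have "(\<lambda>n. \<delta> (e n) (H t) * H' t) \<longlonglongrightarrow> (((H t)\<^sup>2)\<^sup>2 + 3 * 0 * (H t)\<^sup>2) / ((H t)\<^sup>2 + 0)\<^sup>2 * H' t"
      unfolding \<delta>_def using True by (intro tendsto_intros e0) auto
    then show ?thesis using True by (simp add: f_def g_def)
  next
    case False
    then have "f n t = 0" for n by (auto simp: f_def \<delta>_def)
    moreover have "g t = 0" using False by (auto simp: g_def)
    ultimately show ?thesis by simp
  qed
  have "(\<lambda>n. \<eta> (e n) x) \<longlonglongrightarrow> x" for x
  proof (cases "x = 0")
    case False
    have "(\<lambda>n. \<eta> (e n) x) \<longlonglongrightarrow> x ^ 3 / (x\<^sup>2 + 0)"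
      unfolding \<eta>_def using False by (intro tendsto_intros e0) auto
    then show ?thesis using False by (simp add: power2_eq_square power3_eq_cube)
  qed (simp add: \<eta>_def)
  then have "(\<lambda>n. \<eta> (e n) (H d) - \<eta> (e n) (H c)) \<longlonglongrightarrow> H d - H c" by (intro tendsto_intros)
  moreover have "\<bar>f k x\<bar> \<le> 3 * L'" for k x
    using mult_mono[OF \<delta>_bd[OF e, of k "H x"] bd'[of x]] L' by (auto simp: f_def abs_mult)
  ultimately have "(g has_integral (H d - H c)) {c..d}"
    by (intro has_integral_dominated_convergence[where f = f and h = "\<lambda>_. 3 * L'", OF fint])
      (auto simp: lim)
  moreover have "countable {t \<in> U. H t = 0 \<and> H' t \<noteq> 0}"
  proof (rule countable_isolated_real)
    fix t assume "t \<in> {t \<in> U. H t = 0 \<and> H' t \<noteq> 0}"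
    then show "\<exists>e>0. \<forall>s\<in>{t \<in> U. H t = 0 \<and> H' t \<noteq> 0}. \<bar>s - t\<bar> < e \<longrightarrow> s = t"
      using isolated_simple_zero[OF der, of t] by fast
  qed
  then have "negligible (\<Union>((\<lambda>t. {t}) ` {t \<in> U. H t = 0 \<and> H' t \<noteq> 0}))"
    by (intro negligible_countable_Union) auto
  then have "negligible {t \<in> U. H t = 0 \<and> H' t \<noteq> 0}" by simp
  ultimately show ?thesis
    by (rule_tac has_integral_spike[of "{t \<in> U. H t = 0 \<and> H' t \<noteq> 0}" _ _ g]) (auto simp: g_def)
qed

text \<open>The integral of the gradient along a path that may lie in the boundary, where \<open>u\<close> need not be
  differentiable: the path is the limit for \<open>d \<rightarrow> 0\<close> of paths inside \<open>W\<close>, and both sides are continuous in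
  \<open>d\<close>.\<close>

lemma boundary_path_integral:
  fixes u g1 g2 :: "real \<times> real \<Rightarrow> real" and \<Gamma>1 \<Gamma>2 \<Gamma>1' \<Gamma>2' :: "real \<Rightarrow> real \<Rightarrow> real"
  assumes u: "continuous_on K u" and g: "continuous_on K g1" "continuous_on K g2"
    and der: "\<And>z. z \<in> W \<Longrightarrow> (u has_derivative (\<lambda>h. g1 z * fst h + g2 z * snd h)) (at z)"
    and W: "W \<subseteq> K" and st: "s \<le> t" and d0: "d0 > 0"
    and inK: "\<And>d r. 0 \<le> d \<Longrightarrow> d \<le> d0 \<Longrightarrow> r \<in> {s..t} \<Longrightarrow> (\<Gamma>1 d r, \<Gamma>2 d r) \<in> K"
    and inW: "\<And>d r. 0 < d \<Longrightarrow> d \<le> d0 \<Longrightarrow> r \<in> {s..t} \<Longrightarrow> (\<Gamma>1 d r, \<Gamma>2 d r) \<in> W"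
    and \<Gamma>: "continuous_on ({0..d0} \<times> {s..t}) (\<lambda>(d, r). \<Gamma>1 d r)"
            "continuous_on ({0..d0} \<times> {s..t}) (\<lambda>(d, r). \<Gamma>2 d r)"
    and \<Gamma>': "continuous_on ({0..d0} \<times> {s..t}) (\<lambda>(d, r). \<Gamma>1' d r)"
            "continuous_on ({0..d0} \<times> {s..t}) (\<lambda>(d, r). \<Gamma>2' d r)"
    and d\<Gamma>: "\<And>d r. 0 \<le> d \<Longrightarrow> d \<le> d0 \<Longrightarrow> r \<in> {s..t} \<Longrightarrow> (\<Gamma>1 d has_real_derivative \<Gamma>1' d r) (at r)"
            "\<And>d r. 0 \<le> d \<Longrightarrow> d \<le> d0 \<Longrightarrow> r \<in> {s..t} \<Longrightarrow> (\<Gamma>2 d has_real_derivative \<Gamma>2' d r) (at r)"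
  shows "((\<lambda>r. g1 (\<Gamma>1 0 r, \<Gamma>2 0 r) * \<Gamma>1' 0 r + g2 (\<Gamma>1 0 r, \<Gamma>2 0 r) * \<Gamma>2' 0 r)
            has_integral (u (\<Gamma>1 0 t, \<Gamma>2 0 t) - u (\<Gamma>1 0 s, \<Gamma>2 0 s))) {s..t}"
proof -
  define G where "G d r = g1 (\<Gamma>1 d r, \<Gamma>2 d r) * \<Gamma>1' d r + g2 (\<Gamma>1 d r, \<Gamma>2 d r) * \<Gamma>2' d r" for d r
  define D where "D d = u (\<Gamma>1 d t, \<Gamma>2 d t) - u (\<Gamma>1 d s, \<Gamma>2 d s)" for d
  have \<Gamma>c: "continuous_on ({0..d0} \<times> {s..t}) (\<lambda>x. (\<Gamma>1 (fst x) (snd x), \<Gamma>2 (fst x) (snd x)))"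
    using \<Gamma> by (intro continuous_on_Pair) (auto simp: case_prod_unfold)
  have im: "(\<lambda>x. (\<Gamma>1 (fst x) (snd x), \<Gamma>2 (fst x) (snd x))) ` ({0..d0} \<times> {s..t}) \<subseteq> K"
    using inK by auto
  have comp: "continuous_on ({0..d0} \<times> {s..t}) (\<lambda>x. f (\<Gamma>1 (fst x) (snd x), \<Gamma>2 (fst x) (snd x)))"
    if "continuous_on K f" for f :: "real \<times> real \<Rightarrow> real"
    by (rule continuous_on_compose2[OF that \<Gamma>c im])
  have Gc: "continuous_on ({0..d0} \<times> {s..t}) (\<lambda>(d, r). G d r)"
    unfolding case_prod_unfold G_def
    using \<Gamma>' by (intro continuous_on_add continuous_on_mult comp g) (auto simp: case_prod_unfold)
  have Ic: "continuous_on {0..d0} (\<lambda>d. integral {s..t} (G d))"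
    using integral_continuous_on_param[of "{0..d0}" s t G] Gc by simp
  have at: "continuous_on {0..d0} (\<lambda>d. u (\<Gamma>1 d r, \<Gamma>2 d r))" if "r \<in> {s..t}" for r
  proof -
    have "continuous_on {0..d0} (\<lambda>d. (\<lambda>x. u (\<Gamma>1 (fst x) (snd x), \<Gamma>2 (fst x) (snd x))) (d, r))"
      by (rule continuous_on_compose2[OF comp[OF u]]) (use that in \<open>auto intro!: continuous_intros\<close>)
    then show ?thesis by simp
  qed
  have Dc: "continuous_on {0..d0} D"
    unfolding D_def using at st by (intro continuous_on_diff) auto
  have eq: "integral {s..t} (G d) = D d" if d: "0 < d" "d \<le> d0" for d
  proof (rule integral_unique)
    have "((\<lambda>r. u (\<Gamma>1 d r, \<Gamma>2 d r)) has_vector_derivative G d r) (at r within {s..t})"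
      if r: "r \<in> {s..t}" for r
    proof -
      have "((\<lambda>r. (\<Gamma>1 d r, \<Gamma>2 d r)) has_derivative (\<lambda>h. (\<Gamma>1' d r * h, \<Gamma>2' d r * h))) (at r)"
        using d\<Gamma>[of d r] d r by (intro has_derivative_Pair) (auto simp: has_field_derivative_def)
      from has_derivative_compose[OF this der[OF inW[OF d r]]]
      have "((\<lambda>r. u (\<Gamma>1 d r, \<Gamma>2 d r)) has_derivative (\<lambda>h. G d r * h)) (at r)"
        by (simp add: G_def algebra_simps)
      then show ?thesis
        by (metis has_field_derivative_def has_real_derivative_iff_has_vector_derivative
            has_vector_derivative_at_within)
    qed
    then show "(G d has_integral D d) {s..t}"
      unfolding D_def using fundamental_theorem_of_calculus[OF st, of "\<lambda>r. u (\<Gamma>1 d r, \<Gamma>2 d r)" "G d"] by blast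
  qed
  have "((\<lambda>d. integral {s..t} (G d)) \<longlongrightarrow> integral {s..t} (G 0)) (at 0 within {0..d0})"
    using Ic d0 by (simp add: continuous_on_def)
  moreover have "(D \<longlongrightarrow> D 0) (at 0 within {0..d0})"
    using Dc d0 by (simp add: continuous_on_def)
  moreover have "\<forall>\<^sub>F d in at 0 within {0..d0}. integral {s..t} (G d) = D d"
    using eq by (auto simp: eventually_at_filter)
  moreover have "at 0 within {0..d0} \<noteq> bot"
    using d0 by (simp add: at_within_Icc_at_right)
  ultimately have "integral {s..t} (G 0) = D 0"
    using tendsto_unique[of "at 0 within {0..d0}" D "integral {s..t} (G 0)" "D 0"]
      tendsto_cong[of "\<lambda>d. integral {s..t} (G d)" D "at 0 within {0..d0}"] by blast
  moreover have "continuous_on {s..t} (\<lambda>r. (\<lambda>(d, r). G d r) (0, r))"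
    by (rule continuous_on_compose2[OF Gc]) (use d0 in \<open>auto intro!: continuous_intros\<close>)
  then have "G 0 integrable_on {s..t}" by (simp add: integrable_continuous_real)
  ultimately show ?thesis unfolding D_def G_def
    by (simp add: has_integral_iff)
qed

lemma lborel_integral_diagonal_scaling:
  fixes \<phi> :: "real \<times> real \<Rightarrow> real"
  assumes pq: "p > 0" "q > 0" and \<phi>[measurable]: "\<phi> \<in> borel_measurable borel"
  shows "(LINT z|lborel. \<phi> (p * fst z, q * snd z)) = (LINT z|lborel. \<phi> z) / (p * q)"
proof -
  define c :: "real \<times> real \<Rightarrow> real" where "c j = (if j = (1, 0) then p else q)" for j
  define T :: "real \<times> real \<Rightarrow> real \<times> real" where "T x = 0 + (\<Sum>j\<in>Basis. (c j * (x \<bullet> j)) *\<^sub>R j)" for x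
  have B: "(Basis :: (real \<times> real) set) = {(1, 0), (0, 1)}"
    by (auto simp: Basis_prod_def)
  have T: "T x = (p * fst x, q * snd x)" for x
    unfolding T_def B by (cases x) (auto simp: c_def)
  have Tm[measurable]: "T \<in> borel \<rightarrow>\<^sub>M borel"
    unfolding T_def by (intro borel_measurable_continuous_onI continuous_intros)
  have l: "(lborel :: (real \<times> real) measure) = density (distr lborel borel T) (\<lambda>_. ennreal (p * q))"
    using lborel_affine_euclidean[where c = c and t = 0] pq
    unfolding T_def[abs_def, symmetric] by (simp add: B c_def)
  have "(LINT z|lborel. \<phi> z) = (LINT z|density (distr lborel borel T) (\<lambda>_. ennreal (p * q)). \<phi> z)"
    using l by simp
  also have "\<dots> = (LINT z|distr lborel borel T. (p * q) *\<^sub>R \<phi> z)"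
    using pq by (intro integral_density) auto
  also have "\<dots> = (LINT z|lborel. (p * q) *\<^sub>R \<phi> (T z))"
    by (intro integral_distr) auto
  also have "\<dots> = (p * q) * (LINT z|lborel. \<phi> (T z))" by simp
  finally show ?thesis using pq by (simp add: T field_simps)
qed

lemma lborel_integral_eq_HK:
  fixes f :: "real \<Rightarrow> real"
  assumes f: "f \<in> borel_measurable borel" and bd: "\<And>t. \<bar>f t\<bar> \<le> L"
    and supp: "\<And>t. t \<notin> {c..d} \<Longrightarrow> f t = 0" and J: "(f has_integral J) {c..d}"
  shows "(LINT t|lborel. f t) = J"
proof -
  have fin: "emeasure lborel {c..d} < \<infinity>" by (rule emeasure_bounded_finite) simp
  have "integrable lborel f"
    by (rule integrableI_bounded_set[where A = "{c..d}" and B = L, OF _ _ fin]) (use f bd supp in auto)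
  then have "(f has_integral (LINT t|lborel. f t)) UNIV" by (rule has_integral_integral_lborel)
  moreover have "(f has_integral J) UNIV"
    by (rule has_integral_on_superset[OF J]) (use supp in auto)
  ultimately show ?thesis by (rule has_integral_unique)
qed

lemma FTC_converse:
  fixes g \<phi> :: "real \<Rightarrow> real"
  assumes int: "\<And>s t. a < s \<Longrightarrow> s \<le> t \<Longrightarrow> t < b \<Longrightarrow> (g has_integral (\<phi> t - \<phi> s)) {s..t}"
    and g: "continuous_on {a<..<b} g" and x: "a < x" "x < b"
  shows "(\<phi> has_real_derivative g x) (at x)"
proof -
  define s t where "s = (a + x) / 2" and "t = (x + b) / 2"
  have st: "a < s" "s < x" "x < t" "t < b" using x by (auto simp: s_def t_def)
  have "continuous_on {s..t} g" by (rule continuous_on_subset[OF g]) (use st in auto)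
  then have "((\<lambda>r. integral {s..r} g) has_real_derivative g x) (at x within {s..t})"
    by (rule integral_has_real_derivative) (use st in auto)
  moreover have "at x within {s..t} = at x" using st by (intro at_within_interior) auto
  ultimately have "((\<lambda>r. integral {s..r} g) has_real_derivative g x) (at x)" by simp
  then have "((\<lambda>r. \<phi> s + integral {s..r} g) has_real_derivative g x) (at x)"
    by (auto intro!: derivative_eq_intros)
  moreover have "\<forall>\<^sub>F r in nhds x. r \<in> {s<..<t}" using st by (intro eventually_nhds_in_open) auto
  then have "\<forall>\<^sub>F r in nhds x. \<phi> s + integral {s..r} g = \<phi> r"
  proof eventually_elim
    case (elim r)
    then have "integral {s..r} g = \<phi> r - \<phi> s" using int[of s r] st by (intro integral_unique) auto
    then show ?case by simp
  qed
  ultimately show ?thesis using DERIV_cong_ev[OF refl _ refl] by metis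
qed

lemma one_minus_power_le:
  fixes s :: real
  assumes "0 \<le> s" "s \<le> 1"
  shows "1 - s ^ n \<le> real n * (1 - s)"
  using Bernoulli_inequality[of "s - 1" n] assms by (simp add: algebra_simps)

lemma partial_derivatives:
  fixes \<phi> :: "real \<times> real \<Rightarrow> real"
  assumes "(\<phi> has_derivative (\<lambda>h. p * fst h + q * snd h)) (at z)"
  shows "((\<lambda>s. \<phi> (s, snd z)) has_real_derivative p) (at (fst z))"
    and "((\<lambda>s. \<phi> (fst z, s)) has_real_derivative q) (at (snd z))"
proof -
  have "((\<lambda>s. (s, snd z)) has_derivative (\<lambda>h. (h, 0))) (at (fst z))"
    by (auto intro!: derivative_eq_intros)
  from has_derivative_compose[OF this, of \<phi> "\<lambda>h. p * fst h + q * snd h"] assms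
  have "((\<lambda>s. \<phi> (s, snd z)) has_derivative (\<lambda>h. p * h)) (at (fst z))" by simp
  then show "((\<lambda>s. \<phi> (s, snd z)) has_real_derivative p) (at (fst z))"
    by (simp add: has_field_derivative_def)
  have "((\<lambda>s. (fst z, s)) has_derivative (\<lambda>h. (0, h))) (at (snd z))"
    by (auto intro!: derivative_eq_intros)
  from has_derivative_compose[OF this, of \<phi> "\<lambda>h. p * fst h + q * snd h"] assms
  have "((\<lambda>s. \<phi> (fst z, s)) has_derivative (\<lambda>h. q * h)) (at (snd z))" by simp
  then show "((\<lambda>s. \<phi> (fst z, s)) has_real_derivative q) (at (snd z))"
    by (simp add: has_field_derivative_def)
qed

lemma combine_energy_inequalities:
  fixes a b c c' j b' A D :: real
  assumes "- D \<le> c - 2 * (j + b') + A" "c \<le> c'" "b \<le> b'" "a \<le> j"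
  shows "2 * a + 2 * b \<le> c' + A + D"
  using assms by argo

lemma power_strict_mono_odd: "odd n \<Longrightarrow> a < b \<Longrightarrow> a ^ n < (b :: real) ^ n"
  by (metis antisym_conv2 less_imp_le odd_real_root_power_cancel power_mono_odd less_irrefl)

lemma partial_derivative_representation:
  fixes \<phi> :: "real \<times> real \<Rightarrow> real"
  assumes "\<phi> differentiable (at z)"
  shows "(\<phi> has_derivative (\<lambda>h. partial_x \<phi> z * fst h + partial_y \<phi> z * snd h)) (at z)"
proof -
  obtain D where D: "(\<phi> has_derivative D) (at z)" using assms by (auto simp: differentiable_def)
  then have "linear D" by (simp add: has_derivative_linear)
  have rep: "D = (\<lambda>h. D (1, 0) * fst h + D (0, 1) * snd h)"
  proof
    fix h :: "real \<times> real"
    have h: "fst h *\<^sub>R (1, 0) + snd h *\<^sub>R (0, 1) = h" by (cases h) simp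
    have "D (fst h *\<^sub>R (1, 0) + snd h *\<^sub>R (0, 1)) = fst h *\<^sub>R D (1, 0) + snd h *\<^sub>R D (0, 1)"
      by (simp only: linear_add[OF \<open>linear D\<close>] linear_scale[OF \<open>linear D\<close>])
    then show "D h = D (1, 0) * fst h + D (0, 1) * snd h"
      unfolding h by (simp add: mult.commute)
  qed
  have D': "(\<phi> has_derivative (\<lambda>h. D (1, 0) * fst h + D (0, 1) * snd h)) (at z)"
    using D rep by simp
  have "partial_x \<phi> z = D (1, 0)" "partial_y \<phi> z = D (0, 1)"
    using partial_derivatives[OF D'] by (auto simp: partial_x_def partial_y_def case_prod_unfold DERIV_imp_deriv)
  then show ?thesis using D' by simp
qed

lemma extends_continuouslyE:
  assumes "extends_continuously \<Omega> \<phi>"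
  obtains g where "continuous_on (closure \<Omega>) g" "\<And>z. z \<in> \<Omega> \<Longrightarrow> g z = \<phi> z"
  using assms by (auto simp: extends_continuously_def)

section \<open>Geometry of the Tricomi domain\<close>

text \<open>The dilations \<open>dil t (x, y) = (t\<^bsup>wx\<^esup> x, t\<^bsup>wy\<^esup> y)\<close> with \<open>wx = m1 + 2\<close> and \<open>wy = m2 + 2\<close> are the flow of \<open>D\<close> at
  time \<open>- ln t\<close>, and the operator is homogeneous under them. In the lower half-plane the functions
  \<open>\<xi>\<close> of \<open>y\<close> and \<open>\<eta>\<close> of \<open>x\<close> are characteristic coordinates up to a constant factor: \<open>BC\<close> lies on \<open>\<xi> = \<eta>\<close>, \<open>AC\<close> on
  \<open>\<xi> + \<eta> = \<eta>0\<close>, and both are multiplied by the same power of \<open>t\<close> under \<open>dil t\<close>. The inverse function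
  of \<open>\<xi>\<close> on the negative half-line is \<open>\<zeta>\<close>.\<close>

locale tricomi_geometry =
  fixes m1 m2 :: nat and x0 :: real and \<sigma> \<Omega> :: "(real \<times> real) set"
  assumes m1_odd: "odd m1" and m2_even: "even m2" and m2_half_even: "even (m2 div 2)"
    and dom: "tricomi_domain m1 m2 x0 \<sigma> \<Omega>"
    and star: "D_star_shaped m1 m2 \<Omega>"
begin

definition wx :: nat where "wx = m1 + 2"
definition wy :: nat where "wy = m2 + 2"
definition half_wy :: nat where "half_wy = (m2 + 2) div 2"

lemma weights: "odd half_wy" "half_wy > 0" "wy = 2 * half_wy" "wx > 2" "wy > 0" "wx > 0" "wy \<ge> 2"
  using m1_odd m2_even m2_half_even by (auto simp: half_wy_def wy_def wx_def elim!: evenE oddE)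

lemma zero_powers[simp]: "(0 :: real) ^ wx = 0" "(0 :: real) ^ wy = 0" "(0 :: real) ^ (wx * half_wy) = 0"
  using weights by (simp_all add: zero_power)

definition \<eta> :: "real \<Rightarrow> real" where "\<eta> x = - (x ^ half_wy)"
definition \<eta>0 :: real where "\<eta>0 = \<eta> (2 * x0)"
definition \<xi> :: "real \<Rightarrow> real" where "\<xi> y = real wy / real wx * (- y) powr (real wx / 2)"
definition \<zeta> :: "real \<Rightarrow> real" where "\<zeta> c = - ((real wx / real wy * c) powr (2 / real wx))"
definition dil :: "real \<Rightarrow> real \<times> real \<Rightarrow> real \<times> real" where
  "dil t z = (t ^ wx * fst z, t ^ wy * snd z)"
definition xC :: real where "xC = - root half_wy (\<eta>0 / 2)"
definition yC :: real where "yC = \<zeta> (\<eta>0 / 2)"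

abbreviation "AC \<equiv> char_AC m1 m2 x0"
abbreviation "BC \<equiv> char_BC m1 m2 x0"

lemma x0: "x0 < 0" and open_\<Omega>: "open \<Omega>" and bounded_\<Omega>: "bounded \<Omega>"
  and frontier_\<Omega>: "frontier \<Omega> = \<sigma> \<union> AC \<union> BC"
  using dom by (auto simp: tricomi_domain_def)

lemma \<sigma>_pos: "z \<in> \<sigma> \<Longrightarrow> snd z > 0 \<or> z = (2 * x0, 0) \<or> z = (0, 0)"
  using dom by (cases z) (auto simp: tricomi_domain_def)

lemma \<sigma>_nonneg: "z \<in> \<sigma> \<Longrightarrow> snd z \<ge> 0"
  using \<sigma>_pos[of z] by auto

lemma closure_eq: "closure \<Omega> = \<Omega> \<union> (\<sigma> \<union> AC \<union> BC)" and disjoint_frontier: "\<Omega> \<inter> (\<sigma> \<union> AC \<union> BC) = {}"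
  using frontier_\<Omega> open_\<Omega> closure_Un_frontier[of \<Omega>] frontier_disjoint_eq[of \<Omega>] by auto

lemma \<eta>_strict: "x < x' \<Longrightarrow> \<eta> x' < \<eta> x"
  unfolding \<eta>_def using power_strict_mono_odd[OF weights(1)] by simp

lemma \<eta>_le_iff: "\<eta> x \<le> \<eta> x' \<longleftrightarrow> x' \<le> x" and \<eta>_less_iff: "\<eta> x < \<eta> x' \<longleftrightarrow> x' < x"
  using \<eta>_strict by (metis linorder_not_le less_le_not_le antisym_conv3 less_irrefl)+

lemma \<eta>_0[simp]: "\<eta> 0 = 0" using weights by (simp add: \<eta>_def)

lemma \<eta>0_pos: "\<eta>0 > 0" unfolding \<eta>0_def using \<eta>_strict[of "2 * x0" 0] x0 by simp

lemma \<eta>_xC: "\<eta> xC = \<eta>0 / 2"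
  unfolding \<eta>_def xC_def using weights by (simp add: odd_real_root_pow)

lemma xC_bounds: "2 * x0 < xC" "xC < 0"
  using \<eta>_less_iff[of xC "2 * x0"] \<eta>_less_iff[of 0 xC] \<eta>_xC \<eta>0_pos by (auto simp: \<eta>0_def[symmetric])

lemma \<xi>_nonneg: "\<xi> y \<ge> 0" by (simp add: \<xi>_def)
lemma \<xi>_0[simp]: "\<xi> 0 = 0" by (simp add: \<xi>_def)
lemma \<zeta>_0[simp]: "\<zeta> 0 = 0" by (simp add: \<zeta>_def)

lemma \<zeta>_nonpos: "\<zeta> c \<le> 0" by (simp add: \<zeta>_def)

lemma \<xi>_\<zeta>: "c \<ge> 0 \<Longrightarrow> \<xi> (\<zeta> c) = c"
  unfolding \<xi>_def \<zeta>_def using weights by (simp add: powr_powr)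

lemma \<zeta>_\<xi>: "y \<le> 0 \<Longrightarrow> \<zeta> (\<xi> y) = y"
  unfolding \<xi>_def \<zeta>_def using weights by (simp add: powr_powr)

lemma \<zeta>_strict: "0 \<le> c \<Longrightarrow> c < d \<Longrightarrow> \<zeta> d < \<zeta> c"
  unfolding \<zeta>_def using weights by (auto intro!: powr_less_mono2 divide_strict_right_mono mult_strict_left_mono)

lemma \<xi>_strict: "y < y' \<Longrightarrow> y' \<le> 0 \<Longrightarrow> \<xi> y' < \<xi> y"
proof -
  assume "y < y'" "y' \<le> 0"
  then have "(- y') powr (real wx / 2) < (- y) powr (real wx / 2)" using weights by (intro powr_less_mono2) auto
  moreover have "real wy / real wx > 0" using weights by simp
  ultimately show ?thesis unfolding \<xi>_def by (rule mult_strict_left_mono)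
qed

lemma \<xi>_mono: "y \<le> y' \<Longrightarrow> y' \<le> 0 \<Longrightarrow> \<xi> y' \<le> \<xi> y"
  using \<xi>_strict[of y y'] by (cases "y = y'") auto

lemma \<xi>_pos: "y < 0 \<Longrightarrow> \<xi> y > 0"
  using \<xi>_strict[of y 0] by simp

lemma \<zeta>_neg: "0 < c \<Longrightarrow> \<zeta> c < 0"
  using \<zeta>_strict[of 0 c] by simp

lemma \<xi>_less_iff: "y \<le> 0 \<Longrightarrow> c \<ge> 0 \<Longrightarrow> \<xi> y < c \<longleftrightarrow> \<zeta> c < y"
  by (metis \<xi>_\<zeta> \<xi>_nonneg \<zeta>_\<xi> \<zeta>_strict not_less_iff_gr_or_eq)

lemma \<xi>_le_iff: "y \<le> 0 \<Longrightarrow> c \<ge> 0 \<Longrightarrow> \<xi> y \<le> c \<longleftrightarrow> \<zeta> c \<le> y"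
  by (metis \<xi>_less_iff \<xi>_\<zeta> \<zeta>_\<xi> less_eq_real_def)

lemma yC_neg: "yC < 0" unfolding yC_def using \<zeta>_neg \<eta>0_pos by simp

lemma \<xi>_yC: "\<xi> yC = \<eta>0 / 2" unfolding yC_def using \<xi>_\<zeta> \<eta>0_pos by simp

lemma y_C_eq: "y_C m1 m2 x0 = yC"
  unfolding y_C_def yC_def \<zeta>_def \<eta>0_def \<eta>_def half_wy_def wx_def wy_def by (simp add: algebra_simps)

lemma AC_iff: "(x, y) \<in> AC \<longleftrightarrow> x \<le> 0 \<and> y \<le> 0 \<and> \<xi> y \<le> \<eta>0 / 2 \<and> \<xi> y + \<eta> x = \<eta>0"
proof -
  define p where "p = (- y) powr ((real m1 + 2) / 2)"
  have *: "2 / (real m1 + 2) * p = 2 / (real m2 + 2) * (q - r) \<longleftrightarrow> real wy / real wx * p + - q = - r" for q r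
    unfolding wx_def wy_def by (simp add: field_simps) argo
  have "(x, y) \<in> AC \<longleftrightarrow> x \<le> 0 \<and> yC \<le> y \<and> y \<le> 0 \<and>
      2 / (real m1 + 2) * p = 2 / (real m2 + 2) * (x ^ half_wy - (2 * x0) ^ half_wy)"
    by (simp only: char_AC_def y_C_eq half_wy_def mem_Collect_eq prod.case p_def)
  moreover have "\<xi> y = real wy / real wx * p" by (simp add: \<xi>_def p_def wx_def add.commute)
  moreover have "y \<le> 0 \<Longrightarrow> yC \<le> y \<longleftrightarrow> \<xi> y \<le> \<eta>0 / 2"
    using \<xi>_le_iff[of y "\<eta>0 / 2"] \<eta>0_pos by (simp add: yC_def)
  ultimately show ?thesis unfolding * by (auto simp: \<eta>0_def \<eta>_def)
qed

lemma BC_iff: "(x, y) \<in> BC \<longleftrightarrow> x \<le> 0 \<and> y \<le> 0 \<and> \<xi> y \<le> \<eta>0 / 2 \<and> \<xi> y = \<eta> x"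
proof -
  define p where "p = (- y) powr ((real m1 + 2) / 2)"
  have *: "2 / (real m1 + 2) * p = - (2 / (real m2 + 2)) * q \<longleftrightarrow> real wy / real wx * p = - q" for q
    unfolding wx_def wy_def by (simp add: field_simps) argo
  have "(x, y) \<in> BC \<longleftrightarrow> x \<le> 0 \<and> yC \<le> y \<and> y \<le> 0 \<and>
      2 / (real m1 + 2) * p = - (2 / (real m2 + 2)) * x ^ half_wy"
    by (simp only: char_BC_def y_C_eq half_wy_def mem_Collect_eq prod.case p_def)
  moreover have "\<xi> y = real wy / real wx * p" by (simp add: \<xi>_def p_def wx_def add.commute)
  moreover have "y \<le> 0 \<Longrightarrow> yC \<le> y \<longleftrightarrow> \<xi> y \<le> \<eta>0 / 2"
    using \<xi>_le_iff[of y "\<eta>0 / 2"] \<eta>0_pos by (simp add: yC_def)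
  ultimately show ?thesis unfolding * by (auto simp: \<eta>_def)
qed

lemma C_in: "(xC, yC) \<in> AC" "(xC, yC) \<in> BC"
  using xC_bounds yC_neg \<eta>_xC \<xi>_yC by (auto simp: AC_iff BC_iff)

subsection \<open>The two characteristics as one graph\<close>

text \<open>The ordinate of the lower boundary above the abscissa \<open>x\<close>: the minimum selects \<open>BC\<close> to the right
  of \<open>C\<close> and \<open>AC\<close> to its left.\<close>

definition R :: "real \<Rightarrow> real" where "R x = \<zeta> (min (\<eta> x) (\<eta>0 - \<eta> x))"

lemma \<eta>_range: "2 * x0 \<le> x \<Longrightarrow> x \<le> 0 \<Longrightarrow> 0 \<le> \<eta> x \<and> \<eta> x \<le> \<eta>0"
  using \<eta>_le_iff[of 0 x] \<eta>_le_iff[of x "2 * x0"] by (simp add: \<eta>0_def)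

lemma \<eta>_range': "0 \<le> \<eta> x \<Longrightarrow> \<eta> x \<le> \<eta>0 \<Longrightarrow> 2 * x0 \<le> x \<and> x \<le> 0"
  using \<eta>_le_iff[of 0 x] \<eta>_le_iff[of x "2 * x0"] by (simp add: \<eta>0_def)

lemma \<eta>_range_strict: "0 < \<eta> x \<and> \<eta> x < \<eta>0 \<longleftrightarrow> 2 * x0 < x \<and> x < 0"
  using \<eta>_less_iff[of 0 x] \<eta>_less_iff[of x "2 * x0"] by (auto simp: \<eta>0_def)

lemma AC_BC_graph: "AC \<union> BC = (\<lambda>x. (x, R x)) ` {2 * x0..0}"
proof (intro equalityI subsetI)
  fix z assume z: "z \<in> AC \<union> BC"
  obtain x y where xy: "z = (x, y)" by (cases z)
  have "\<xi> y = min (\<eta> x) (\<eta>0 - \<eta> x)" "y \<le> 0" "0 \<le> \<eta> x \<and> \<eta> x \<le> \<eta>0"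
    using z \<xi>_nonneg[of y] \<eta>0_pos unfolding xy by (auto simp: AC_iff BC_iff)
  then show "z \<in> (\<lambda>x. (x, R x)) ` {2 * x0..0}"
    using \<zeta>_\<xi>[of y] \<eta>_range'[of x] unfolding xy R_def by (intro image_eqI[of _ _ x]) auto
next
  fix z assume "z \<in> (\<lambda>x. (x, R x)) ` {2 * x0..0}"
  then obtain x where x: "z = (x, R x)" "2 * x0 \<le> x" "x \<le> 0" by auto
  have "\<xi> (R x) = min (\<eta> x) (\<eta>0 - \<eta> x)" unfolding R_def using \<eta>_range[OF x(2,3)] by (intro \<xi>_\<zeta>) auto
  then show "z \<in> AC \<union> BC"
    using x \<eta>_range[OF x(2,3)] \<zeta>_nonpos unfolding x(1) Un_iff AC_iff BC_iff by (auto simp: R_def min_def split: if_splits)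
qed

lemma continuous_\<eta>: "continuous_on A \<eta>"
  unfolding \<eta>_def by (intro continuous_intros)

lemma continuous_\<zeta>: "continuous_on {0..} \<zeta>"
  unfolding \<zeta>_def using weights by (intro continuous_intros continuous_on_powr') auto

lemma continuous_R: "continuous_on {2 * x0..0} R"
  unfolding R_def
  by (rule continuous_on_compose2[OF continuous_\<zeta>])
    (auto intro!: continuous_intros continuous_\<eta> simp: \<eta>_range)

lemma R_ends: "R 0 = 0" "R (2 * x0) = 0"
  unfolding R_def using \<eta>0_pos by (auto simp: \<eta>0_def min_def)

lemma R_neg: "2 * x0 < x \<Longrightarrow> x < 0 \<Longrightarrow> R x < 0"
  unfolding R_def using \<eta>_range_strict[of x] by (intro \<zeta>_neg) auto

lemma triangle_iff_graph:
  assumes "y < 0"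
  shows "\<xi> y < \<eta> x \<and> \<xi> y + \<eta> x < \<eta>0 \<longleftrightarrow> 2 * x0 < x \<and> x < 0 \<and> R x < y"
proof
  assume L: "\<xi> y < \<eta> x \<and> \<xi> y + \<eta> x < \<eta>0"
  then have "0 < \<eta> x \<and> \<eta> x < \<eta>0" using \<xi>_pos[OF assms] by auto
  then show "2 * x0 < x \<and> x < 0 \<and> R x < y"
    using L \<eta>_range_strict[of x] \<xi>_less_iff[of y "min (\<eta> x) (\<eta>0 - \<eta> x)"] assms
    by (auto simp: R_def)
next
  assume L: "2 * x0 < x \<and> x < 0 \<and> R x < y"
  then show "\<xi> y < \<eta> x \<and> \<xi> y + \<eta> x < \<eta>0"
    using \<eta>_range_strict[of x] \<xi>_less_iff[of y "min (\<eta> x) (\<eta>0 - \<eta> x)"] assms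
    by (auto simp: R_def)
qed

subsection \<open>The domain has no slits\<close>

text \<open>The boundary is a Jordan curve, so every point of it is also a boundary point of the unbounded
  component of the complement, which does not meet the closure of the domain. This is what makes
  star-shapedness of the closure useful for the domain itself, see \<open>dil_in\<close>.\<close>

lemma interior_closure: "interior (closure \<Omega>) = \<Omega>"
proof -
  obtain g where g: "piecewise_C1_arc g" "pathstart g = (2 * x0, 0)" "pathfinish g = (0, 0)" "path_image g = \<sigma>"
    using dom by (auto simp: tricomi_domain_def)
  then have arc_g: "arc g" by (simp add: piecewise_C1_arc_def)
  \<comment> \<open>the way back from \<open>B\<close> through \<open>C\<close> to \<open>A\<close>\<close>
  define \<beta> where "\<beta> t = (2 * x0 * t, R (2 * x0 * t))" for t
  have rng: "2 * x0 * t \<in> {2 * x0..0}" if "t \<in> {0..1}" for t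
  proof -
    have "2 * x0 \<le> 2 * x0 * t" using mult_left_mono_neg[of t 1 "2 * x0"] x0 that by auto
    moreover have "2 * x0 * t \<le> 0" using x0 that by (rule_tac mult_nonpos_nonneg) auto
    ultimately show ?thesis unfolding atLeastAtMost_iff by blast
  qed
  have "continuous_on {0..1} (\<lambda>t. R (2 * x0 * t))"
    by (rule continuous_on_compose2[OF continuous_R]) (use rng in \<open>auto intro!: continuous_intros\<close>)
  then have "continuous_on {0..1} \<beta>"
    unfolding \<beta>_def by (intro continuous_intros)
  moreover have "inj_on \<beta> {0..1}" using x0 by (auto simp: inj_on_def \<beta>_def)
  ultimately have arc_\<beta>: "arc \<beta>" by (simp add: arc_def path_def)
  have \<beta>_ends: "pathstart \<beta> = (0, 0)" "pathfinish \<beta> = (2 * x0, 0)"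
    by (auto simp: pathstart_def pathfinish_def \<beta>_def R_ends)
  have img: "path_image \<beta> = AC \<union> BC"
  proof -
    have "(\<lambda>t. 2 * x0 * t) ` {0..1} = {2 * x0..0}"
    proof (intro equalityI subsetI)
      fix x assume "x \<in> {2 * x0..0}"
      then show "x \<in> (\<lambda>t. 2 * x0 * t) ` {0..1}" using x0
        by (intro image_eqI[of _ _ "x / (2 * x0)"]) (auto simp: field_simps)
    qed (use rng in blast)
    then show ?thesis unfolding AC_BC_graph path_image_def \<beta>_def
      by (metis (no_types, lifting) image_cong image_image)
  qed
  have inter: "path_image g \<inter> path_image \<beta> \<subseteq> {pathstart g, pathstart \<beta>}"
  proof
    fix z assume z: "z \<in> path_image g \<inter> path_image \<beta>"
    then have "snd z \<le> 0" using img by (cases z) (auto simp: AC_iff BC_iff)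
    then show "z \<in> {pathstart g, pathstart \<beta>}"
      using z \<sigma>_pos[of z] g \<beta>_ends by auto
  qed
  have loop: "simple_path (g +++ \<beta>)"
    using arc_g arc_\<beta> g \<beta>_ends inter by (intro simple_path_join_loop) auto
  have im: "path_image (g +++ \<beta>) = frontier \<Omega>"
    using g \<beta>_ends img by (subst path_image_join) (auto simp: frontier_\<Omega>)
  have "frontier \<Omega> homeomorphic sphere (0 :: complex) 1"
    unfolding im[symmetric] using loop g \<beta>_ends by (intro homeomorphic_simple_path_image_circle) auto
  also have "sphere (0 :: complex) 1 homeomorphic sphere (0 :: real \<times> real) 1"
    by (intro homeomorphic_spheres_gen) auto
  finally have sph: "frontier \<Omega> homeomorphic sphere (0 :: real \<times> real) 1" .
  have "bounded (- (- frontier \<Omega>))" using bounded_\<Omega> bounded_closure bounded_subset[of "closure \<Omega>"] by (auto simp: frontier_def)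
  then obtain p where p: "p \<in> - frontier \<Omega>" "\<not> bounded (connected_component_set (- frontier \<Omega>) p)"
    using cobounded_unbounded_component by blast
  define V where "V = connected_component_set (- frontier \<Omega>) p"
  have V: "V \<in> components (- frontier \<Omega>)" unfolding V_def using p by (simp add: componentsI)
  have fV: "frontier V = frontier \<Omega>" by (rule Jordan_Brouwer_frontier[OF sph V]) simp
  have VF: "V \<inter> frontier \<Omega> = {}" using V in_components_subset by blast
  have "V \<inter> \<Omega> = {}"
  proof (rule ccontr)
    assume "V \<inter> \<Omega> \<noteq> {}"
    then have "V \<subseteq> \<Omega>" using connected_Int_frontier[of V \<Omega>] VF in_components_connected[OF V] by blast
    then show False using p bounded_\<Omega> bounded_subset unfolding V_def by blast
  qed
  then have Vc: "V \<inter> closure \<Omega> = {}" using VF closure_Un_frontier[of \<Omega>] by auto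
  have "z \<in> \<Omega>" if z: "z \<in> interior (closure \<Omega>)" for z
  proof (rule ccontr)
    assume "z \<notin> \<Omega>"
    then have "z \<in> frontier \<Omega>" using z interior_subset open_\<Omega> by (auto simp: frontier_def interior_open)
    then have "z \<in> closure V" using fV by (auto simp: frontier_def)
    then have "interior (closure \<Omega>) \<inter> V \<noteq> {}" using z open_Int_closure_eq_empty[OF open_interior] by blast
    then show False using Vc interior_subset by blast
  qed
  moreover have "\<Omega> \<subseteq> interior (closure \<Omega>)" using open_\<Omega> by (simp add: closure_subset interior_maximal)
  ultimately show ?thesis by blast
qed

subsection \<open>The characteristic triangle\<close>

text \<open>The vertical half-line going down from such a point does not meet the boundary, so it would lie
  in the bounded set \<open>\<Omega>\<close> if the point did.\<close>

lemma outside_triangle: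
  assumes y: "y < 0" and out: "\<xi> y > \<eta> x \<or> \<xi> y + \<eta> x > \<eta>0"
  shows "(x, y) \<notin> \<Omega>"
proof
  assume mem: "(x, y) \<in> \<Omega>"
  obtain M where M: "\<And>z. z \<in> \<Omega> \<Longrightarrow> norm z \<le> M" using bounded_\<Omega> bounded_iff by metis
  define L where "L = {x} \<times> {..y}"
  have "connected L" unfolding L_def by (intro connected_Times) auto
  moreover have "L \<inter> frontier \<Omega> = {}"
  proof (rule equals0I)
    fix z assume z: "z \<in> L \<inter> frontier \<Omega>"
    then obtain y' where y': "z = (x, y')" "y' \<le> y" by (auto simp: L_def)
    have "\<xi> y \<le> \<xi> y'" using y' y by (intro \<xi>_mono) auto
    moreover have "z \<in> AC \<union> BC" using z y' y \<sigma>_nonneg[of z] by (auto simp: frontier_\<Omega>)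
    ultimately show False using out unfolding y' by (auto simp: AC_iff BC_iff)
  qed
  moreover have "L \<inter> \<Omega> \<noteq> {}" using mem by (auto simp: L_def)
  ultimately have "L \<subseteq> \<Omega>" using connected_Int_frontier[of L \<Omega>] by blast
  moreover have "(x, min y (- \<bar>M\<bar> - 1)) \<in> L" by (auto simp: L_def)
  ultimately have "norm (x, min y (- \<bar>M\<bar> - 1)) \<le> M" using M by blast
  moreover have "\<bar>min y (- \<bar>M\<bar> - 1)\<bar> \<le> norm (x, min y (- \<bar>M\<bar> - 1))"
    using norm_snd_le[of "min y (- \<bar>M\<bar> - 1)" x] by simp
  ultimately show False by linarith
qed

text \<open>The open characteristic triangle is connected and does not meet the boundary, but its vertex \<open>C\<close> is
  a boundary point; therefore it is contained in the domain. By \<open>outside_triangle\<close> nothing else of the lower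
  half-plane is.\<close>

lemma lower_half_triangle:
  assumes y: "y < 0"
  shows "(x, y) \<in> \<Omega> \<longleftrightarrow> \<xi> y < \<eta> x \<and> \<xi> y + \<eta> x < \<eta>0"
proof -
  have sub: "\<xi> y < \<eta> x \<and> \<xi> y + \<eta> x < \<eta>0" if z: "(x, y) \<in> \<Omega>" and y: "y < 0" for x y
  proof -
    have le: "\<xi> y \<le> \<eta> x" "\<xi> y + \<eta> x \<le> \<eta>0" using outside_triangle[OF y] z by (meson not_le)+
    then have "x \<le> 0" using \<eta>_range'[of x] \<xi>_nonneg[of y] by auto
    then have "(x, y) \<in> BC" if "\<xi> y = \<eta> x" using that le y by (auto simp: BC_iff)
    moreover have "(x, y) \<in> AC" if "\<xi> y + \<eta> x = \<eta>0" using that le y \<open>x \<le> 0\<close> by (auto simp: AC_iff)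
    ultimately show ?thesis using z disjoint_frontier le by fastforce
  qed
  \<comment> \<open>the triangle, as the image of a rectangle to see that it is connected\<close>
  define T where "T = (\<lambda>(x, l). (x, l * R x)) ` ({2 * x0<..<0} \<times> {0<..<1})"
  have T_iff: "(x, y) \<in> T \<longleftrightarrow> y < 0 \<and> \<xi> y < \<eta> x \<and> \<xi> y + \<eta> x < \<eta>0" for x y
  proof
    assume "(x, y) \<in> T"
    then obtain l where l: "2 * x0 < x" "x < 0" "0 < l" "l < 1" "y = l * R x" by (auto simp: T_def)
    then have "y < 0" "R x < y" using R_neg[of x] mult_pos_neg[of l "R x"] mult_strict_right_mono_neg[of l 1 "R x"] by auto
    then show "y < 0 \<and> \<xi> y < \<eta> x \<and> \<xi> y + \<eta> x < \<eta>0" using triangle_iff_graph l by auto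
  next
    assume a: "y < 0 \<and> \<xi> y < \<eta> x \<and> \<xi> y + \<eta> x < \<eta>0"
    then have "2 * x0 < x" "x < 0" "R x < y" using triangle_iff_graph by auto
    then show "(x, y) \<in> T" unfolding T_def using a
      by (intro image_eqI[of _ _ "(x, y / R x)"]) (auto simp: divide_less_eq zero_less_divide_iff)
  qed
  have "connected T" unfolding T_def
  proof (intro connected_continuous_image connected_Times)
    have "continuous_on ({2 * x0<..<0} \<times> {0<..<1::real}) (\<lambda>p. R (fst p))"
      by (rule continuous_on_compose2[OF continuous_R]) (auto intro!: continuous_intros)
    then show "continuous_on ({2 * x0<..<0} \<times> {0<..<1}) (\<lambda>(x, l). (x, l * R x))"
      unfolding case_prod_unfold by (intro continuous_intros)
  qed auto
  moreover have "T \<inter> frontier \<Omega> = {}"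
  proof (rule equals0I)
    fix z assume z: "z \<in> T \<inter> frontier \<Omega>"
    obtain x y where xy: "z = (x, y)" by (cases z)
    show False using z \<sigma>_nonneg[of z] unfolding xy by (auto simp: T_iff frontier_\<Omega> AC_iff BC_iff)
  qed
  moreover have "T \<inter> \<Omega> \<noteq> {}"
  proof -
    have "(xC, yC) \<in> closure \<Omega>" using C_in by (simp add: closure_eq)
    moreover have "(xC, yC) \<in> {z. snd z < 0}" using yC_neg by simp
    ultimately have "{z. snd z < 0} \<inter> closure \<Omega> \<noteq> {}" by blast
    moreover have "open {z :: real \<times> real. snd z < 0}" by (intro open_Collect_less continuous_intros)
    ultimately have "{z. snd z < 0} \<inter> \<Omega> \<noteq> {}" by (simp add: open_Int_closure_eq_empty)
    then obtain z where z: "z \<in> \<Omega>" "snd z < 0" by auto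
    then have "z \<in> T" using sub[of "fst z" "snd z"] T_iff[of "fst z" "snd z"] by simp
    then show ?thesis using z by blast
  qed
  ultimately have "T \<subseteq> \<Omega>" using connected_Int_frontier[of T \<Omega>] by blast
  then show ?thesis using sub y T_iff by blast
qed

subsection \<open>Anisotropic dilations\<close>

lemma dil_dil: "dil s (dil t z) = dil (s * t) z" by (simp add: dil_def power_mult_distrib)
lemma dil_1[simp]: "dil 1 z = z" by (simp add: dil_def)
lemma continuous_dil: "continuous_on A (dil t)"
  unfolding dil_def by (intro continuous_intros)
lemma continuous_dil_par: "continuous_on A (\<lambda>t. dil t z)"
  unfolding dil_def by (intro continuous_intros)

lemma dil_closure:
  assumes z: "z \<in> closure \<Omega>" and t: "0 \<le> t" "t \<le> 1"
  shows "dil t z \<in> closure \<Omega>"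
proof (cases "t = 0")
  case True
  then show ?thesis using star z by (auto simp: D_star_shaped_def dil_def)
next
  case False
  then have t: "0 < t" "t \<le> 1" using t by auto
  have "D_flow m1 m2 (- ln t) z = dil t z"
  proof -
    have "exp (- (real k + 2) * (- ln t)) = t ^ (k + 2)" for k
    proof -
      have "- (real k + 2) * (- ln t) = real (k + 2) * ln t" by (simp add: algebra_simps)
      then show ?thesis using t by (metis exp_ln exp_of_nat_mult)
    qed
    then show ?thesis by (simp add: D_flow_def dil_def wx_def wy_def case_prod_unfold mult.commute)
  qed
  moreover have "- ln t \<ge> 0" using t by simp
  ultimately show ?thesis using star z unfolding D_star_shaped_def by metis
qed

text \<open>The dilated domain is open and contained in the closure, hence in the interior of the closure.\<close>

lemma dil_in:
  assumes z: "z \<in> \<Omega>" and t: "0 < t" "t \<le> 1"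
  shows "dil t z \<in> \<Omega>"
proof -
  have "open (dil (1 / t) -` \<Omega>)"
    by (rule open_vimage[OF open_\<Omega>]) (rule continuous_dil)
  moreover have "dil (1 / t) -` \<Omega> \<subseteq> closure \<Omega>"
  proof
    fix w assume "w \<in> dil (1 / t) -` \<Omega>"
    then have "dil (1 / t) w \<in> closure \<Omega>" using closure_subset by auto
    from dil_closure[OF this, of t] t show "w \<in> closure \<Omega>" by (simp add: dil_dil)
  qed
  ultimately have "dil (1 / t) -` \<Omega> \<subseteq> \<Omega>" using interior_maximal interior_closure by metis
  moreover have "dil t z \<in> dil (1 / t) -` \<Omega>" using z t by (simp add: dil_dil)
  ultimately show ?thesis by blast
qed

lemma \<eta>_dil: "\<eta> (t ^ wx * x) = t ^ (wx * half_wy) * \<eta> x"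
  by (simp add: \<eta>_def power_mult_distrib power_mult)

lemma \<xi>_dil:
  assumes "t \<ge> 0"
  shows "\<xi> (t ^ wy * y) = t ^ (wx * half_wy) * \<xi> y"
proof (cases "t = 0")
  case True
  then show ?thesis by (simp add: \<xi>_def)
next
  case False
  then have t: "t > 0" using assms by simp
  have "(t ^ wy) powr (real wx / 2) = t ^ (wx * half_wy)"
    using t weights by (simp add: powr_realpow[symmetric] powr_powr mult.commute)
  then show ?thesis
    unfolding \<xi>_def using powr_mult[of "t ^ wy" "- y" "real wx / 2"] by simp
qed

lemma BC_dil:
  assumes "z \<in> BC" "0 \<le> t" "t \<le> 1"
  shows "dil t z \<in> BC"
proof -
  obtain x y where xy: "z = (x, y)" by (cases z)
  have "t ^ (wx * half_wy) * \<xi> y \<le> 1 * \<xi> y"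
    using assms \<xi>_nonneg by (intro mult_right_mono power_le_one) auto
  moreover have "t ^ wx * x \<le> 0" "t ^ wy * y \<le> 0"
    using assms by (auto simp: xy BC_iff intro!: mult_nonneg_nonpos)
  ultimately show ?thesis using assms
    by (auto simp: xy dil_def BC_iff \<eta>_dil \<xi>_dil)
qed

text \<open>A point whose expansion leaves the domain comes from a first exit point \<open>p\<close>. This cannot lie on \<open>BC\<close>,
  since \<open>BC\<close> is invariant under contraction and the whole orbit segment would lie on it. So \<open>p\<close>
  is a point where the solution vanishes.\<close>

lemma exit_point:
  assumes z: "z \<in> \<Omega>" and t: "0 < t" "t \<le> 1" and out: "z \<notin> dil t ` \<Omega>"
  obtains p s where "p \<in> \<sigma> \<union> AC" "t \<le> s" "s < 1" "z = dil s p"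
    "\<And>s'. s \<le> s' \<Longrightarrow> s' < 1 \<Longrightarrow> dil s' p \<in> \<Omega>"
proof -
  define K where "K = {1..1 / t} \<inter> (\<lambda>s. dil s z) -` (- \<Omega>)"
  have "compact K" unfolding K_def
    by (intro compact_Int_closed closed_vimage continuous_dil_par) (use open_\<Omega> in auto)
  moreover have "1 / t \<in> K"
  proof -
    have "dil (1 / t) z \<notin> \<Omega>"
    proof
      assume "dil (1 / t) z \<in> \<Omega>"
      moreover have "z = dil t (dil (1 / t) z)" using t by (simp add: dil_dil)
      ultimately show False using out by blast
    qed
    then show ?thesis using t by (auto simp: K_def)
  qed
  ultimately obtain s0 where s0: "s0 \<in> K" "\<And>s. s \<in> K \<Longrightarrow> s0 \<le> s"
    using compact_attains_inf by (metis empty_iff)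
  have "s0 \<noteq> 1" using s0(1) z by (auto simp: K_def)
  then have s01: "1 < s0" "s0 \<le> 1 / t" using s0(1) by (auto simp: K_def)
  define p where "p = dil s0 z"
  have before: "dil s z \<in> \<Omega>" if "1 \<le> s" "s < s0" for s
    using s0(2)[of s] that s01 by (force simp: K_def)
  have "(\<lambda>s. dil s z) ` {1..<s0} \<subseteq> closure \<Omega>" using before closure_subset[of \<Omega>] by auto
  then have "(\<lambda>s. dil s z) ` closure {1..<s0} \<subseteq> closure \<Omega>"
    by (intro image_closure_subset continuous_dil_par) auto
  then have "p \<in> closure \<Omega>" using s01 by (auto simp: p_def image_subset_iff)
  moreover have "p \<notin> \<Omega>" using s0(1) by (auto simp: K_def p_def)
  moreover have zp: "z = dil (1 / s0) p" using s01 by (simp add: p_def dil_dil)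
  moreover have "p \<notin> BC"
  proof
    assume "p \<in> BC"
    then have "z \<in> BC" unfolding zp using s01 by (intro BC_dil) auto
    then show False using z disjoint_frontier by auto
  qed
  ultimately have "p \<in> \<sigma> \<union> AC" by (auto simp: closure_eq)
  moreover have "t \<le> 1 / s0" "1 / s0 < 1" using s01 t by (auto simp: field_simps)
  moreover have "dil s' p \<in> \<Omega>" if "1 / s0 \<le> s'" "s' < 1" for s'
    using before[of "s' * s0"] that s01 by (simp add: p_def dil_dil field_simps)
  ultimately show ?thesis using that zp by blast
qed

subsection \<open>Integrating a derivative over the domain\<close>

definition I\<Omega> :: "(real \<times> real \<Rightarrow> real) \<Rightarrow> real" where
  "I\<Omega> \<phi> = (LINT z|lborel. indicator \<Omega> z * \<phi> z)"

lemma measurable_on_\<Omega>: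
  "continuous_on \<Omega> \<phi> \<Longrightarrow> (\<lambda>z. indicator \<Omega> z * (\<phi> z :: real)) \<in> borel_measurable borel"
  using borel_measurable_continuous_on_indicator[of \<Omega> \<phi>] open_\<Omega> by simp

lemma integrable_on_\<Omega>:
  assumes "continuous_on \<Omega> \<phi>" "\<And>z. z \<in> \<Omega> \<Longrightarrow> \<bar>\<phi> z\<bar> \<le> L"
  shows "integrable lborel (\<lambda>z. indicator \<Omega> z * (\<phi> z :: real))"
  by (rule integrableI_bounded_set[where A = \<Omega> and B = L])
    (use assms open_\<Omega> measurable_on_\<Omega> emeasure_bounded_finite[OF bounded_\<Omega>] in auto)

lemma \<Omega>_box:
  obtains M where "M > 0" "\<And>z. z \<in> closure \<Omega> \<Longrightarrow> \<bar>fst z\<bar> < M \<and> \<bar>snd z\<bar> < M"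
proof -
  obtain M where M: "M > 0" "\<And>z. z \<in> closure \<Omega> \<Longrightarrow> norm z \<le> M"
    using bounded_closure[OF bounded_\<Omega>] bounded_pos by metis
  have "\<bar>fst z\<bar> < M + 1 \<and> \<bar>snd z\<bar> < M + 1" if "z \<in> closure \<Omega>" for z
    using M(2)[OF that] norm_fst_le[of "fst z" "snd z"] norm_snd_le[of "snd z" "fst z"] by simp
  then show ?thesis using that[of "M + 1"] M by simp
qed

text \<open>The set \<open>D\<close> collects parameters outside the domain at which \<open>h\<close> can be continued by \<open>0\<close>. On the
  characteristic \<open>BC\<close> the function \<open>h\<close> need not vanish, so a section that ends there is cut off exactly
  at its end \<open>c\<close> or \<open>d\<close>, which is not put into \<open>D\<close>.\<close>

lemma slice_integral:
  fixes e :: "real \<Rightarrow> real \<times> real"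
  assumes e: "continuous_on UNIV e" and cd: "c \<le> d"
    and hc: "continuous_on (closure \<Omega>) h"
    and U: "\<And>t. e t \<in> \<Omega> \<Longrightarrow> c < t \<and> t < d"
    and D: "closed D" "\<And>t. t \<in> D \<Longrightarrow> e t \<notin> \<Omega>" "\<And>t. t \<in> D \<Longrightarrow> e t \<in> closure \<Omega> \<Longrightarrow> h (e t) = 0"
    and cover: "\<And>t. c \<le> t \<Longrightarrow> t \<le> d \<Longrightarrow> e t \<in> closure \<Omega> \<or> t \<in> D"
    and zero: "\<And>t. c < t \<Longrightarrow> t < d \<Longrightarrow> e t \<in> closure \<Omega> - \<Omega> \<Longrightarrow> h (e t) = 0"
    and der: "\<And>t. e t \<in> \<Omega> \<Longrightarrow> ((\<lambda>t. h (e t)) has_real_derivative k t) (at t)"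
    and bd: "\<And>t. e t \<in> \<Omega> \<Longrightarrow> \<bar>k t\<bar> \<le> L"
  defines "H \<equiv> \<lambda>t. if e t \<in> closure \<Omega> then h (e t) else 0"
  shows "((\<lambda>t. if e t \<in> \<Omega> then k t else 0) has_integral (H d - H c)) {c..d}"
proof -
  have oU: "open (e -` \<Omega>)" using e open_\<Omega> by (metis open_vimage)
  have cK: "closed (e -` closure \<Omega>)" using e by (metis closed_vimage closed_closure)
  have "continuous_on (e -` closure \<Omega> \<union> D) H"
    unfolding H_def
  proof (rule continuous_on_cases[OF cK D(1)])
    show "continuous_on (e -` closure \<Omega>) (\<lambda>t. h (e t))"
      by (rule continuous_on_compose2[OF hc]) (use e continuous_on_subset in blast)+
  qed (use D(3) in auto)
  then have Hc: "continuous_on {c..d} H"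
  proof (rule continuous_on_subset)
    show "{c..d} \<subseteq> e -` closure \<Omega> \<union> D" using cover by fastforce
  qed
  have "((\<lambda>t. if t \<in> e -` \<Omega> then k t else 0) has_integral (H d - H c)) {c..d}"
  proof (rule has_integral_derivative_vanishing_off_open[OF cd Hc oU])
    show "e -` \<Omega> \<subseteq> {c<..<d}" using U by auto
    show "H t = 0" if "t \<in> {c<..<d} - e -` \<Omega>" for t
      using zero[of t] that by (auto simp: H_def)
    show "(H has_real_derivative k t) (at t)" if t: "t \<in> e -` \<Omega>" for t
    proof (rule DERIV_cong_ev[THEN iffD1, OF refl _ refl der])
      show "e t \<in> \<Omega>" using t by simp
      have "\<forall>\<^sub>F s in nhds t. s \<in> e -` \<Omega>" using oU t eventually_nhds by blast
      then show "\<forall>\<^sub>F s in nhds t. h (e s) = H s"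
        by eventually_elim (use closure_subset in \<open>auto simp: H_def\<close>)
    qed
    show "\<bar>k t\<bar> \<le> L" if "t \<in> e -` \<Omega>" for t using bd that by simp
  qed
  then show ?thesis by simp
qed

lemma slice_lborel_integral:
  fixes e :: "real \<Rightarrow> real \<times> real" and \<phi> :: "real \<times> real \<Rightarrow> real" and L :: real
  assumes e: "continuous_on UNIV e" and \<phi>: "continuous_on \<Omega> \<phi>"
    and bd: "\<And>z. z \<in> \<Omega> \<Longrightarrow> \<bar>\<phi> z\<bar> \<le> L"
    and J: "((\<lambda>t. if e t \<in> \<Omega> then \<phi> (e t) else 0) has_integral J) {c..d}"
    and U: "\<And>t. e t \<in> \<Omega> \<Longrightarrow> c < t \<and> t < d"
  shows "(LINT t|lborel. indicator \<Omega> (e t) * \<phi> (e t)) = J"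
proof -
  let ?f = "\<lambda>t. if e t \<in> \<Omega> then \<phi> (e t) else 0"
  have "continuous_on (e -` \<Omega>) (\<lambda>t. \<phi> (e t))"
    by (rule continuous_on_compose2[OF \<phi>]) (use e continuous_on_subset in blast)+
  moreover have "e -` \<Omega> \<in> sets borel" using open_vimage[OF open_\<Omega> e] by simp
  ultimately have "(\<lambda>t. indicator (e -` \<Omega>) t *\<^sub>R \<phi> (e t)) \<in> borel_measurable borel"
    by (intro borel_measurable_continuous_on_indicator)
  moreover have "(\<lambda>t. indicator (e -` \<Omega>) t *\<^sub>R \<phi> (e t)) = ?f" by (auto simp: fun_eq_iff)
  ultimately have meas: "?f \<in> borel_measurable borel" by simp
  have "\<bar>?f t\<bar> \<le> \<bar>L\<bar>" for t using bd[of "e t"] by auto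
  moreover have "?f t = 0" if "t \<notin> {c..d}" for t using U[of t] that by auto
  ultimately have "(LINT t|lborel. ?f t) = J" by (rule lborel_integral_eq_HK[OF meas _ _ J])
  moreover have "(\<lambda>t. indicator \<Omega> (e t) * \<phi> (e t)) = ?f" by (auto simp: fun_eq_iff)
  ultimately show ?thesis by simp
qed

text \<open>The abscissa of \<open>BC\<close> at height \<open>y\<close>, from the parametrisation \<open>(xC s\<^bsup>wx\<^esup>, yC s\<^bsup>wy\<^esup>)\<close> of \<open>BC\<close> with \<open>s \<in> [0, 1]\<close>,
  which is an orbit of the dilations.\<close>

definition qx :: "real \<Rightarrow> real" where "qx y = xC * root wy (y / yC) ^ wx"

lemma \<xi>_curve: "0 \<le> s \<Longrightarrow> \<xi> (yC * s ^ wy) = \<eta> (xC * s ^ wx)"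
  using \<xi>_dil[of s yC] \<eta>_dil[of s xC] \<eta>_xC \<xi>_yC by (simp add: mult.commute)

lemma curve_BC:
  assumes "0 \<le> s" "s \<le> 1"
  shows "(xC * s ^ wx, yC * s ^ wy) \<in> BC"
  using BC_dil[OF C_in(2) assms] by (simp add: dil_def mult.commute)

lemma qx_curve: "0 \<le> s \<Longrightarrow> qx (yC * s ^ wy) = xC * s ^ wx"
  unfolding qx_def using yC_neg weights by (simp add: real_root_power_cancel)

lemma \<eta>_qx:
  assumes "y \<le> 0"
  shows "\<eta> (qx y) = \<xi> y"
proof -
  define s where "s = root wy (y / yC)"
  have "y / yC \<ge> 0" using assms yC_neg by (simp add: divide_nonpos_neg)
  then have "s \<ge> 0" "s ^ wy = y / yC" using weights by (auto simp: s_def real_root_pow_pos2)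
  then show ?thesis using \<xi>_curve[of s] yC_neg unfolding qx_def s_def[symmetric] by simp
qed

lemma continuous_qx: "continuous_on A qx"
  unfolding qx_def using yC_neg by (intro continuous_intros) auto

lemma qx_BC: "yC \<le> y \<Longrightarrow> y \<le> 0 \<Longrightarrow> (qx y, y) \<in> BC"
  using \<eta>_qx[of y] \<eta>_le_iff[of 0 "qx y"] \<xi>_nonneg[of y] \<xi>_mono[of yC y] \<xi>_yC by (auto simp: BC_iff)

lemma R_curve:
  assumes "0 \<le> s" "s \<le> 1"
  shows "R (xC * s ^ wx) = yC * s ^ wy"
proof -
  have "(xC * s ^ wx, yC * s ^ wy) \<in> BC" by (rule curve_BC[OF assms])
  then have "yC * s ^ wy \<le> 0" "\<xi> (yC * s ^ wy) = \<eta> (xC * s ^ wx)" "\<xi> (yC * s ^ wy) \<le> \<eta>0 / 2"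
    by (auto simp: BC_iff)
  then show ?thesis unfolding R_def using \<zeta>_\<xi>[of "yC * s ^ wy"] by (simp add: min_def)
qed

text \<open>A horizontal line has its endpoints on \<open>\<sigma>\<close> if \<open>y > 0\<close>, and on \<open>AC\<close> (left) and \<open>BC\<close> (right) if \<open>yC < y < 0\<close>.
  Only the latter contributes.\<close>

lemma horizontal_slice:
  assumes hc: "continuous_on (closure \<Omega>) h" and h0: "\<And>z. z \<in> \<sigma> \<union> AC \<Longrightarrow> h z = 0"
    and der: "\<And>z. z \<in> \<Omega> \<Longrightarrow> ((\<lambda>s. h (s, snd z)) has_real_derivative hx z) (at (fst z))"
    and bd: "\<And>z. z \<in> \<Omega> \<Longrightarrow> \<bar>hx z\<bar> \<le> L" and hxc: "continuous_on \<Omega> hx"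
    and y: "y \<noteq> 0" "y \<noteq> yC"
  shows "(LINT x|lborel. indicator \<Omega> (x, y) * hx (x, y)) = indicator {yC..0} y * h (qx y, y)"
proof -
  obtain M where M: "M > 0" "\<And>z. z \<in> closure \<Omega> \<Longrightarrow> \<bar>fst z\<bar> < M \<and> \<bar>snd z\<bar> < M"
    using \<Omega>_box by blast
  have Mc: "\<bar>x\<bar> < M" if "(x, y) \<in> closure \<Omega>" for x using M(2)[OF that] by simp
  have M\<Omega>: "\<bar>x\<bar> < M" if "(x, y) \<in> \<Omega>" for x using Mc[of x] that closure_subset by blast
  have [simp]: "(M, y) \<notin> closure \<Omega>" "(- M, y) \<notin> closure \<Omega>" using Mc[of M] Mc[of "- M"] M by auto
  have e: "continuous_on UNIV (\<lambda>x. (x, y))" by (intro continuous_intros)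
  have der': "((\<lambda>s. h (s, y)) has_real_derivative hx (x, y)) (at x)" if "(x, y) \<in> \<Omega>" for x
    using der[OF that] by simp
  let ?f = "\<lambda>x. if (x, y) \<in> \<Omega> then hx (x, y) else 0"
  have red: "(LINT x|lborel. indicator \<Omega> (x, y) * hx (x, y)) = J" if "(?f has_integral J) {c..d}"
    "\<And>x. (x, y) \<in> \<Omega> \<Longrightarrow> c < x \<and> x < d" for J c d
    by (rule slice_lborel_integral[OF e hxc bd that])
  consider "y > 0" | "yC < y" "y < 0" | "y < yC" using y by linarith
  then show ?thesis
  proof cases
    case 1
    have "\<And>z. z \<in> closure \<Omega> - \<Omega> \<Longrightarrow> snd z = y \<Longrightarrow> z \<in> \<sigma>"
      using 1 by (auto simp: closure_eq AC_iff BC_iff)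
    then have z: "h (x, y) = 0" if "(x, y) \<in> closure \<Omega> - \<Omega>" for x using h0 that by fastforce
    have "(?f has_integral ((if (M, y) \<in> closure \<Omega> then h (M, y) else 0) - (if (- M, y) \<in> closure \<Omega> then h (- M, y) else 0))) {- M..M}"
    proof (rule slice_integral[OF e _ hc, where D = "{x. (x, y) \<notin> \<Omega>}"])
      have "closed ((\<lambda>x. (x, y)) -` (- \<Omega>))" using open_\<Omega> e by (metis closed_vimage closed_Compl)
      moreover have "(\<lambda>x. (x, y)) -` (- \<Omega>) = {x. (x, y) \<notin> \<Omega>}" by auto
      ultimately show "closed {x. (x, y) \<notin> \<Omega>}" by simp
      show "- M < x \<and> x < M" if "(x, y) \<in> \<Omega>" for x using M\<Omega>[OF that] by (simp add: abs_less_iff)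
      show "(x, y) \<in> closure \<Omega> \<or> x \<in> {x. (x, y) \<notin> \<Omega>}" for x using closure_subset by blast
    qed (use M z der' bd in auto)
    then have "(?f has_integral 0) {- M..M}" by simp
    then have "(LINT x|lborel. indicator \<Omega> (x, y) * hx (x, y)) = 0"
      by (rule red) (use M\<Omega> in \<open>simp add: abs_less_iff minus_less_iff\<close>)
    then show ?thesis using 1 by simp
  next
    case 2
    have qB: "(qx y, y) \<in> BC" using 2 by (intro qx_BC) auto
    then have qC: "(qx y, y) \<in> closure \<Omega>" by (simp add: closure_eq)
    have eq: "\<eta> (qx y) = \<xi> y" using 2 by (intro \<eta>_qx) simp
    have \<xi>y: "\<xi> y < \<eta>0 / 2" using 2 \<xi>_strict[of yC y] \<xi>_yC by simp
    have U: "- M < x \<and> x < qx y" if "(x, y) \<in> \<Omega>" for x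
      using that 2 M\<Omega>[OF that] \<eta>_less_iff[of "qx y" x] eq by (auto simp: lower_half_triangle)
    have fr: "(x, y) \<in> AC \<or> (x, y) \<in> BC" if "(x, y) \<in> closure \<Omega> - \<Omega>" for x
      using that 2 \<sigma>_nonneg[of "(x, y)"] by (auto simp: closure_eq)
    have "(?f has_integral ((if (qx y, y) \<in> closure \<Omega> then h (qx y, y) else 0) - (if (- M, y) \<in> closure \<Omega> then h (- M, y) else 0))) {- M..qx y}"
    proof (rule slice_integral[OF e _ hc, where D = "{x. \<eta>0 - \<xi> y \<le> \<eta> x}"])
      show "closed {x. \<eta>0 - \<xi> y \<le> \<eta> x}"
        by (intro closed_Collect_le continuous_intros continuous_\<eta>)
      show "- M \<le> qx y" using Mc[OF qC] by simp
      show "- M < x \<and> x < qx y" if "(x, y) \<in> \<Omega>" for x using U[OF that] .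
      show "(x, y) \<notin> \<Omega>" if "x \<in> {x. \<eta>0 - \<xi> y \<le> \<eta> x}" for x
        using that 2 by (auto simp: lower_half_triangle)
      show "h (x, y) = 0" if "x \<in> {x. \<eta>0 - \<xi> y \<le> \<eta> x}" "(x, y) \<in> closure \<Omega>" for x
      proof -
        have "(x, y) \<notin> \<Omega>" using that 2 by (auto simp: lower_half_triangle)
        then have "(x, y) \<in> AC \<or> (x, y) \<in> BC" using fr that by blast
        moreover have "(x, y) \<notin> BC" using that \<xi>y by (auto simp: BC_iff)
        ultimately show ?thesis using h0 by blast
      qed
      show "(x, y) \<in> closure \<Omega> \<or> x \<in> {x. \<eta>0 - \<xi> y \<le> \<eta> x}" if "- M \<le> x" "x \<le> qx y" for x
      proof (cases "x = qx y")
        case True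
        then show ?thesis using qC by simp
      next
        case False
        then have "\<xi> y < \<eta> x" using that \<eta>_less_iff[of "qx y" x] eq by simp
        then have "(x, y) \<in> \<Omega> \<or> x \<in> {x. \<eta>0 - \<xi> y \<le> \<eta> x}" using 2 by (auto simp: lower_half_triangle)
        then show ?thesis using closure_subset by blast
      qed
      show "h (x, y) = 0" if "- M < x" "x < qx y" "(x, y) \<in> closure \<Omega> - \<Omega>" for x
      proof -
        have "(x, y) \<notin> BC" using that \<eta>_less_iff[of "qx y" x] eq by (auto simp: BC_iff)
        then show ?thesis using fr[OF that(3)] h0 by blast
      qed
    qed (use der' bd in auto)
    then have "(?f has_integral h (qx y, y)) {- M..qx y}" using qC by simp
    from red[OF this U] show ?thesis using 2 by simp
  next
    case 3
    have "(x, y) \<notin> \<Omega>" for x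
      using 3 yC_neg \<xi>_strict[of y yC] \<xi>_yC by (auto simp: lower_half_triangle)
    then show ?thesis using 3 by simp
  qed
qed

text \<open>Only the lines between \<open>C\<close> and \<open>B\<close> meet \<open>BC\<close>, each at its lowest point \<open>(x, R x)\<close>; these lines cross the axis and
  then may meet \<open>\<sigma>\<close> many times.\<close>

lemma vertical_slice:
  assumes hc: "continuous_on (closure \<Omega>) h" and h0: "\<And>z. z \<in> \<sigma> \<union> AC \<Longrightarrow> h z = 0"
    and der: "\<And>z. z \<in> \<Omega> \<Longrightarrow> ((\<lambda>s. h (fst z, s)) has_real_derivative hy z) (at (snd z))"
    and bd: "\<And>z. z \<in> \<Omega> \<Longrightarrow> \<bar>hy z\<bar> \<le> L" and hyc: "continuous_on \<Omega> hy"
    and x: "x \<noteq> 0" "x \<noteq> xC"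
  shows "(LINT y|lborel. indicator \<Omega> (x, y) * hy (x, y)) = indicator {xC..0} x * - h (x, R x)"
proof -
  obtain M where M: "M > 0" "\<And>z. z \<in> closure \<Omega> \<Longrightarrow> \<bar>fst z\<bar> < M \<and> \<bar>snd z\<bar> < M"
    using \<Omega>_box by blast
  have Mc: "\<bar>y\<bar> < M" if "(x, y) \<in> closure \<Omega>" for y using M(2)[OF that] by simp
  have M\<Omega>: "\<bar>y\<bar> < M" if "(x, y) \<in> \<Omega>" for y using Mc[of y] that closure_subset by blast
  have [simp]: "(x, M) \<notin> closure \<Omega>" "(x, - M) \<notin> closure \<Omega>" using Mc[of M] Mc[of "- M"] M by auto
  have e: "continuous_on UNIV (\<lambda>y. (x, y))" by (intro continuous_intros)
  have der': "((\<lambda>s. h (x, s)) has_real_derivative hy (x, y)) (at y)" if "(x, y) \<in> \<Omega>" for y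
    using der[OF that] by simp
  let ?f = "\<lambda>y. if (x, y) \<in> \<Omega> then hy (x, y) else 0"
  have red: "(LINT y|lborel. indicator \<Omega> (x, y) * hy (x, y)) = J" if "(?f has_integral J) {c..d}"
    "\<And>y. (x, y) \<in> \<Omega> \<Longrightarrow> c < y \<and> y < d" for J c d
    by (rule slice_lborel_integral[OF e hyc bd that])
  have clN: "closed {y. (x, y) \<notin> \<Omega>}"
  proof -
    have "closed ((\<lambda>y. (x, y)) -` (- \<Omega>))" using open_\<Omega> e by (metis closed_vimage closed_Compl)
    moreover have "(\<lambda>y. (x, y)) -` (- \<Omega>) = {y. (x, y) \<notin> \<Omega>}" by auto
    ultimately show ?thesis by simp
  qed
  show ?thesis
  proof (cases "xC < x \<and> x < 0")
    case False
    have nB: "(x, y) \<notin> BC" for y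
    proof
      assume B: "(x, y) \<in> BC"
      then have "\<eta> x \<le> \<eta> xC" "x \<le> 0" using \<eta>_xC by (auto simp: BC_iff)
      then show False using False x \<eta>_le_iff[of x xC] by auto
    qed
    then have z: "h (x, y) = 0" if "(x, y) \<in> closure \<Omega> - \<Omega>" for y
      using h0 that by (auto simp: closure_eq)
    have "(?f has_integral ((if (x, M) \<in> closure \<Omega> then h (x, M) else 0) - (if (x, - M) \<in> closure \<Omega> then h (x, - M) else 0))) {- M..M}"
    proof (rule slice_integral[OF e _ hc, where D = "{y. (x, y) \<notin> \<Omega>}"])
      show "- M < y \<and> y < M" if "(x, y) \<in> \<Omega>" for y using M\<Omega>[OF that] by (simp add: abs_less_iff)
      show "(x, y) \<in> closure \<Omega> \<or> y \<in> {y. (x, y) \<notin> \<Omega>}" for y using closure_subset by blast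
    qed (use M z der' bd clN in auto)
    then have "(?f has_integral 0) {- M..M}" by simp
    then have "(LINT y|lborel. indicator \<Omega> (x, y) * hy (x, y)) = 0"
      by (rule red) (use M\<Omega> in \<open>simp add: abs_less_iff minus_less_iff\<close>)
    then show ?thesis using False x by auto
  next
    case True
    then have x2: "2 * x0 < x" "x < 0" using xC_bounds by auto
    have RC: "(x, R x) \<in> closure \<Omega>" using AC_BC_graph x2 by (auto simp: closure_eq)
    have \<eta>x: "0 < \<eta> x" "\<eta> x < \<eta>0 / 2" using \<eta>_less_iff[of x xC] \<eta>_xC True \<eta>_range_strict[of x] x2 by auto
    have Rx: "R x = \<zeta> (\<eta> x)" using \<eta>x by (simp add: R_def min_def)
    have Rneg: "R x < 0" using R_neg x2 by simp
    have U: "R x < y \<and> y < M" if "(x, y) \<in> \<Omega>" for y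
    proof (cases "y < 0")
      case True
      then have "R x < y" using that triangle_iff_graph by (auto simp: lower_half_triangle)
      then show ?thesis using True M by simp
    qed (use Rneg M\<Omega>[OF that] in auto)
    have nB: "(x, y) \<notin> BC" if "y > R x" for y
      using that Rx \<zeta>_\<xi>[of y] by (auto simp: BC_iff)
    have z: "h (x, y) = 0" if "(x, y) \<in> closure \<Omega> - \<Omega>" "y > R x" for y
      using h0 that nB[OF that(2)] by (auto simp: closure_eq)
    have "(?f has_integral ((if (x, M) \<in> closure \<Omega> then h (x, M) else 0) - (if (x, R x) \<in> closure \<Omega> then h (x, R x) else 0))) {R x..M}"
    proof (rule slice_integral[OF e _ hc, where D = "{y. (x, y) \<notin> \<Omega>} \<inter> {0..}"])
      show "closed ({y. (x, y) \<notin> \<Omega>} \<inter> {0..})" using clN by (intro closed_Int) auto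
      show "R x \<le> M" using Rneg M by simp
      show "R x < y \<and> y < M" if "(x, y) \<in> \<Omega>" for y using U[OF that] .
      show "(x, y) \<in> closure \<Omega> \<or> y \<in> {y. (x, y) \<notin> \<Omega>} \<inter> {0..}" if Ry: "R x \<le> y" "y \<le> M" for y
      proof -
        consider "y = R x" | "R x < y" "y < 0" | "y \<ge> 0" using Ry by linarith
        then show ?thesis
        proof cases
          case 1 then show ?thesis using RC by simp
        next
          case 2
          then have "(x, y) \<in> \<Omega>" using triangle_iff_graph x2 by (auto simp: lower_half_triangle)
          then show ?thesis using closure_subset by blast
        next
          case 3 then show ?thesis using closure_subset by blast
        qed
      qed
    qed (use Rneg z der' bd in auto)
    then have "(?f has_integral - h (x, R x)) {R x..M}" using RC by simp
    from red[OF this U] show ?thesis using True by simp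
  qed
qed

text \<open>Together with \<open>green_y\<close> this is the divergence theorem for functions vanishing on \<open>\<sigma>\<close> and \<open>AC\<close>. It
  follows from Fubini and the integrals over slices. The remaining integral
  over \<open>BC\<close> is written with the parameter \<open>s\<close>.\<close>

lemma green_x:
  assumes hc: "continuous_on (closure \<Omega>) h" and h0: "\<And>z. z \<in> \<sigma> \<union> AC \<Longrightarrow> h z = 0"
    and der: "\<And>z. z \<in> \<Omega> \<Longrightarrow> ((\<lambda>s. h (s, snd z)) has_real_derivative hx z) (at (fst z))"
    and bd: "\<And>z. z \<in> \<Omega> \<Longrightarrow> \<bar>hx z\<bar> \<le> L" and hxc: "continuous_on \<Omega> hx"
  shows "I\<Omega> hx = - integral {0..1} (\<lambda>s. real wy * yC * s ^ (wy - 1) * h (xC * s ^ wx, yC * s ^ wy))"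
proof -
  let ?F = "\<lambda>z. indicator \<Omega> z * hx z"
  have int: "integrable (lborel \<Otimes>\<^sub>M lborel) (\<lambda>(x, y). ?F (x, y))"
    using integrable_on_\<Omega>[OF hxc bd] by (simp add: lborel_prod case_prod_unfold)
  have fc: "continuous_on {yC..0} (\<lambda>y. h (qx y, y))"
    by (rule continuous_on_compose2[OF hc])
      (use qx_BC in \<open>auto intro!: continuous_intros continuous_qx simp: closure_eq\<close>)
  have set: "set_integrable lborel {yC..0} (\<lambda>y. h (qx y, y))" by (rule borel_integrable_atLeastAtMost'[OF fc])
  have "I\<Omega> hx = (LINT z|(lborel \<Otimes>\<^sub>M lborel). ?F z)" by (simp add: I\<Omega>_def lborel_prod)
  also have "\<dots> = (LINT y|lborel. (LINT x|lborel. ?F (x, y)))"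
    using lborel_pair.integral_snd[OF int] by (simp add: case_prod_unfold)
  also have "\<dots> = (LINT y|lborel. indicator {yC..0} y * h (qx y, y))"
  proof (rule integral_cong_AE)
    show "(\<lambda>y. (LINT x|lborel. ?F (x, y))) \<in> borel_measurable lborel"
      using lborel_pair.integrable_snd[OF int] by (simp add: borel_measurable_integrable case_prod_unfold)
    show "(\<lambda>y. indicator {yC..0} y * h (qx y, y)) \<in> borel_measurable lborel"
      using set by (simp add: set_integrable_def borel_measurable_integrable)
    have "AE y in lborel. y \<noteq> 0 \<and> y \<noteq> yC" using AE_lborel_singleton[of 0] AE_lborel_singleton[of yC] by auto
    then show "AE y in lborel. (LINT x|lborel. ?F (x, y)) = indicator {yC..0} y * h (qx y, y)"
      by eventually_elim (use horizontal_slice[OF hc h0 der bd hxc] in auto)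
  qed
  also have "\<dots> = integral {yC..0} (\<lambda>y. h (qx y, y))"
    using set_borel_integral_eq_integral(2)[OF set] by (simp add: set_lebesgue_integral_def)
  also have "\<dots> = - integral {0..1} (\<lambda>s. real wy * yC * s ^ (wy - 1) * h (xC * s ^ wx, yC * s ^ wy))"
  proof -
    define g where "g s = yC * s ^ wy" for s
    have "g ` {0..1} \<subseteq> {yC..0}"
    proof
      fix y assume "y \<in> g ` {0..1}"
      then obtain s where s: "y = yC * s ^ wy" "0 \<le> s" "s \<le> 1" unfolding g_def image_iff Bex_def atLeastAtMost_iff by blast
      have "s ^ wy \<le> 1" "0 \<le> s ^ wy" using s power_le_one by auto
      then show "y \<in> {yC..0}" using yC_neg s mult_left_mono_neg[of "s ^ wy" 1 yC] by (auto simp: mult_nonpos_nonneg)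
    qed
    then have "((\<lambda>s. (yC * (real wy * s ^ (wy - 1))) *\<^sub>R h (qx (g s), g s)) has_integral
        (integral {g 0..g 1} (\<lambda>y. h (qx y, y)) - integral {g 1..g 0} (\<lambda>y. h (qx y, y)))) {0..1}"
      by (intro has_integral_substitution_general[where s = "{}" and c = yC and d = 0] fc)
        (auto simp: g_def intro!: continuous_intros derivative_eq_intros)
    then have "((\<lambda>s. real wy * yC * s ^ (wy - 1) * h (qx (g s), g s)) has_integral - integral {yC..0} (\<lambda>y. h (qx y, y))) {0..1}"
      using yC_neg weights by (simp add: g_def zero_power mult_ac)
    then have "((\<lambda>s. real wy * yC * s ^ (wy - 1) * h (xC * s ^ wx, yC * s ^ wy)) has_integral - integral {yC..0} (\<lambda>y. h (qx y, y))) {0..1}"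
      by (rule has_integral_eq[rotated]) (auto simp: g_def qx_curve)
    then show ?thesis by (simp add: has_integral_iff)
  qed
  finally show ?thesis .
qed

lemma green_y:
  assumes hc: "continuous_on (closure \<Omega>) h" and h0: "\<And>z. z \<in> \<sigma> \<union> AC \<Longrightarrow> h z = 0"
    and der: "\<And>z. z \<in> \<Omega> \<Longrightarrow> ((\<lambda>s. h (fst z, s)) has_real_derivative hy z) (at (snd z))"
    and bd: "\<And>z. z \<in> \<Omega> \<Longrightarrow> \<bar>hy z\<bar> \<le> L" and hyc: "continuous_on \<Omega> hy"
  shows "I\<Omega> hy = integral {0..1} (\<lambda>s. real wx * xC * s ^ (wx - 1) * h (xC * s ^ wx, yC * s ^ wy))"
proof -
  let ?F = "\<lambda>z. indicator \<Omega> z * hy z"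
  have int: "integrable (lborel \<Otimes>\<^sub>M lborel) (\<lambda>(x, y). ?F (x, y))"
    using integrable_on_\<Omega>[OF hyc bd] by (simp add: lborel_prod case_prod_unfold)
  have "continuous_on {xC..0} R" by (rule continuous_on_subset[OF continuous_R]) (use xC_bounds in auto)
  then have fc: "continuous_on {xC..0} (\<lambda>x. h (x, R x))"
    using AC_BC_graph xC_bounds
    by (intro continuous_on_compose2[OF hc]) (auto intro!: continuous_intros simp: closure_eq)
  then have fc': "continuous_on {xC..0} (\<lambda>x. - h (x, R x))" by (intro continuous_intros)
  have set: "set_integrable lborel {xC..0} (\<lambda>x. - h (x, R x))" by (rule borel_integrable_atLeastAtMost'[OF fc'])
  have "I\<Omega> hy = (LINT z|(lborel \<Otimes>\<^sub>M lborel). ?F z)" by (simp add: I\<Omega>_def lborel_prod)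
  also have "\<dots> = (LINT x|lborel. (LINT y|lborel. ?F (x, y)))"
    using lborel_pair.integral_fst[OF int] by (simp add: case_prod_unfold)
  also have "\<dots> = (LINT x|lborel. indicator {xC..0} x * - h (x, R x))"
  proof (rule integral_cong_AE)
    show "(\<lambda>x. (LINT y|lborel. ?F (x, y))) \<in> borel_measurable lborel"
      using lborel_pair.integrable_fst[OF int] by (simp add: borel_measurable_integrable case_prod_unfold)
    show "(\<lambda>x. indicator {xC..0} x * - h (x, R x)) \<in> borel_measurable lborel"
      using set unfolding set_integrable_def by (simp only: borel_measurable_integrable real_scaleR_def)
    have "AE x in lborel. x \<noteq> 0 \<and> x \<noteq> xC" using AE_lborel_singleton[of 0] AE_lborel_singleton[of xC] by auto
    then show "AE x in lborel. (LINT y|lborel. ?F (x, y)) = indicator {xC..0} x * - h (x, R x)"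
      by eventually_elim (use vertical_slice[OF hc h0 der bd hyc] in auto)
  qed
  also have "\<dots> = integral {xC..0} (\<lambda>x. - h (x, R x))"
    using set_borel_integral_eq_integral(2)[OF set] unfolding set_lebesgue_integral_def by (simp only: real_scaleR_def)
  also have "\<dots> = integral {0..1} (\<lambda>s. real wx * xC * s ^ (wx - 1) * h (xC * s ^ wx, yC * s ^ wy))"
  proof -
    define g where "g s = xC * s ^ wx" for s
    have "g ` {0..1} \<subseteq> {xC..0}"
    proof
      fix y assume "y \<in> g ` {0..1}"
      then obtain s where s: "y = xC * s ^ wx" "0 \<le> s" "s \<le> 1" unfolding g_def image_iff Bex_def atLeastAtMost_iff by blast
      have "s ^ wx \<le> 1" "0 \<le> s ^ wx" using s power_le_one by auto
      then show "y \<in> {xC..0}" using xC_bounds s mult_left_mono_neg[of "s ^ wx" 1 xC] by (auto simp: mult_nonpos_nonneg)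
    qed
    then have "((\<lambda>s. (xC * (real wx * s ^ (wx - 1))) *\<^sub>R h (g s, R (g s))) has_integral
        (integral {g 0..g 1} (\<lambda>x. h (x, R x)) - integral {g 1..g 0} (\<lambda>x. h (x, R x)))) {0..1}"
      by (intro has_integral_substitution_general[where s = "{}" and c = xC and d = 0] fc)
        (auto simp: g_def intro!: continuous_intros derivative_eq_intros)
    then have "((\<lambda>s. real wx * xC * s ^ (wx - 1) * h (g s, R (g s))) has_integral - integral {xC..0} (\<lambda>x. h (x, R x))) {0..1}"
      using xC_bounds weights by (simp add: g_def zero_power mult_ac)
    then have "((\<lambda>s. real wx * xC * s ^ (wx - 1) * h (xC * s ^ wx, yC * s ^ wy)) has_integral - integral {xC..0} (\<lambda>x. h (x, R x))) {0..1}"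
      by (rule has_integral_eq[rotated]) (auto simp: g_def R_curve)
    then show ?thesis by (simp add: has_integral_iff)
  qed
  finally show ?thesis .
qed

end

section \<open>A solution and its dilates\<close>

text \<open>The functions \<open>u1\<close>, \<open>u2\<close> and \<open>u11\<close>, \<open>u12\<close>, \<open>u21\<close>, \<open>u22\<close> are the continuous extensions to the closure of the
  partial derivatives of first and second order.\<close>

locale tricomi_solution = tricomi_geometry +
  fixes u u1 u2 u11 u12 u21 u22 :: "real \<times> real \<Rightarrow> real" and \<alpha> :: real
  assumes cont: "continuous_on (closure \<Omega>) u" "continuous_on (closure \<Omega>) u1" "continuous_on (closure \<Omega>) u2"
      "continuous_on (closure \<Omega>) u11" "continuous_on (closure \<Omega>) u12"
      "continuous_on (closure \<Omega>) u21" "continuous_on (closure \<Omega>) u22"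
    and du: "\<And>z. z \<in> \<Omega> \<Longrightarrow> (u has_derivative (\<lambda>h. u1 z * fst h + u2 z * snd h)) (at z)"
    and du1: "\<And>z. z \<in> \<Omega> \<Longrightarrow> (u1 has_derivative (\<lambda>h. u11 z * fst h + u12 z * snd h)) (at z)"
    and du2: "\<And>z. z \<in> \<Omega> \<Longrightarrow> (u2 has_derivative (\<lambda>h. u21 z * fst h + u22 z * snd h)) (at z)"
    and \<alpha>: "\<alpha> > 0" "\<alpha> > critical_exponent m1 m2 - 1"
    and pde: "\<And>z. z \<in> \<Omega> \<Longrightarrow> snd z ^ m1 * u11 z + fst z ^ m2 * u22 z = - (u z * \<bar>u z\<bar> powr (\<alpha> - 1))"
    and bc: "\<And>z. z \<in> \<sigma> \<union> AC \<Longrightarrow> u z = 0"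
begin

definition f :: "real \<Rightarrow> real" where "f s = s * \<bar>s\<bar> powr (\<alpha> - 1)"
definition F :: "real \<Rightarrow> real" where "F s = \<bar>s\<bar> powr (\<alpha> + 1) / (\<alpha> + 1)"
text \<open>The energy density: the quadratic form of the operator on the gradient, indefinite for \<open>y < 0\<close>.\<close>

definition Q :: "real \<times> real \<Rightarrow> real" where
  "Q z = snd z ^ m1 * (u1 z)\<^sup>2 + fst z ^ m2 * (u2 z)\<^sup>2"
text \<open>The degrees of homogeneity: the energy density of \<open>u \<circ> dil t\<close> is \<open>t\<^bsup>E\<^esup> Q (dil t z)\<close>, and its integral scales like
  \<open>t\<^bsup>- N\<^esup>\<close>.\<close>

definition N :: nat where "N = m1 + m2 + m1 * m2"
definition E :: real where "E = 4 - real m1 * real m2"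

lemma N_ge_1: "N \<ge> 1" using m1_odd by (auto simp: N_def elim!: oddE)
lemma E_eq: "E = real (wx + wy) - real N" by (simp add: E_def N_def wx_def wy_def)
lemma compact_closure_\<Omega>: "compact (closure \<Omega>)"
  using bounded_\<Omega> by (simp add: compact_closure)

lemma bounded_on_closure:
  assumes "continuous_on (closure \<Omega>) \<phi>"
  shows "\<exists>B\<ge>0. \<forall>z\<in>closure \<Omega>. \<bar>\<phi> z :: real\<bar> \<le> B"
proof -
  have "bounded (\<phi> ` closure \<Omega>)"
    using assms compact_closure_\<Omega> compact_continuous_image compact_imp_bounded by blast
  then obtain B where "B > 0" "\<And>z. z \<in> closure \<Omega> \<Longrightarrow> \<bar>\<phi> z\<bar> \<le> B"
    by (auto simp: bounded_pos)
  then show ?thesis by (intro exI[of _ B]) auto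
qed

definition sup_bound :: real where
  "sup_bound = (SOME B. B \<ge> 1 \<and> (\<forall>\<phi>\<in>{fst, snd, u, u1, u2, u11, u12, u21, u22}. \<forall>z\<in>closure \<Omega>. \<bar>\<phi> z\<bar> \<le> B))"

lemma sup_bound: "sup_bound \<ge> 1" "\<And>\<phi> z. \<phi> \<in> {fst, snd, u, u1, u2, u11, u12, u21, u22} \<Longrightarrow> z \<in> closure \<Omega> \<Longrightarrow> \<bar>\<phi> z\<bar> \<le> sup_bound"
proof -
  let ?S = "{fst, snd, u, u1, u2, u11, u12, u21, u22}"
  have "\<forall>\<phi>\<in>?S. continuous_on (closure \<Omega>) \<phi>" using cont by (auto intro!: continuous_intros)
  then have "\<forall>\<phi>\<in>?S. \<exists>B\<ge>0. \<forall>z\<in>closure \<Omega>. \<bar>\<phi> z\<bar> \<le> B" using bounded_on_closure by blast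
  then obtain b where b: "\<And>\<phi>. \<phi> \<in> ?S \<Longrightarrow> 0 \<le> b \<phi> \<and> (\<forall>z\<in>closure \<Omega>. \<bar>\<phi> z\<bar> \<le> b \<phi>)" by metis
  have "b \<phi> \<le> sum b ?S" if "\<phi> \<in> ?S" for \<phi> using b that by (intro member_le_sum) auto
  then have "1 + sum b ?S \<ge> 1 \<and> (\<forall>\<phi>\<in>?S. \<forall>z\<in>closure \<Omega>. \<bar>\<phi> z\<bar> \<le> 1 + sum b ?S)"
    using b sum_nonneg[of ?S b] by (smt (verit))
  then have "\<exists>B. B \<ge> 1 \<and> (\<forall>\<phi>\<in>?S. \<forall>z\<in>closure \<Omega>. \<bar>\<phi> z\<bar> \<le> B)" by blast
  from someI_ex[OF this] show "sup_bound \<ge> 1" "\<And>\<phi> z. \<phi> \<in> ?S \<Longrightarrow> z \<in> closure \<Omega> \<Longrightarrow> \<bar>\<phi> z\<bar> \<le> sup_bound"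
    unfolding sup_bound_def by blast+
qed

lemma sup_bounds:
  assumes "z \<in> closure \<Omega>"
  shows "\<bar>fst z\<bar> \<le> sup_bound" "\<bar>snd z\<bar> \<le> sup_bound" "\<bar>u z\<bar> \<le> sup_bound" "\<bar>u1 z\<bar> \<le> sup_bound" "\<bar>u2 z\<bar> \<le> sup_bound"
    "\<bar>u11 z\<bar> \<le> sup_bound" "\<bar>u12 z\<bar> \<le> sup_bound" "\<bar>u21 z\<bar> \<le> sup_bound" "\<bar>u22 z\<bar> \<le> sup_bound"
  using sup_bound(2)[OF _ assms] by auto

lemma in_closure: "z \<in> \<Omega> \<Longrightarrow> z \<in> closure \<Omega>" using closure_subset by blast

definition lip :: real where "lip = real (wx + wy) * sup_bound\<^sup>2"

lemma lip_nonneg: "lip \<ge> 0" by (simp add: lip_def)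

text \<open>The constant \<open>lip\<close> bounds the derivative of \<open>\<phi>\<close> along the orbit, which lies in the domain except
  possibly for its end points \<open>z\<close> and \<open>dil s z\<close>.\<close>

lemma dil_Lipschitz:
  assumes \<phi>: "continuous_on (closure \<Omega>) \<phi>"
    and d\<phi>: "\<And>z. z \<in> \<Omega> \<Longrightarrow> (\<phi> has_derivative (\<lambda>h. p z * fst h + q z * snd h)) (at z)"
    and bd: "\<And>z. z \<in> \<Omega> \<Longrightarrow> \<bar>p z\<bar> \<le> sup_bound" "\<And>z. z \<in> \<Omega> \<Longrightarrow> \<bar>q z\<bar> \<le> sup_bound"
    and z: "z \<in> closure \<Omega>" and s: "0 \<le> s" "s \<le> 1"
    and ins: "\<And>r. s < r \<Longrightarrow> r < 1 \<Longrightarrow> dil r z \<in> \<Omega>"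
  shows "\<bar>\<phi> (dil s z) - \<phi> z\<bar> \<le> lip * (1 - s)"
proof (cases "s = 1")
  case True then show ?thesis by simp
next
  case False
  then have s1: "s < 1" using s by simp
  define \<phi>' where "\<phi>' r = p (dil r z) * (real wx * r ^ (wx - 1) * fst z) + q (dil r z) * (real wy * r ^ (wy - 1) * snd z)" for r
  have "continuous_on {s..1} (\<lambda>r. \<phi> (dil r z))"
    by (rule continuous_on_compose2[OF \<phi>]) (use dil_closure[OF z] s in \<open>auto intro!: continuous_dil_par\<close>)
  moreover have "((\<lambda>r. \<phi> (dil r z)) has_real_derivative \<phi>' r) (at r)" if r: "s < r" "r < 1" for r
  proof -
    have "((\<lambda>r. dil r z) has_derivative (\<lambda>h. (real wx * r ^ (wx - 1) * fst z * h, real wy * r ^ (wy - 1) * snd z * h))) (at r)"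
      unfolding dil_def by (auto intro!: derivative_eq_intros simp: mult_ac)
    from has_derivative_compose[OF this d\<phi>[OF ins[OF r]]]
    have "((\<lambda>r. \<phi> (dil r z)) has_derivative (\<lambda>h. \<phi>' r * h)) (at r)"
      by (rule has_derivative_eq_rhs) (simp add: \<phi>'_def fun_eq_iff algebra_simps)
    then show ?thesis by (simp add: has_field_derivative_def)
  qed
  ultimately obtain r where r: "s < r" "r < 1" "\<phi> (dil 1 z) - \<phi> (dil s z) = (1 - s) * \<phi>' r"
    using real_mvt[OF s1] by blast
  have pow: "\<bar>r ^ n\<bar> \<le> 1" for n using r(1,2) s(1) power_le_one[of r n] by simp
  have term_le: "\<bar>a * (real k * r ^ n * b)\<bar> \<le> sup_bound * (real k * 1 * sup_bound)" if "\<bar>a\<bar> \<le> sup_bound" "\<bar>b\<bar> \<le> sup_bound" for a b k n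
    unfolding abs_mult using that pow[of n] by (intro mult_mono) simp_all
  have "\<bar>p (dil r z) * (real wx * r ^ (wx - 1) * fst z)\<bar> \<le> sup_bound * (real wx * 1 * sup_bound)"
    by (rule term_le[OF bd(1)[OF ins[OF r(1,2)]] sup_bounds(1)[OF z]])
  moreover have "\<bar>q (dil r z) * (real wy * r ^ (wy - 1) * snd z)\<bar> \<le> sup_bound * (real wy * 1 * sup_bound)"
    by (rule term_le[OF bd(2)[OF ins[OF r(1,2)]] sup_bounds(2)[OF z]])
  ultimately have "\<bar>\<phi>' r\<bar> \<le> lip"
    unfolding \<phi>'_def lip_def by (simp add: algebra_simps power2_eq_square)
  then have "(1 - s) * \<bar>\<phi>' r\<bar> \<le> (1 - s) * lip" using s by (intro mult_left_mono) auto
  moreover have "\<bar>\<phi> (dil s z) - \<phi> z\<bar> = (1 - s) * \<bar>\<phi>' r\<bar>"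
    using r(3) s1 by (metis abs_minus_commute abs_mult abs_of_pos diff_gt_0_iff_gt dil_1)
  ultimately show ?thesis by (simp add: mult.commute)
qed

lemma increments:
  assumes "z \<in> \<Omega>" "0 < t" "t \<le> 1"
  shows "\<bar>u (dil t z) - u z\<bar> \<le> lip * (1 - t)" "\<bar>u1 (dil t z) - u1 z\<bar> \<le> lip * (1 - t)"
    "\<bar>u2 (dil t z) - u2 z\<bar> \<le> lip * (1 - t)"
proof -
  note c = in_closure[OF assms(1)]
  have i: "dil r z \<in> \<Omega>" if "t < r" "r < 1" for r using dil_in assms that by simp
  show "\<bar>u (dil t z) - u z\<bar> \<le> lip * (1 - t)"
    by (rule dil_Lipschitz[OF cont(1) du _ _ c _ _ i]) (use assms sup_bounds in_closure in auto)
  show "\<bar>u1 (dil t z) - u1 z\<bar> \<le> lip * (1 - t)"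
    by (rule dil_Lipschitz[OF cont(2) du1 _ _ c _ _ i]) (use assms sup_bounds in_closure in auto)
  show "\<bar>u2 (dil t z) - u2 z\<bar> \<le> lip * (1 - t)"
    by (rule dil_Lipschitz[OF cont(3) du2 _ _ c _ _ i]) (use assms sup_bounds in_closure in auto)
qed

text \<open>By \<open>exit_point\<close> such a point is the image of a boundary point with \<open>u = 0\<close> under a contraction with a factor
  between \<open>t\<close> and \<open>1\<close>.\<close>

lemma small_in_layer:
  assumes "z \<in> \<Omega>" "0 < t" "t \<le> 1" "z \<notin> dil t ` \<Omega>"
  shows "\<bar>u z\<bar> \<le> lip * (1 - t)"
proof -
  obtain p s where p: "p \<in> \<sigma> \<union> AC" "t \<le> s" "s < 1" "z = dil s p"
    "\<And>s'. s \<le> s' \<Longrightarrow> s' < 1 \<Longrightarrow> dil s' p \<in> \<Omega>"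
    using exit_point[OF assms] by metis
  have c: "p \<in> closure \<Omega>" using p(1) by (auto simp: closure_eq)
  have "\<bar>u (dil s p) - u p\<bar> \<le> lip * (1 - s)"
    by (rule dil_Lipschitz[OF cont(1) du _ _ c]) (use assms p sup_bounds in_closure in auto)
  also have "\<dots> \<le> lip * (1 - t)" using lip_nonneg p by (intro mult_left_mono) auto
  finally show ?thesis using bc[OF p(1)] p by simp
qed

subsection \<open>The energy density on \<open>AC\<close>\<close>

text \<open>On \<open>AC\<close> this is the slope of a characteristic: its square times \<open>(- y)\<^bsup>m1\<^esup>\<close> is \<open>x\<^bsup>m2\<^esup>\<close>.\<close>

lemma R_derivative:
  assumes "2 * x0 < x" "x < xC"
  shows "(R has_real_derivative - (x ^ (half_wy - 1)) * (- R x) powr (- (real m1 / 2))) (at x)"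
proof -
  define k where "k = real wx / real wy"
  have \<eta>x: "\<eta>0 / 2 < \<eta> x" "\<eta> x < \<eta>0"
    using \<eta>_strict[OF assms(2)] \<eta>_xC \<eta>_strict[OF assms(1)] by (auto simp: \<eta>0_def)
  have k: "k > 0" using weights by (simp add: k_def)
  define c where "c = k * (\<eta>0 - \<eta> x)"
  have c: "c > 0" using k \<eta>x by (simp add: c_def)
  have "min (\<eta> x) (\<eta>0 - \<eta> x) = \<eta>0 - \<eta> x" using \<eta>x by simp
  then have Rx: "- R x = c powr (2 / real wx)" by (simp add: R_def \<zeta>_def k_def c_def)
  have "((\<lambda>x. - ((k * (\<eta>0 - \<eta> x)) powr (2 / real wx))) has_real_derivative
      - (k * (real half_wy * x ^ (half_wy - 1)) * (2 / real wx) * c powr (2 / real wx - 1))) (at x)"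
    unfolding \<eta>_def using c by (auto intro!: derivative_eq_intros simp: c_def \<eta>_def powr_diff)
  moreover have "k * real half_wy * (2 / real wx) = 1" using weights by (simp add: k_def)
  then have "k * (real half_wy * x ^ (half_wy - 1)) * (2 / real wx) = x ^ (half_wy - 1)"
    by (metis (no_types, lifting) mult.assoc mult.commute mult.right_neutral)
  moreover have "c powr (2 / real wx - 1) = (- R x) powr (- (real m1 / 2))"
  proof -
    have "2 / real wx * (- (real m1 / 2)) = 2 / real wx - 1" by (simp add: wx_def field_simps)
    then show ?thesis unfolding Rx powr_powr by simp
  qed
  ultimately have "((\<lambda>x. - ((k * (\<eta>0 - \<eta> x)) powr (2 / real wx))) has_real_derivative
      - (x ^ (half_wy - 1)) * (- R x) powr (- (real m1 / 2))) (at x)" by (simp only: mult_minus_left)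
  moreover have "\<forall>\<^sub>F y in nhds x. y \<in> {2 * x0<..<xC}" using assms by (intro eventually_nhds_in_open) auto
  then have "\<forall>\<^sub>F y in nhds x. - ((k * (\<eta>0 - \<eta> y)) powr (2 / real wx)) = R y"
  proof eventually_elim
    case (elim y)
    then have "min (\<eta> y) (\<eta>0 - \<eta> y) = \<eta>0 - \<eta> y" using \<eta>_strict[of y xC] \<eta>_xC by simp
    then show ?case by (simp add: R_def \<zeta>_def k_def)
  qed
  ultimately show ?thesis using DERIV_cong_ev[OF refl _ refl] by metis
qed

text \<open>As \<open>u\<close> vanishes on \<open>AC\<close>, its tangential derivative vanishes there, so the gradient is conormal; the
  quadratic form is zero on conormals of a characteristic. The gradient is only a limit from inside at the
  boundary, and the tangential derivative is computed on \<open>AC\<close> as a limit of contracted copies of \<open>AC\<close>.\<close>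

lemma Q_on_AC:
  assumes "p \<in> AC"
  shows "Q p = 0"
proof -
  define R' where "R' x = - (x ^ (half_wy - 1)) * (- R x) powr (- (real m1 / 2))" for x
  have sub: "{2 * x0<..<xC} \<subseteq> {2 * x0..0}" using xC_bounds by auto
  have Rc: "continuous_on {2 * x0<..<xC} R" by (rule continuous_on_subset[OF continuous_R sub])
  have Rn: "R x < 0" if "x \<in> {2 * x0<..<xC}" for x using R_neg that xC_bounds by simp
  have R'c: "continuous_on {2 * x0<..<xC} R'"
    unfolding R'_def using Rn by (intro continuous_intros Rc) force
  have gc: "continuous_on {2 * x0..0} (\<lambda>x. \<phi> (x, R x))" if "continuous_on (closure \<Omega>) \<phi>" for \<phi> :: "_ \<Rightarrow> real"
    by (rule continuous_on_compose2[OF that])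
      (use AC_BC_graph in \<open>auto intro!: continuous_intros continuous_R simp: closure_eq\<close>)
  have tri: "\<xi> (R x) < \<eta> x" "\<xi> (R x) + \<eta> x = \<eta>0" if "x \<in> {2 * x0<..<xC}" for x
  proof -
    have "\<eta>0 / 2 < \<eta> x" "\<eta> x < \<eta>0"
      using \<eta>_strict[of x xC] \<eta>_xC \<eta>_strict[of "2 * x0" x] that by (auto simp: \<eta>0_def)
    then show "\<xi> (R x) < \<eta> x" "\<xi> (R x) + \<eta> x = \<eta>0" using \<xi>_\<zeta>[of "\<eta>0 - \<eta> x"] by (auto simp: R_def min_def)
  qed
  have tang: "u1 (x, R x) + u2 (x, R x) * R' x = 0" if x: "x \<in> {2 * x0<..<xC}" for x
  proof -
    have "((\<lambda>x. u (x, R x)) has_real_derivative u1 (x, R x) + u2 (x, R x) * R' x) (at x)"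
    proof (rule FTC_converse[where a = "2 * x0" and b = xC])
      show "continuous_on {2 * x0<..<xC} (\<lambda>x. u1 (x, R x) + u2 (x, R x) * R' x)"
        using gc[OF cont(2)] gc[OF cont(3)] sub by (intro continuous_intros R'c) (auto intro: continuous_on_subset)
      fix s t assume st: "2 * x0 < s" "s \<le> t" "t < xC"
      have sub': "{s..t} \<subseteq> {2 * x0<..<xC}" using st by auto
      have "((\<lambda>r. u1 ((1 - 0) ^ wx * r, (1 - 0) ^ wy * R r) * (1 - 0) ^ wx
              + u2 ((1 - 0) ^ wx * r, (1 - 0) ^ wy * R r) * ((1 - 0) ^ wy * R' r))
            has_integral (u ((1 - 0) ^ wx * t, (1 - 0) ^ wy * R t) - u ((1 - 0) ^ wx * s, (1 - 0) ^ wy * R s))) {s..t}"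
      proof (rule boundary_path_integral[OF cont(1,2,3) du, where ?d0.0 = "1/2"])
        show "\<Omega> \<subseteq> closure \<Omega>" by (rule closure_subset)
        fix d r :: real assume r: "r \<in> {s..t}" and d: "d \<le> 1/2"
        have r': "r \<in> {2 * x0<..<xC}" using r sub' by blast
        have "(r, R r) \<in> AC \<union> BC" unfolding AC_BC_graph using r' sub by blast
        then have pc: "(r, R r) \<in> closure \<Omega>" by (auto simp: closure_eq)
        show "((1 - d) ^ wx * r, (1 - d) ^ wy * R r) \<in> closure \<Omega>" if "0 \<le> d"
          using dil_closure[OF pc, of "1 - d"] that d by (simp add: dil_def)
        show "((1 - d) ^ wx * r, (1 - d) ^ wy * R r) \<in> \<Omega>" if "0 < d"
        proof -
          have y: "(1 - d) ^ wy * R r < 0" using Rn[OF r'] d by (intro mult_pos_neg) auto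
          have "(1 - d) ^ (wx * half_wy) < 1" using that d weights power_less_one_iff[of "1 - d" "wx * half_wy"] by auto
          moreover have "(1 - d) ^ (wx * half_wy) > 0" using d by auto
          ultimately have "(1 - d) ^ (wx * half_wy) * \<xi> (R r) < (1 - d) ^ (wx * half_wy) * \<eta> r"
            "(1 - d) ^ (wx * half_wy) * (\<xi> (R r) + \<eta> r) < \<eta>0"
            using tri[OF r'] \<eta>0_pos by auto
          then show ?thesis unfolding lower_half_triangle[OF y] using d by (simp add: \<xi>_dil \<eta>_dil distrib_left)
        qed
        show "((\<lambda>r. (1 - d) ^ wx * r) has_real_derivative (1 - d) ^ wx) (at r)"
          by (auto intro!: derivative_eq_intros)
        show "((\<lambda>r. (1 - d) ^ wy * R r) has_real_derivative (1 - d) ^ wy * R' r) (at r)"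
          using R_derivative[of r] r' unfolding R'_def by (auto intro!: derivative_eq_intros)
      next
        have "continuous_on ({0..1/2} \<times> {s..t}) (\<lambda>x. R (snd x))"
          by (rule continuous_on_compose2[OF Rc]) (use sub' in \<open>auto intro!: continuous_intros\<close>)
        then show "continuous_on ({0..1/2} \<times> {s..t}) (\<lambda>(d, r). (1 - d) ^ wy * R r)"
          unfolding case_prod_unfold by (intro continuous_intros)
        have "continuous_on ({0..1/2} \<times> {s..t}) (\<lambda>x. R' (snd x))"
          by (rule continuous_on_compose2[OF R'c]) (use sub' in \<open>auto intro!: continuous_intros\<close>)
        then show "continuous_on ({0..1/2} \<times> {s..t}) (\<lambda>(d, r). (1 - d) ^ wy * R' r)"
          unfolding case_prod_unfold by (intro continuous_intros)
      qed (use st in \<open>auto simp: case_prod_unfold intro!: continuous_intros\<close>)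
      then show "((\<lambda>x. u1 (x, R x) + u2 (x, R x) * R' x) has_integral (u (t, R t) - u (s, R s))) {s..t}"
        by simp
    qed (use x in auto)
    moreover have "((\<lambda>x. u (x, R x)) has_real_derivative 0) (at x)"
    proof (rule DERIV_cong_ev[THEN iffD1, OF refl _ refl DERIV_const[of 0]])
      have "\<forall>\<^sub>F y in nhds x. y \<in> {2 * x0<..<xC}" using x by (intro eventually_nhds_in_open) auto
      then show "\<forall>\<^sub>F y in nhds x. 0 = u (y, R y)"
      proof eventually_elim
        case (elim y)
        have "(y, R y) \<in> AC" using tri[OF elim] Rn[OF elim] elim xC_bounds by (auto simp: AC_iff)
        then show ?case using bc by simp
      qed
    qed
    ultimately show ?thesis using DERIV_unique by blast
  qed
  have Qc: "continuous_on {2 * x0..xC} (\<lambda>x. Q (x, R x))"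
  proof -
    have sub: "{2 * x0..xC} \<subseteq> {2 * x0..0}" using xC_bounds by auto
    show ?thesis unfolding Q_def using gc[OF cont(2)] gc[OF cont(3)] continuous_R sub
      by (auto intro!: continuous_intros intro: continuous_on_subset)
  qed
  have Q0: "Q (x, R x) = 0" if x: "x \<in> {2 * x0<..<xC}" for x
  proof -
    have "((- R x) powr (- (real m1 / 2)))\<^sup>2 = (- R x) powr (- real m1)"
      by (simp add: power2_eq_square powr_add[symmetric])
    also have "\<dots> = inverse ((- R x) ^ m1)" using Rn[OF x] by (simp add: powr_minus powr_realpow)
    finally have sq: "((- R x) powr (- (real m1 / 2)))\<^sup>2 = inverse ((- R x) ^ m1)" .
    have "(x ^ (half_wy - 1))\<^sup>2 = x ^ m2"
    proof -
      have "m2 = (half_wy - 1) * 2" using m2_even by (auto simp: half_wy_def elim!: evenE)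
      then show ?thesis by (metis power_mult)
    qed
    then have R'2: "(R' x)\<^sup>2 * (- R x) ^ m1 = x ^ m2"
      unfolding R'_def power_mult_distrib sq using Rn[OF x] by simp
    have "(R x) ^ m1 = - ((- R x) ^ m1)" using m1_odd by simp
    moreover have "u1 (x, R x) = - (u2 (x, R x) * R' x)" using tang[OF x] by simp
    ultimately have "Q (x, R x) = (u2 (x, R x))\<^sup>2 * (x ^ m2 - (R' x)\<^sup>2 * (- R x) ^ m1)"
      by (simp add: Q_def power_mult_distrib algebra_simps)
    then show ?thesis using R'2 by simp
  qed
  obtain x y where xy: "p = (x, y)" by (cases p)
  have "(x, y) \<in> (\<lambda>x. (x, R x)) ` {2 * x0..0}" using assms AC_BC_graph xy by blast
  then have x: "y = R x" "2 * x0 \<le> x" by auto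
  have "\<eta> xC \<le> \<eta> x" using assms xy \<eta>_xC by (auto simp: AC_iff)
  then have "x \<in> closure {2 * x0<..<xC}" using x xC_bounds by (auto simp: \<eta>_le_iff)
  then have "Q (x, R x) = 0"
    by (rule continuous_constant_on_closure[rotated 2, where S = "{2 * x0<..<xC}" and f = "\<lambda>x. Q (x, R x)"])
      (use Qc Q0 xC_bounds in auto)
  then show ?thesis using xy x by simp
qed

lemma continuous_Q: "continuous_on (closure \<Omega>) Q"
  unfolding Q_def using cont by (intro continuous_intros)

text \<open>For \<open>y < 0\<close> the exit point of \<open>exit_point\<close> is on \<open>AC\<close>, where \<open>Q = 0\<close>, and \<open>Q\<close> is uniformly
  continuous.\<close>

lemma Q_small_in_layer:
  assumes "e > 0"
  shows "\<forall>\<^sub>F t in at_left 1. \<forall>z\<in>\<Omega> - dil t ` \<Omega>. snd z < 0 \<longrightarrow> \<bar>Q z\<bar> \<le> e"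
proof -
  have "uniformly_continuous_on (closure \<Omega>) Q"
    using continuous_Q compact_closure_\<Omega> by (rule compact_uniformly_continuous)
  then obtain d where d: "d > 0" "\<And>z w. z \<in> closure \<Omega> \<Longrightarrow> w \<in> closure \<Omega> \<Longrightarrow> dist w z < d \<Longrightarrow> dist (Q w) (Q z) < e"
    using assms unfolding uniformly_continuous_on_def by metis
  define c where "c = sup_bound * real (wx + wy)"
  have "((\<lambda>t. c * (1 - t)) \<longlongrightarrow> c * (1 - 1)) (at_left 1)" by (intro tendsto_intros)
  then have "\<forall>\<^sub>F t in at_left 1. c * (1 - t) < d" using d by (auto dest: order_tendstoD)
  moreover have "\<forall>\<^sub>F t in at_left (1::real). t \<in> {0<..<1}" by (intro eventually_at_leftI[of 0]) auto
  ultimately show ?thesis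
  proof eventually_elim
    case (elim t)
    show ?case
    proof (intro ballI impI)
      fix z assume z: "z \<in> \<Omega> - dil t ` \<Omega>" "snd z < 0"
      obtain p s where p: "p \<in> \<sigma> \<union> AC" "t \<le> s" "s < 1" "z = dil s p"
        "\<And>s'. s \<le> s' \<Longrightarrow> s' < 1 \<Longrightarrow> dil s' p \<in> \<Omega>"
        using exit_point[of z t] z elim by (metis DiffD1 DiffD2 greaterThanLessThan_iff less_imp_le)
      have s: "0 < s" using p elim by simp
      have pc: "p \<in> closure \<Omega>" using p(1) by (auto simp: closure_eq)
      have "snd p < 0" using z(2) p(4) s by (simp add: dil_def mult_less_0_iff)
      then have "p \<in> AC" using p(1) \<sigma>_nonneg[of p] by auto
      then have Qp: "Q p = 0" by (rule Q_on_AC)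
      have comp: "\<bar>s ^ n * r - r\<bar> \<le> real n * (1 - t) * sup_bound" if "\<bar>r\<bar> \<le> sup_bound" for n r
      proof -
        have "s ^ n * r - r = - ((1 - s ^ n) * r)" by (simp add: algebra_simps)
        then have "\<bar>s ^ n * r - r\<bar> = (1 - s ^ n) * \<bar>r\<bar>"
          using s p power_le_one[of s n] by (simp only: abs_minus_cancel abs_mult) simp
        also have "\<dots> \<le> (real n * (1 - s)) * sup_bound"
          using one_minus_power_le[of s n] s p that by (intro mult_mono) (auto simp: power_le_one)
        also have "\<dots> \<le> (real n * (1 - t)) * sup_bound"
          using p sup_bound by (intro mult_right_mono mult_left_mono) auto
        finally show ?thesis .
      qed
      have "dist z p \<le> \<bar>s ^ wx * fst p - fst p\<bar> + \<bar>s ^ wy * snd p - snd p\<bar>"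
        unfolding p(4) dil_def dist_prod_def dist_real_def fst_conv snd_conv
        using sqrt_sum_squares_le_sum_abs by simp
      also have "\<dots> \<le> real wx * (1 - t) * sup_bound + real wy * (1 - t) * sup_bound"
        by (intro add_mono comp sup_bounds pc)
      also have "\<dots> = c * (1 - t)" by (simp add: c_def algebra_simps)
      also have "\<dots> < d" using elim by simp
      finally have "dist (Q z) (Q p) < e" using d(2)[OF pc, of z] z in_closure by blast
      then show "\<bar>Q z\<bar> \<le> e" using Qp by (simp add: dist_real_def)
    qed
  qed
qed

subsection \<open>The trace of the solution on \<open>BC\<close>\<close>

definition \<psi> :: "real \<Rightarrow> real" where "\<psi> s = u (xC * s ^ wx, yC * s ^ wy)"
definition \<psi>' :: "real \<Rightarrow> real" where
  "\<psi>' s = u1 (xC * s ^ wx, yC * s ^ wy) * (xC * (real wx * s ^ (wx - 1)))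
        + u2 (xC * s ^ wx, yC * s ^ wy) * (yC * (real wy * s ^ (wy - 1)))"

lemma curve_closure: "0 \<le> s \<Longrightarrow> s \<le> 1 \<Longrightarrow> (xC * s ^ wx, yC * s ^ wy) \<in> closure \<Omega>"
  using curve_BC by (auto simp: closure_eq)

lemma continuous_on_curve:
  "continuous_on (closure \<Omega>) \<phi> \<Longrightarrow> continuous_on {0..1} (\<lambda>s. \<phi> (xC * s ^ wx, yC * s ^ wy) :: real)"
  by (rule continuous_on_compose2[where t = "closure \<Omega>" and g = \<phi>]) (use curve_closure in \<open>auto intro!: continuous_intros\<close>)

lemma continuous_\<psi>: "continuous_on {0..1} \<psi>"
  unfolding \<psi>_def by (rule continuous_on_curve[OF cont(1)])

lemma continuous_\<psi>': "continuous_on {0..1} \<psi>'"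
  unfolding \<psi>'_def by (intro continuous_intros continuous_on_curve cont)

lemma \<psi>_1: "\<psi> 1 = 0" unfolding \<psi>_def using bc C_in by simp

text \<open>The arc \<open>BC\<close> is stretched in the direction of \<open>x\<close> by \<open>1 + d\<close>, which moves it into the triangle as long as it
  stays away from \<open>C\<close>; this bounds \<open>d\<close> in terms of the largest parameter \<open>t < 1\<close>.\<close>

lemma \<psi>_derivative:
  assumes "0 < s" "s < 1"
  shows "(\<psi> has_real_derivative \<psi>' s) (at s)"
proof (rule FTC_converse[OF _ _ assms])
  show "continuous_on {0<..<1} \<psi>'" by (rule continuous_on_subset[OF continuous_\<psi>']) auto
  fix s t :: real assume st: "0 < s" "s \<le> t" "t < 1"
  define d0 where "d0 = 1 / t - 1"
  have d0: "d0 > 0" using st by (simp add: d0_def)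
  have "((\<lambda>r. u1 ((1 + 0) * (xC * r ^ wx), yC * r ^ wy) * ((1 + 0) * (xC * (real wx * r ^ (wx - 1))))
          + u2 ((1 + 0) * (xC * r ^ wx), yC * r ^ wy) * (yC * (real wy * r ^ (wy - 1))))
        has_integral (u ((1 + 0) * (xC * t ^ wx), yC * t ^ wy) - u ((1 + 0) * (xC * s ^ wx), yC * s ^ wy))) {s..t}"
  proof (rule boundary_path_integral[OF cont(1,2,3) du _ _ d0])
    show "\<Omega> \<subseteq> closure \<Omega>" by (rule closure_subset)
    fix d r :: real assume r: "r \<in> {s..t}" and d: "d \<le> d0"
    have r01: "0 < r" "r < 1" using r st by auto
    show \<Omega>: "((1 + d) * (xC * r ^ wx), yC * r ^ wy) \<in> \<Omega>" if "0 < d"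
    proof -
      have y: "yC * r ^ wy < 0" using yC_neg r01 by (intro mult_neg_pos) auto
      have D: "\<xi> (yC * r ^ wy) = r ^ (wx * half_wy) * (\<eta>0 / 2)"
        using \<xi>_dil[of r yC] r01 \<xi>_yC by (simp add: mult.commute)
      have "\<eta> ((1 + d) * (xC * r ^ wx)) = (1 + d) ^ half_wy * \<eta> (r ^ wx * xC)"
        by (simp add: \<eta>_def power_mult_distrib mult_ac)
      then have H: "\<eta> ((1 + d) * (xC * r ^ wx)) = (1 + d) ^ half_wy * (r ^ (wx * half_wy) * (\<eta>0 / 2))"
        by (simp add: \<eta>_dil \<eta>_xC)
      have pos: "r ^ (wx * half_wy) * (\<eta>0 / 2) > 0" using r01 \<eta>0_pos by simp
      have "(1 + d) ^ half_wy > 1" using that weights by (intro one_less_power) auto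
      then have 1: "\<xi> (yC * r ^ wy) < \<eta> ((1 + d) * (xC * r ^ wx))"
        unfolding D H using mult_strict_right_mono[OF _ pos, of 1] by simp
      have "(1 + d) * r ^ wx < 1"
      proof -
        have "(1 + d) * r \<le> (1 / t) * t" using d r r01 st that by (intro mult_mono) (auto simp: d0_def)
        then have "(1 + d) * r \<le> 1" using st by simp
        moreover have "r ^ (wx - 1) < 1" using r01 weights power_less_one_iff[of r "wx - 1"] by auto
        moreover have "r ^ wx = r * r ^ (wx - 1)" using weights by (simp add: power_eq_if)
        moreover have "((1 + d) * r) * r ^ (wx - 1) \<le> 1 * r ^ (wx - 1)"
          using \<open>(1 + d) * r \<le> 1\<close> r01 by (intro mult_right_mono) auto
        ultimately show ?thesis by (simp add: mult.assoc)
      qed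
      moreover have "0 < (1 + d) * r ^ wx" using that r01 by simp
      ultimately have "((1 + d) * r ^ wx) ^ half_wy < 1" using weights power_less_one_iff[of "(1 + d) * r ^ wx" "half_wy"] by auto
      then have "(1 + d) ^ half_wy * r ^ (wx * half_wy) < 1" by (simp add: power_mult_distrib power_mult)
      moreover have "r ^ (wx * half_wy) \<le> 1" using r01 by (intro power_le_one) auto
      ultimately have "(r ^ (wx * half_wy) + (1 + d) ^ half_wy * r ^ (wx * half_wy)) * (\<eta>0 / 2) < 2 * (\<eta>0 / 2)"
        using \<eta>0_pos by (intro mult_strict_right_mono) auto
      then have "\<xi> (yC * r ^ wy) + \<eta> ((1 + d) * (xC * r ^ wx)) < \<eta>0"
        unfolding D H by (simp add: algebra_simps)
      then show ?thesis unfolding lower_half_triangle[OF y] using 1 by simp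
    qed
    show "((1 + d) * (xC * r ^ wx), yC * r ^ wy) \<in> closure \<Omega>" if "0 \<le> d"
      using \<Omega> that curve_closure[of r] r01 in_closure by (cases "d = 0") auto
    show "((\<lambda>r. (1 + d) * (xC * r ^ wx)) has_real_derivative (1 + d) * (xC * (real wx * r ^ (wx - 1)))) (at r)"
      by (auto intro!: derivative_eq_intros)
    show "((\<lambda>r. yC * r ^ wy) has_real_derivative yC * (real wy * r ^ (wy - 1))) (at r)"
      by (auto intro!: derivative_eq_intros)
  qed (use st in \<open>auto simp: case_prod_unfold intro!: continuous_intros\<close>)
  then show "(\<psi>' has_integral \<psi> t - \<psi> s) {s..t}"
    unfolding \<psi>_def \<psi>'_def[abs_def] by simp
qed

abbreviation w :: nat where "w \<equiv> wx + wy"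

subsection \<open>Integrals over the domain\<close>

lemma integrable_indicator_bounded:
  assumes "(\<lambda>z. indicator \<Omega> z * \<phi> z) \<in> borel_measurable borel" "\<And>z. z \<in> \<Omega> \<Longrightarrow> \<bar>\<phi> z\<bar> \<le> L"
  shows "integrable lborel (\<lambda>z. indicator \<Omega> z * (\<phi> z :: real))"
  by (rule integrableI_bounded_set[where A = \<Omega> and B = L])
    (use assms open_\<Omega> emeasure_bounded_finite[OF bounded_\<Omega>] in auto)

lemma integrable_indicator_continuous:
  assumes "continuous_on (closure \<Omega>) \<phi>"
  shows "integrable lborel (\<lambda>z. indicator \<Omega> z * (\<phi> z :: real))"
proof -
  obtain B where "\<forall>z\<in>closure \<Omega>. \<bar>\<phi> z\<bar> \<le> B" using bounded_on_closure[OF assms] by blast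
  then show ?thesis
    by (intro integrable_on_\<Omega>[where L = B] continuous_on_subset[OF assms closure_subset]) (use in_closure in auto)
qed

lemma I\<Omega>_cong: "(\<And>z. z \<in> \<Omega> \<Longrightarrow> \<phi> z = \<theta> z) \<Longrightarrow> I\<Omega> \<phi> = I\<Omega> \<theta>"
  unfolding I\<Omega>_def by (intro Bochner_Integration.integral_cong) (auto simp: indicator_def)

lemma I\<Omega>_mono:
  assumes "integrable lborel (\<lambda>z. indicator \<Omega> z * \<phi> z)" "integrable lborel (\<lambda>z. indicator \<Omega> z * \<theta> z)"
    "\<And>z. z \<in> \<Omega> \<Longrightarrow> \<phi> z \<le> \<theta> z"
  shows "I\<Omega> \<phi> \<le> I\<Omega> \<theta>"
  unfolding I\<Omega>_def using assms by (intro integral_mono) (auto simp: indicator_def)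

lemma I\<Omega>_add:
  assumes "integrable lborel (\<lambda>z. indicator \<Omega> z * \<phi> z)" "integrable lborel (\<lambda>z. indicator \<Omega> z * \<theta> z)"
  shows "I\<Omega> (\<lambda>z. \<phi> z + \<theta> z) = I\<Omega> \<phi> + I\<Omega> \<theta>"
  unfolding I\<Omega>_def using Bochner_Integration.integral_add[OF assms] by (simp add: distrib_left)

lemma I\<Omega>_diff:
  assumes "integrable lborel (\<lambda>z. indicator \<Omega> z * \<phi> z)" "integrable lborel (\<lambda>z. indicator \<Omega> z * \<theta> z)"
  shows "I\<Omega> (\<lambda>z. \<phi> z - \<theta> z) = I\<Omega> \<phi> - I\<Omega> \<theta>"
  unfolding I\<Omega>_def using Bochner_Integration.integral_diff[OF assms] by (simp add: right_diff_distrib)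

lemma I\<Omega>_cmult: "I\<Omega> (\<lambda>z. c * \<phi> z) = c * I\<Omega> \<phi>"
  unfolding I\<Omega>_def by (simp add: mult.left_commute)

definition area :: real where "area = I\<Omega> (\<lambda>_. 1)"

lemma area_nonneg: "area \<ge> 0" unfolding area_def I\<Omega>_def by (intro integral_nonneg_AE) auto

lemma I\<Omega>_const: "I\<Omega> (\<lambda>_. c) = c * area"
  using I\<Omega>_cmult[of c "\<lambda>_. 1"] by (simp add: area_def)

lemma comp_dil_continuous:
  assumes "continuous_on (closure \<Omega>) \<phi>" "0 \<le> t" "t \<le> 1"
  shows "continuous_on (closure \<Omega>) (\<lambda>z. \<phi> (dil t z))"
  by (rule continuous_on_compose2[OF assms(1) continuous_dil]) (use dil_closure assms(2,3) in blast)

subsection \<open>The nonlinearity and its primitive\<close>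

text \<open>In this form the continuity of \<open>f\<close> at \<open>0\<close> is visible also for \<open>\<alpha> < 1\<close>.\<close>

lemma f_alt: "f s = (max s 0) powr \<alpha> - (max (- s) 0) powr \<alpha>"
proof -
  have "r * r powr (\<alpha> - 1) = r powr \<alpha>" if "r > 0" for r :: real
    using that by (simp add: powr_mult_base)
  from this[of s] this[of "- s"] show ?thesis
    unfolding f_def by (cases "s > 0"; cases "s = 0") (auto simp: max_def)
qed

lemma continuous_f: "continuous_on A f"
proof -
  have "continuous_on A (\<lambda>s. (max s 0) powr \<alpha> - (max (- s) 0) powr \<alpha>)"
    using \<alpha> by (intro continuous_intros continuous_on_powr') auto
  then show ?thesis using f_alt by (simp add: fun_eq_iff[symmetric] cong: continuous_on_cong)
qed

lemma F_nonneg: "F s \<ge> 0" using \<alpha> by (simp add: F_def)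

lemma mult_f: "s * f s = (\<alpha> + 1) * F s"
proof (cases "s = 0")
  case False
  have "s * f s = \<bar>s\<bar> * (\<bar>s\<bar> * \<bar>s\<bar> powr (\<alpha> - 1))" by (simp add: f_def mult.assoc[symmetric] abs_mult_self_eq)
  also have "\<dots> = \<bar>s\<bar> powr (\<alpha> + 1)" using False by (simp add: powr_mult_base add.commute)
  finally show ?thesis using \<alpha> by (simp add: F_def)
qed (simp add: F_def f_def)

lemma continuous_F: "continuous_on A F"
  unfolding F_def using \<alpha> by (intro continuous_intros continuous_on_powr') auto

lemma F_derivative: "(F has_real_derivative f s) (at s)"
proof -
  consider "s > 0" | "s < 0" | "s = 0" by linarith
  then show ?thesis
  proof cases
    case 1
    have "((\<lambda>r. r powr (\<alpha> + 1) / (\<alpha> + 1)) has_real_derivative s powr \<alpha>) (at s)"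
      using 1 \<alpha> by (auto intro!: derivative_eq_intros)
    moreover have "f s = s powr \<alpha>" using 1 by (simp add: f_alt)
    moreover have "\<forall>\<^sub>F r in nhds s. r \<in> {0<..}" using 1 by (intro eventually_nhds_in_open) auto
    then have "\<forall>\<^sub>F r in nhds s. r powr (\<alpha> + 1) / (\<alpha> + 1) = F r"
      by eventually_elim (simp add: F_def)
    ultimately show ?thesis using DERIV_cong_ev[OF refl _ refl] by metis
  next
    case 2
    have "((\<lambda>r. (- r) powr (\<alpha> + 1) / (\<alpha> + 1)) has_real_derivative - ((- s) powr \<alpha>)) (at s)"
      using 2 \<alpha> by (auto intro!: derivative_eq_intros)
    moreover have "f s = - ((- s) powr \<alpha>)" using 2 by (simp add: f_alt)
    moreover have "\<forall>\<^sub>F r in nhds s. r \<in> {..<0}" using 2 by (intro eventually_nhds_in_open) auto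
    then have "\<forall>\<^sub>F r in nhds s. (- r) powr (\<alpha> + 1) / (\<alpha> + 1) = F r"
      by eventually_elim (simp add: F_def)
    ultimately show ?thesis using DERIV_cong_ev[OF refl _ refl] by metis
  next
    case 3
    have "continuous_on UNIV (\<lambda>s. f s / (\<alpha> + 1))" using \<alpha> by (intro continuous_intros continuous_f) auto
    then have "((\<lambda>r. f r / (\<alpha> + 1)) \<longlongrightarrow> f 0 / (\<alpha> + 1)) (at 0)"
      by (simp add: continuous_on_def)
    moreover have "F r / r = f r / (\<alpha> + 1)" if "r \<noteq> 0" for r
      using mult_f[of r] that \<alpha> by (simp add: field_simps)
    then have "\<forall>\<^sub>F r in at 0. f r / (\<alpha> + 1) = (F r - F 0) / (r - 0)"
      by (auto simp: eventually_at_filter F_def)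
    ultimately have "((\<lambda>r. (F r - F 0) / (r - 0)) \<longlongrightarrow> f 0 / (\<alpha> + 1)) (at 0)"
      by (rule Lim_transform_eventually)
    then show ?thesis using 3 by (simp add: has_field_derivative_iff f_def)
  qed
qed

text \<open>By the mean value theorem \<open>F p - F q\<close> is \<open>(p - q) f c\<close> with \<open>c\<close> between \<open>p\<close> and \<open>q\<close>, and \<open>f c\<close> is close to \<open>f q\<close>.
  The product \<open>q f q\<close> is \<open>(\<alpha> + 1) F q\<close>.\<close>

lemma tangent_bound:
  assumes "e > 0"
  shows "\<exists>d>0. \<forall>p q. \<bar>p\<bar> \<le> sup_bound \<longrightarrow> \<bar>q\<bar> \<le> sup_bound \<longrightarrow> \<bar>p - q\<bar> < d \<longrightarrow> p * f q \<ge> F p + \<alpha> * F q - e * \<bar>p - q\<bar>"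
proof -
  have "uniformly_continuous_on {- sup_bound..sup_bound} f"
    by (intro compact_uniformly_continuous continuous_f) simp
  then obtain d where d: "d > 0" "\<And>x y. x \<in> {- sup_bound..sup_bound} \<Longrightarrow> y \<in> {- sup_bound..sup_bound} \<Longrightarrow> \<bar>y - x\<bar> < d \<Longrightarrow> \<bar>f y - f x\<bar> < e"
    using assms unfolding uniformly_continuous_on_def dist_real_def by metis
  have "p * f q \<ge> F p + \<alpha> * F q - e * \<bar>p - q\<bar>" if pq: "\<bar>p\<bar> \<le> sup_bound" "\<bar>q\<bar> \<le> sup_bound" "\<bar>p - q\<bar> < d" for p q
  proof -
    have "\<exists>c. \<bar>c\<bar> \<le> sup_bound \<and> \<bar>c - q\<bar> \<le> \<bar>p - q\<bar> \<and> F p - F q = (p - q) * f c"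
    proof -
      consider "p = q" | "p < q" | "q < p" by linarith
      then show ?thesis
      proof cases
        case 1 then show ?thesis using pq by (intro exI[of _ q]) auto
      next
        case 2
        obtain c where "p < c" "c < q" "F q - F p = (q - p) * f c"
          using real_mvt[OF 2 continuous_F F_derivative] by blast
        then show ?thesis using pq by (intro exI[of _ c]) (auto simp: algebra_simps)
      next
        case 3
        obtain c where "q < c" "c < p" "F p - F q = (p - q) * f c"
          using real_mvt[OF 3 continuous_F F_derivative] by blast
        then show ?thesis using pq by (intro exI[of _ c]) (auto simp: algebra_simps)
      qed
    qed
    then obtain c where c: "\<bar>c\<bar> \<le> sup_bound" "\<bar>c - q\<bar> \<le> \<bar>p - q\<bar>" "F p - F q = (p - q) * f c" by blast
    have "\<bar>f q - f c\<bar> < e" using d(2)[of c q] c pq by (auto simp: abs_le_iff abs_minus_commute)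
    then have "\<bar>(p - q) * (f q - f c)\<bar> \<le> \<bar>p - q\<bar> * e" by (auto simp: abs_mult intro!: mult_left_mono)
    then have "(p - q) * f q \<ge> F p - F q - e * \<bar>p - q\<bar>"
      unfolding c(3) by (simp add: algebra_simps abs_le_iff)
    moreover have "p * f q = (p - q) * f q + (\<alpha> + 1) * F q" using mult_f[of q] by (simp add: algebra_simps)
    moreover have "(\<alpha> + 1) * F q = \<alpha> * F q + F q" by (simp add: distrib_right)
    ultimately show ?thesis by linarith
  qed
  then show ?thesis using d(1) by blast
qed

subsection \<open>The weak form tested with a dilate\<close>

text \<open>On a characteristic the conormal derivative is a multiple of the tangential derivative. With the
  parameter \<open>s\<close> of \<open>BC\<close> this multiple is \<open>\<rho> s\<^bsup>N\<^esup>\<close>. That the \<open>x\<close>- and the \<open>y\<close>-component give the same \<open>\<rho>\<close>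
  (\<open>\<rho>_x\<close> and \<open>\<rho>_y\<close>) is the equation of \<open>BC\<close> at \<open>C\<close>.\<close>

definition \<rho> :: real where "\<rho> = - (real wy * yC ^ (m1 + 1)) / (real wx * xC)"

lemma \<rho>_pos: "\<rho> > 0"
proof -
  have "yC ^ (m1 + 1) = (- yC) ^ (m1 + 1)" using m1_odd by (intro power_minus_even[symmetric]) simp
  also have "\<dots> > 0" using yC_neg by (intro zero_less_power) simp
  finally have "yC ^ (m1 + 1) > 0" .
  then have "- (real wy * yC ^ (m1 + 1)) < 0" using weights by (simp only: neg_less_0_iff_less) (intro mult_pos_pos; simp)
  moreover have "real wx * xC < 0" using xC_bounds weights by (intro mult_pos_neg) auto
  ultimately show ?thesis unfolding \<rho>_def by (rule divide_neg_neg)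
qed

lemma \<rho>_x: "\<rho> * (real wx * xC) = - (real wy * yC ^ (m1 + 1))"
  unfolding \<rho>_def using xC_bounds weights by simp

lemma \<rho>_y: "\<rho> * (real wy * yC) = real wx * xC ^ (m2 + 1)"
proof -
  have "(\<xi> yC)\<^sup>2 = (real wy / real wx)\<^sup>2 * ((- yC) powr (real wx / 2))\<^sup>2"
    by (simp add: \<xi>_def power_mult_distrib power_divide)
  also have "((- yC) powr (real wx / 2))\<^sup>2 = (- yC) powr real wx"
    by (simp add: power2_eq_square powr_add[symmetric])
  also have "\<dots> = (- yC) ^ wx" using yC_neg by (intro powr_realpow) simp
  also have "\<dots> = - (yC ^ wx)" using m1_odd by (intro power_minus_odd) (simp add: wx_def)
  finally have 1: "(\<xi> yC)\<^sup>2 = (real wy / real wx)\<^sup>2 * - (yC ^ wx)" .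
  have "(\<eta> xC)\<^sup>2 = xC ^ wy" using weights(3) by (simp add: \<eta>_def power_mult[symmetric] mult.commute)
  then have 2: "xC ^ wy = (real wy / real wx)\<^sup>2 * - (yC ^ wx)"
    using 1 \<eta>_xC \<xi>_yC by simp
  have "(real wx)\<^sup>2 * (real wy / real wx)\<^sup>2 = (real wy)\<^sup>2" using weights by (simp add: power_divide)
  then have "(real wy)\<^sup>2 * - (yC ^ wx) = (real wx)\<^sup>2 * xC ^ wy"
    unfolding 2 by (simp only: mult.assoc[symmetric])
  then have "(real wy * yC ^ (m1 + 1)) * (real wy * yC) * - 1 = (real wx * xC ^ (m2 + 1)) * (real wx * xC)"
    by (simp add: wx_def wy_def power2_eq_square mult_ac)
  moreover have "\<rho> * (real wy * yC) = (real wy * yC ^ (m1 + 1)) * (real wy * yC) * - 1 / (real wx * xC)"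
    by (simp add: \<rho>_def)
  moreover have "real wx * xC \<noteq> 0" using xC_bounds weights by simp
  then have "real wx * xC ^ (m2 + 1) * (real wx * xC) / (real wx * xC) = real wx * xC ^ (m2 + 1)"
    by (rule nonzero_mult_div_cancel_right)
  ultimately show ?thesis by (simp only:)
qed

text \<open>The boundary term on \<open>BC\<close> in the weak form for the pair \<open>u \<circ> dil t\<close>, \<open>u\<close>: the trace of \<open>u \<circ> dil t\<close> is
  \<open>s \<mapsto> \<psi> (t s)\<close>.\<close>

definition bdry :: "real \<Rightarrow> real" where
  "bdry t = \<rho> * integral {0..1} (\<lambda>s. s ^ N * (t * \<psi>' (t * s)) * \<psi> s)"

lemma E_pow:
  assumes "t > 0"
  shows "t powr E * (t ^ wy) ^ m1 = t ^ wx * t ^ wx" "t powr E * (t ^ wx) ^ m2 = t ^ wy * t ^ wy"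
proof -
  have "E + real (wy * m1) = real (wx + wx)" "E + real (wx * m2) = real (wy + wy)"
    by (auto simp: E_def wx_def wy_def algebra_simps)
  then show "t powr E * (t ^ wy) ^ m1 = t ^ wx * t ^ wx" "t powr E * (t ^ wx) ^ m2 = t ^ wy * t ^ wy"
    unfolding power_mult[symmetric] power_add[symmetric]
    by (simp_all only: powr_realpow[OF assms, symmetric] powr_add[symmetric])
qed

lemma boundary_integrand:
  "real wx * xC * s ^ (wx - 1) * (v * ((xC * s ^ wx) ^ m2 * (t ^ wy * Y)))
    - real wy * yC * s ^ (wy - 1) * (v * ((yC * s ^ wy) ^ m1 * (t ^ wx * X)))
   = \<rho> * (s ^ N * (t * (X * (xC * (real wx * (t * s) ^ (wx - 1))) + Y * (yC * (real wy * (t * s) ^ (wy - 1))))) * v)"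
proof -
  have s1: "s ^ (wy - 1) * (s ^ wy) ^ m1 = s ^ N * s ^ (wx - 1)"
    unfolding power_mult[symmetric] power_add[symmetric] by (simp add: wx_def wy_def N_def algebra_simps)
  have s2: "s ^ (wx - 1) * (s ^ wx) ^ m2 = s ^ N * s ^ (wy - 1)"
    unfolding power_mult[symmetric] power_add[symmetric] by (simp add: wx_def wy_def N_def algebra_simps)
  have t1: "t * t ^ (wx - 1) = t ^ wx" "t * t ^ (wy - 1) = t ^ wy" by (simp_all add: wx_def wy_def)
  have A: "- (real wy * yC * s ^ (wy - 1) * (v * ((yC * s ^ wy) ^ m1 * (t ^ wx * X))))
     = - (real wy * yC ^ (m1 + 1)) * (s ^ (wy - 1) * (s ^ wy) ^ m1) * t ^ wx * X * v"
    by (simp add: power_mult_distrib algebra_simps)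
  have B: "real wx * xC * s ^ (wx - 1) * (v * ((xC * s ^ wx) ^ m2 * (t ^ wy * Y)))
     = (real wx * xC ^ (m2 + 1)) * (s ^ (wx - 1) * (s ^ wx) ^ m2) * t ^ wy * Y * v"
    by (simp add: power_mult_distrib algebra_simps)
  have C: "\<rho> * (s ^ N * (t * (X * (xC * (real wx * (t * s) ^ (wx - 1))) + Y * (yC * (real wy * (t * s) ^ (wy - 1))))) * v)
     = (\<rho> * (real wx * xC)) * (s ^ N * s ^ (wx - 1)) * (t * t ^ (wx - 1)) * X * v
       + (\<rho> * (real wy * yC)) * (s ^ N * s ^ (wy - 1)) * (t * t ^ (wy - 1)) * Y * v"
    by (simp add: power_mult_distrib algebra_simps)
  show ?thesis unfolding C \<rho>_x \<rho>_y s1[symmetric] s2[symmetric] t1 using A B by linarith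
qed

definition cross_density :: "real \<Rightarrow> real \<times> real \<Rightarrow> real" where
  "cross_density t z = snd z ^ m1 * (t ^ wx * u1 (dil t z)) * u1 z + fst z ^ m2 * (t ^ wy * u2 (dil t z)) * u2 z"

lemma continuous_cross_density: "0 \<le> t \<Longrightarrow> t \<le> 1 \<Longrightarrow> continuous_on (closure \<Omega>) (cross_density t)"
  unfolding cross_density_def using cont by (intro continuous_intros comp_dil_continuous)

lemma continuous_reaction: "0 \<le> t \<Longrightarrow> t \<le> 1 \<Longrightarrow> continuous_on (closure \<Omega>) (\<lambda>z. u z * f (u (dil t z)))"
  using cont by (intro continuous_intros continuous_on_compose2[OF continuous_f comp_dil_continuous]) auto

text \<open>The equation for \<open>u \<circ> dil t\<close> (which is the one for \<open>u\<close> up to the factor \<open>t\<^bsup>E\<^esup>\<close>, by homogeneity) is tested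
  with \<open>u\<close>. The dilate is defined on the whole domain because \<open>t \<le> 1\<close>, and \<open>u\<close> vanishes on \<open>\<sigma>\<close> and \<open>AC\<close>.\<close>

lemma green_identity:
  assumes t: "0 < t" "t \<le> 1"
  shows "I\<Omega> (cross_density t) = t powr E * I\<Omega> (\<lambda>z. u z * f (u (dil t z))) + bdry t"
proof -
  have t0: "0 \<le> t" using t by simp
  define hX where "hX z = u z * (snd z ^ m1 * (t ^ wx * u1 (dil t z)))" for z
  define hY where "hY z = u z * (fst z ^ m2 * (t ^ wy * u2 (dil t z)))" for z
  define hX' where "hX' z = u1 z * (snd z ^ m1 * (t ^ wx * u1 (dil t z)))
    + u z * (snd z ^ m1 * (t ^ wx * (t ^ wx * u11 (dil t z))))" for z
  define hY' where "hY' z = u2 z * (fst z ^ m2 * (t ^ wy * u2 (dil t z)))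
    + u z * (fst z ^ m2 * (t ^ wy * (t ^ wy * u22 (dil t z))))" for z
  have c: "continuous_on (closure \<Omega>) hX" "continuous_on (closure \<Omega>) hY"
    "continuous_on (closure \<Omega>) hX'" "continuous_on (closure \<Omega>) hY'"
    unfolding hX_def hY_def hX'_def hY'_def using cont t0 t by (intro continuous_intros comp_dil_continuous; simp)+
  have z0: "hX z = 0" "hY z = 0" if "z \<in> \<sigma> \<union> AC" for z using bc[OF that] by (simp_all add: hX_def hY_def)
  obtain LX LY where L: "\<forall>z\<in>closure \<Omega>. \<bar>hX' z\<bar> \<le> LX" "\<forall>z\<in>closure \<Omega>. \<bar>hY' z\<bar> \<le> LY"
    using bounded_on_closure[OF c(3)] bounded_on_closure[OF c(4)] by blast
  have dX: "((\<lambda>s. hX (s, snd z)) has_real_derivative hX' z) (at (fst z))" if z: "z \<in> \<Omega>" for z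
  proof -
    have zt: "dil t z \<in> \<Omega>" using dil_in z t by simp
    have 1: "((\<lambda>s. u1 (dil t (s, snd z))) has_real_derivative u11 (dil t z) * (t ^ wx * 1)) (at (fst z))"
      using DERIV_chain2[where f = "\<lambda>r. u1 (r, t ^ wy * snd z)" and g = "\<lambda>s. t ^ wx * s" and x = "fst z",
          OF _ DERIV_cmult[OF DERIV_ident]] partial_derivatives(1)[OF du1[OF zt]]
      by (simp add: dil_def)
    show ?thesis unfolding hX_def hX'_def
      by (rule derivative_eq_intros partial_derivatives(1)[OF du[OF z]] 1 refl | simp)+
  qed
  have dY: "((\<lambda>s. hY (fst z, s)) has_real_derivative hY' z) (at (snd z))" if z: "z \<in> \<Omega>" for z
  proof -
    have zt: "dil t z \<in> \<Omega>" using dil_in z t by simp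
    have 1: "((\<lambda>s. u2 (dil t (fst z, s))) has_real_derivative u22 (dil t z) * (t ^ wy * 1)) (at (snd z))"
      using DERIV_chain2[where f = "\<lambda>r. u2 (t ^ wx * fst z, r)" and g = "\<lambda>s. t ^ wy * s" and x = "snd z",
          OF _ DERIV_cmult[OF DERIV_ident]] partial_derivatives(2)[OF du2[OF zt]]
      by (simp add: dil_def)
    show ?thesis unfolding hY_def hY'_def
      by (rule derivative_eq_intros partial_derivatives(2)[OF du[OF z]] 1 refl | simp)+
  qed
  have GX: "I\<Omega> hX' = - integral {0..1} (\<lambda>s. real wy * yC * s ^ (wy - 1) * hX (xC * s ^ wx, yC * s ^ wy))"
    by (rule green_x[OF c(1) z0(1) dX _ continuous_on_subset[OF c(3) closure_subset]])
      (use L in_closure in auto)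
  have GY: "I\<Omega> hY' = integral {0..1} (\<lambda>s. real wx * xC * s ^ (wx - 1) * hY (xC * s ^ wx, yC * s ^ wy))"
    by (rule green_y[OF c(2) z0(2) dY _ continuous_on_subset[OF c(4) closure_subset]])
      (use L in_closure in auto)
  have iX: "(\<lambda>s. real wy * yC * s ^ (wy - 1) * hX (xC * s ^ wx, yC * s ^ wy)) integrable_on {0..1}"
    by (intro integrable_continuous_real continuous_intros continuous_on_curve c)
  have iY: "(\<lambda>s. real wx * xC * s ^ (wx - 1) * hY (xC * s ^ wx, yC * s ^ wy)) integrable_on {0..1}"
    by (intro integrable_continuous_real continuous_intros continuous_on_curve c)
  have "I\<Omega> hX' + I\<Omega> hY' = integral {0..1} (\<lambda>s. real wx * xC * s ^ (wx - 1) * hY (xC * s ^ wx, yC * s ^ wy)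
      - real wy * yC * s ^ (wy - 1) * hX (xC * s ^ wx, yC * s ^ wy))"
    unfolding GX GY using Henstock_Kurzweil_Integration.integral_diff[OF iY iX] by simp
  also have "\<dots> = integral {0..1} (\<lambda>s. \<rho> * (s ^ N * (t * \<psi>' (t * s)) * \<psi> s))"
  proof (rule Henstock_Kurzweil_Integration.integral_cong)
    fix s :: real
    have d: "dil t (xC * s ^ wx, yC * s ^ wy) = (xC * (t * s) ^ wx, yC * (t * s) ^ wy)"
      by (simp add: dil_def power_mult_distrib mult_ac)
    show "real wx * xC * s ^ (wx - 1) * hY (xC * s ^ wx, yC * s ^ wy)
      - real wy * yC * s ^ (wy - 1) * hX (xC * s ^ wx, yC * s ^ wy) = \<rho> * (s ^ N * (t * \<psi>' (t * s)) * \<psi> s)"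
      unfolding hX_def hY_def d \<psi>'_def \<psi>_def fst_conv snd_conv by (rule boundary_integrand)
  qed
  also have "\<dots> = bdry t" by (simp add: bdry_def)
  finally have bdry: "I\<Omega> hX' + I\<Omega> hY' = bdry t" .
  have "I\<Omega> hX' + I\<Omega> hY' = I\<Omega> (\<lambda>z. hX' z + hY' z)" using I\<Omega>_add integrable_indicator_continuous c by simp
  also have "\<dots> = I\<Omega> (\<lambda>z. cross_density t z - t powr E * (u z * f (u (dil t z))))"
  proof (rule I\<Omega>_cong)
    fix z assume z: "z \<in> \<Omega>"
    define a b where "a = u11 (dil t z)" and "b = u22 (dil t z)"
    have "(t ^ wy * snd z) ^ m1 * a + (t ^ wx * fst z) ^ m2 * b = - f (u (dil t z))"
      using pde[OF dil_in[OF z t]] by (simp add: dil_def f_def a_def b_def)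
    then have "t powr E * ((t ^ wy) ^ m1 * snd z ^ m1 * a + (t ^ wx) ^ m2 * fst z ^ m2 * b) = - (t powr E * f (u (dil t z)))"
      by (simp add: power_mult_distrib)
    then have "(t powr E * (t ^ wy) ^ m1) * snd z ^ m1 * a + (t powr E * (t ^ wx) ^ m2) * fst z ^ m2 * b = - (t powr E * f (u (dil t z)))"
      by (simp add: algebra_simps)
    then have "u z * ((t ^ wx * t ^ wx) * snd z ^ m1 * a + (t ^ wy * t ^ wy) * fst z ^ m2 * b) = u z * - (t powr E * f (u (dil t z)))"
      unfolding E_pow[OF t(1)] by simp
    then show "hX' z + hY' z = cross_density t z - t powr E * (u z * f (u (dil t z)))"
      unfolding hX'_def hY'_def cross_density_def a_def b_def by (simp add: algebra_simps)
  qed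
  also have "\<dots> = I\<Omega> (cross_density t) - t powr E * I\<Omega> (\<lambda>z. u z * f (u (dil t z)))"
    using I\<Omega>_diff[OF integrable_indicator_continuous[OF continuous_cross_density[OF t0 t(2)]] integrable_indicator_continuous[OF continuous_on_mult_left[OF continuous_reaction[OF t0 t(2)]]], of "t powr E"]
    by (simp add: I\<Omega>_cmult)
  finally show ?thesis using bdry by simp
qed

subsection \<open>Scaling and the layer lost by a dilation\<close>

lemma dil_image: "0 < t \<Longrightarrow> dil t ` \<Omega> = dil (1 / t) -` \<Omega>"
proof (intro equalityI subsetI)
  fix z assume t: "0 < t" and "z \<in> dil (1 / t) -` \<Omega>"
  then show "z \<in> dil t ` \<Omega>" by (intro image_eqI[of _ _ "dil (1 / t) z"]) (auto simp: dil_dil)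
qed (auto simp: dil_dil)

lemma open_dil_image: "0 < t \<Longrightarrow> open (dil t ` \<Omega>)"
  unfolding dil_image by (rule open_vimage[OF open_\<Omega>]) (rule continuous_dil)

lemma layer_measurable:
  assumes "0 < t" "(\<lambda>z. indicator \<Omega> z * \<phi> z) \<in> borel_measurable borel"
  shows "(\<lambda>z. indicator \<Omega> z * (indicator (\<Omega> - dil t ` \<Omega>) z * (\<phi> z :: real))) \<in> borel_measurable borel"
proof -
  have "\<Omega> - dil t ` \<Omega> \<in> sets borel" using open_\<Omega> open_dil_image[OF assms(1)] by auto
  then have "(\<lambda>z. indicator (\<Omega> - dil t ` \<Omega>) z * (indicator \<Omega> z * \<phi> z)) \<in> borel_measurable borel"
    using assms(2) by measurable
  then show ?thesis by (simp add: mult.left_commute)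
qed

text \<open>Change of variables; the image of the domain under \<open>dil t\<close> is the domain without a layer at \<open>\<sigma>\<close> and \<open>AC\<close>.\<close>

lemma scaling:
  assumes t: "0 < t" "t \<le> 1" and meas: "(\<lambda>z. indicator \<Omega> z * \<phi> z) \<in> borel_measurable borel"
    and bd: "\<And>z. z \<in> \<Omega> \<Longrightarrow> \<bar>\<phi> z :: real\<bar> \<le> L"
  shows "t ^ w * I\<Omega> (\<lambda>z. \<phi> (dil t z)) = I\<Omega> \<phi> - I\<Omega> (\<lambda>z. indicator (\<Omega> - dil t ` \<Omega>) z * \<phi> z)"
proof -
  have sub: "dil t ` \<Omega> \<subseteq> \<Omega>" using dil_in t by blast
  define G where "G z = indicator (dil t ` \<Omega>) z * \<phi> z" for z
  have Gd: "G z = indicator \<Omega> z * \<phi> z - indicator \<Omega> z * (indicator (\<Omega> - dil t ` \<Omega>) z * \<phi> z)" for z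
    using sub by (auto simp: G_def indicator_def)
  have lm: "(\<lambda>z. indicator \<Omega> z * (indicator (\<Omega> - dil t ` \<Omega>) z * \<phi> z)) \<in> borel_measurable borel"
    by (rule layer_measurable[OF t(1) meas])
  have G[measurable]: "G \<in> borel_measurable borel"
    unfolding Gd[abs_def] using meas lm by (intro borel_measurable_diff)
  have i1: "integrable lborel (\<lambda>z. indicator \<Omega> z * \<phi> z)" by (rule integrable_indicator_bounded[OF meas bd])
  have "\<bar>indicator (\<Omega> - dil t ` \<Omega>) z * \<phi> z\<bar> \<le> \<bar>L\<bar>" if "z \<in> \<Omega>" for z
    using bd[OF that] by (auto simp: indicator_def)
  then have i2: "integrable lborel (\<lambda>z. indicator \<Omega> z * (indicator (\<Omega> - dil t ` \<Omega>) z * \<phi> z))"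
    by (rule integrable_indicator_bounded[OF lm])
  have "indicator \<Omega> z * \<phi> (dil t z) = G (t ^ wx * fst z, t ^ wy * snd z)" for z
  proof -
    have "dil t z \<in> dil t ` \<Omega> \<longleftrightarrow> z \<in> \<Omega>" unfolding dil_image[OF t(1)] using t by (simp add: dil_dil)
    then show ?thesis unfolding G_def dil_def[symmetric] by (simp add: indicator_def)
  qed
  then have "I\<Omega> (\<lambda>z. \<phi> (dil t z)) = (LINT z|lborel. G (t ^ wx * fst z, t ^ wy * snd z))"
    by (simp add: I\<Omega>_def)
  also have "\<dots> = (LINT z|lborel. G z) / (t ^ wx * t ^ wy)"
    by (rule lborel_integral_diagonal_scaling) (use t in auto)
  finally have "t ^ w * I\<Omega> (\<lambda>z. \<phi> (dil t z)) = (LINT z|lborel. G z)" using t by (simp add: power_add)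
  also have "\<dots> = I\<Omega> \<phi> - I\<Omega> (\<lambda>z. indicator (\<Omega> - dil t ` \<Omega>) z * \<phi> z)"
    unfolding Gd I\<Omega>_def using Bochner_Integration.integral_diff[OF i1 i2] by simp
  finally show ?thesis .
qed

lemma near_1: "\<forall>\<^sub>F t in at_left (1::real). 0 < t \<and> t < 1"
  by (rule eventually_at_leftI[of 0]) auto

text \<open>The energy density is nonnegative in the part of the layer with \<open>y \<ge> 0\<close>, and this replaces the sign of
  the boundary integral over \<open>\<sigma>\<close> in the Pohozaev identity. In the part with \<open>y < 0\<close> the density is small by
  \<open>Q_small_in_layer\<close>, and the area is \<open>O(1 - t)\<close>, since the half-plane is invariant under dilations.\<close>

lemma energy_in_layer:
  assumes e: "e > 0"
  shows "\<forall>\<^sub>F t in at_left 1. I\<Omega> (\<lambda>z. indicator (\<Omega> - dil t ` \<Omega>) z * Q z) \<ge> - e * (1 - t)"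
proof -
  define e' where "e' = e / (real w * (area + 1))"
  have wpos: "real w > 0" using weights by simp
  have e': "e' > 0" using e wpos area_nonneg by (simp add: e'_def)
  define H where "H = {z :: real \<times> real. snd z < 0}"
  have Hm: "H \<in> sets borel" unfolding H_def by (intro borel_open open_Collect_less continuous_intros)
  have \<Omega>m: "\<Omega> \<in> sets borel" using open_\<Omega> by simp
  have mH: "(\<lambda>z. indicator \<Omega> z * indicator H z :: real) \<in> borel_measurable borel"
    using Hm \<Omega>m by measurable
  have mQ: "(\<lambda>z. indicator \<Omega> z * Q z) \<in> borel_measurable borel"
    by (intro measurable_on_\<Omega> continuous_on_subset[OF continuous_Q closure_subset])
  obtain LQ where LQ: "\<forall>z\<in>closure \<Omega>. \<bar>Q z\<bar> \<le> LQ" using bounded_on_closure[OF continuous_Q] by blast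
  show ?thesis using Q_small_in_layer[OF e'] near_1
  proof eventually_elim
    case (elim t)
    let ?L = "\<Omega> - dil t ` \<Omega>"
    have t: "0 < t" "t \<le> 1" using elim by auto
    have low: "- e' * (indicator ?L z * indicator H z) \<le> indicator ?L z * Q z" if z: "z \<in> \<Omega>" for z
    proof (cases "z \<in> ?L")
      case True
      show ?thesis
      proof (cases "snd z < 0")
        case neg: True
        then have "\<bar>Q z\<bar> \<le> e'" using elim True by blast
        then show ?thesis using True neg by (simp add: H_def)
      next
        case False
        have "fst z ^ m2 \<ge> 0" using m2_even by (simp add: zero_le_even_power)
        then have "Q z \<ge> 0" unfolding Q_def using False by (intro add_nonneg_nonneg mult_nonneg_nonneg) auto
        then show ?thesis using True False by (simp add: H_def)
      qed
    qed simp
    have lm: "(\<lambda>z. indicator \<Omega> z * (indicator ?L z * indicator H z :: real)) \<in> borel_measurable borel"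
      by (rule layer_measurable[OF t(1) mH])
    have "I\<Omega> (\<lambda>z. - e' * (indicator ?L z * indicator H z)) \<le> I\<Omega> (\<lambda>z. indicator ?L z * Q z)"
    proof (rule I\<Omega>_mono[OF _ _ low])
      have "(\<lambda>z. - e' * (indicator \<Omega> z * (indicator ?L z * indicator H z :: real))) \<in> borel_measurable borel"
        by (rule borel_measurable_times[OF borel_measurable_const lm])
      then have "(\<lambda>z. indicator \<Omega> z * (- e' * (indicator ?L z * indicator H z))) \<in> borel_measurable borel"
        by (simp add: mult.left_commute)
      then show "integrable lborel (\<lambda>z. indicator \<Omega> z * (- e' * (indicator ?L z * indicator H z)))"
        by (rule integrable_indicator_bounded[where L = e']) (use e' in \<open>auto simp: indicator_def\<close>)
      have "\<bar>indicator ?L z * Q z\<bar> \<le> \<bar>LQ\<bar>" if "z \<in> \<Omega>" for z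
        using LQ in_closure[OF that] by (fastforce simp: indicator_def)
      then show "integrable lborel (\<lambda>z. indicator \<Omega> z * (indicator ?L z * Q z))"
        by (rule integrable_indicator_bounded[OF layer_measurable[OF t(1) mQ]])
    qed
    moreover have "I\<Omega> (\<lambda>z. - e' * (indicator ?L z * indicator H z)) = - e' * I\<Omega> (\<lambda>z. indicator ?L z * indicator H z)"
      by (rule I\<Omega>_cmult)
    moreover have Xle: "I\<Omega> (\<lambda>z. indicator ?L z * indicator H z) \<le> real w * (1 - t) * area"
    proof -
      have "indicator H (dil t z) = (indicator H z :: real)" for z
        using t by (simp add: H_def dil_def indicator_def mult_less_0_iff)
      then have inv: "(\<lambda>z. indicator H (dil t z) :: real) = indicator H" by (simp add: fun_eq_iff)
      have "t ^ w * I\<Omega> (\<lambda>z. indicator H (dil t z)) = I\<Omega> (indicator H) - I\<Omega> (\<lambda>z. indicator ?L z * indicator H z)"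
        by (rule scaling[OF t mH, of 1]) simp
      then have "t ^ w * I\<Omega> (indicator H) = I\<Omega> (indicator H) - I\<Omega> (\<lambda>z. indicator ?L z * indicator H z)"
        unfolding inv .
      then have "I\<Omega> (\<lambda>z. indicator ?L z * indicator H z) = (1 - t ^ w) * I\<Omega> (indicator H)"
        by (simp add: algebra_simps)
      also have "\<dots> \<le> (real w * (1 - t)) * area"
      proof (rule mult_mono)
        show "1 - t ^ w \<le> real w * (1 - t)" using one_minus_power_le[of t w] t by simp
        have "I\<Omega> (indicator H) \<le> I\<Omega> (\<lambda>_. 1)"
          by (rule I\<Omega>_mono[OF integrable_indicator_bounded[OF mH, of 1] integrable_indicator_continuous]) (auto simp: indicator_def)
        then show "I\<Omega> (indicator H) \<le> area" by (simp add: area_def)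
        show "0 \<le> I\<Omega> (indicator H)" unfolding I\<Omega>_def by (intro integral_nonneg_AE) auto
        show "0 \<le> real w * (1 - t)" using t by simp
      qed
      finally show ?thesis .
    qed
    moreover have "e' * (real w * (1 - t) * area) \<le> e * (1 - t)"
    proof -
      have "e' * (real w * (1 - t) * area) = (e * (1 - t)) * (area / (area + 1))"
      proof -
        have "e / (W * M) * (W * r * m) = (e * r) * (m / M)" if "W > 0" for W M r m using that by simp
        from this[OF wpos] show ?thesis unfolding e'_def .
      qed
      also have "\<dots> \<le> (e * (1 - t)) * 1"
        using e t area_nonneg by (intro mult_left_mono) (auto simp: divide_le_eq)
      finally show ?thesis by simp
    qed
    ultimately show ?case using mult_left_mono[OF Xle less_imp_le[OF e']] by linarith
  qed
qed

lemma continuous_Fu: "continuous_on (closure \<Omega>) (\<lambda>z. F (u z))"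
  using continuous_on_compose2[OF continuous_F[of UNIV] cont(1)] by simp

text \<open>By \<open>small_in_layer\<close> the integrand is \<open>O((1 - t)\<^bsup>\<alpha> + 1\<^esup>)\<close>, and the area of the layer is at most \<open>area\<close>.\<close>

lemma potential_in_layer:
  assumes e: "e > 0"
  shows "\<forall>\<^sub>F t in at_left 1. I\<Omega> (\<lambda>z. indicator (\<Omega> - dil t ` \<Omega>) z * F (u z)) \<le> e * (1 - t)"
proof -
  define c where "c = lip powr (\<alpha> + 1) / (\<alpha> + 1) * area"
  have "continuous_on {0..1} (\<lambda>t. c * (1 - t) powr \<alpha>)"
    using \<alpha> by (intro continuous_intros continuous_on_powr') auto
  then have "((\<lambda>t. c * (1 - t) powr \<alpha>) \<longlongrightarrow> c * (1 - 1) powr \<alpha>) (at_left 1)"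
    by (rule continuous_on_Icc_at_leftD) simp
  then have "\<forall>\<^sub>F t in at_left 1. c * (1 - t) powr \<alpha> < e" using e by (intro order_tendstoD) auto
  then show ?thesis using near_1
  proof eventually_elim
    case (elim t)
    let ?L = "\<Omega> - dil t ` \<Omega>"
    have t: "0 < t" "t \<le> 1" using elim by auto
    define b where "b = (lip * (1 - t)) powr (\<alpha> + 1) / (\<alpha> + 1)"
    have b0: "b \<ge> 0" using \<alpha> by (simp add: b_def)
    have up: "indicator ?L z * F (u z) \<le> b" if z: "z \<in> \<Omega>" for z
    proof (cases "z \<in> ?L")
      case True
      then have "\<bar>u z\<bar> \<le> lip * (1 - t)" using small_in_layer[of z t] t by auto
      then have "F (u z) \<le> b" unfolding F_def b_def using \<alpha> by (intro divide_right_mono powr_mono2) auto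
      then show ?thesis using True by simp
    qed (use b0 in simp)
    have m: "(\<lambda>z. indicator \<Omega> z * F (u z)) \<in> borel_measurable borel"
      by (intro measurable_on_\<Omega> continuous_on_subset[OF continuous_Fu closure_subset])
    have "\<bar>indicator ?L z * F (u z)\<bar> \<le> b" if "z \<in> \<Omega>" for z
      using up[OF that] F_nonneg[of "u z"] by (simp add: abs_mult)
    then have i: "integrable lborel (\<lambda>z. indicator \<Omega> z * (indicator ?L z * F (u z)))"
      by (rule integrable_indicator_bounded[OF layer_measurable[OF t(1) m]])
    have "I\<Omega> (\<lambda>z. indicator ?L z * F (u z)) \<le> I\<Omega> (\<lambda>_. b)"
      by (rule I\<Omega>_mono[OF i integrable_indicator_continuous up]) auto
    also have "\<dots> = (c * (1 - t) powr \<alpha>) * (1 - t)"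
      unfolding I\<Omega>_const b_def c_def using t lip_nonneg \<alpha> by (simp add: powr_mult powr_add)
    also have "\<dots> \<le> e * (1 - t)" using elim by (intro mult_right_mono) auto
    finally show ?case .
  qed
qed

definition potential :: real where "potential = I\<Omega> (\<lambda>z. F (u z))"

lemma potential_scaling:
  assumes t: "0 < t" "t \<le> 1"
  shows "t ^ w * I\<Omega> (\<lambda>z. F (u (dil t z))) = potential - I\<Omega> (\<lambda>z. indicator (\<Omega> - dil t ` \<Omega>) z * F (u z))"
proof -
  obtain L where L: "\<forall>z\<in>closure \<Omega>. \<bar>F (u z)\<bar> \<le> L" using bounded_on_closure[OF continuous_Fu] by blast
  have m: "(\<lambda>z. indicator \<Omega> z * F (u z)) \<in> borel_measurable borel"
    by (intro measurable_on_\<Omega> continuous_on_subset[OF continuous_Fu closure_subset])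
  show ?thesis unfolding potential_def by (rule scaling[OF t m, where L = L]) (use L in_closure in auto)
qed

lemma energy_scaling:
  assumes t: "0 < t" "t \<le> 1"
  shows "I\<Omega> (\<lambda>z. snd z ^ m1 * (t ^ wx * u1 (dil t z))\<^sup>2 + fst z ^ m2 * (t ^ wy * u2 (dil t z))\<^sup>2)
    = t powr - real N * (I\<Omega> Q - I\<Omega> (\<lambda>z. indicator (\<Omega> - dil t ` \<Omega>) z * Q z))"
proof -
  obtain L where L: "\<forall>z\<in>closure \<Omega>. \<bar>Q z\<bar> \<le> L" using bounded_on_closure[OF continuous_Q] by blast
  have m: "(\<lambda>z. indicator \<Omega> z * Q z) \<in> borel_measurable borel"
    by (intro measurable_on_\<Omega> continuous_on_subset[OF continuous_Q closure_subset])
  have "snd z ^ m1 * (t ^ wx * u1 (dil t z))\<^sup>2 + fst z ^ m2 * (t ^ wy * u2 (dil t z))\<^sup>2 = t powr E * Q (dil t z)" for z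
  proof -
    have "t powr E * Q (dil t z) = (t powr E * (t ^ wy) ^ m1) * (snd z ^ m1 * (u1 (dil t z))\<^sup>2)
        + (t powr E * (t ^ wx) ^ m2) * (fst z ^ m2 * (u2 (dil t z))\<^sup>2)"
      by (simp add: Q_def dil_def power_mult_distrib algebra_simps)
    also have "\<dots> = snd z ^ m1 * (t ^ wx * u1 (dil t z))\<^sup>2 + fst z ^ m2 * (t ^ wy * u2 (dil t z))\<^sup>2"
      unfolding E_pow[OF t(1)] power2_eq_square by (simp only: mult_ac)
    finally show ?thesis by simp
  qed
  then have "I\<Omega> (\<lambda>z. snd z ^ m1 * (t ^ wx * u1 (dil t z))\<^sup>2 + fst z ^ m2 * (t ^ wy * u2 (dil t z))\<^sup>2)
      = t powr E * I\<Omega> (\<lambda>z. Q (dil t z))" by (simp add: I\<Omega>_cmult)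
  moreover have "t powr E = t powr - real N * t ^ w"
    using t unfolding E_eq by (simp only: powr_realpow[symmetric] powr_add[symmetric]) simp
  moreover have "t ^ w * I\<Omega> (\<lambda>z. Q (dil t z)) = I\<Omega> Q - I\<Omega> (\<lambda>z. indicator (\<Omega> - dil t ` \<Omega>) z * Q z)"
    by (rule scaling[OF t m, where L = L]) (use L in_closure in auto)
  ultimately show ?thesis by (simp only: mult.assoc)
qed

text \<open>The expression estimated from below is the energy of the difference \<open>u \<circ> dil t - u\<close>, whose gradient is \<open>O(1 - t)\<close>.\<close>

lemma difference_energy:
  shows "\<exists>C. \<forall>t. 0 < t \<and> t \<le> 1 \<longrightarrow>
    I\<Omega> (\<lambda>z. snd z ^ m1 * (t ^ wx * u1 (dil t z))\<^sup>2 + fst z ^ m2 * (t ^ wy * u2 (dil t z))\<^sup>2)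
      - 2 * I\<Omega> (cross_density t) + I\<Omega> Q \<ge> - C * (1 - t)\<^sup>2"
proof -
  define C1 where "C1 = lip + real w * sup_bound"
  define C where "C = (sup_bound ^ m1 + sup_bound ^ m2) * C1\<^sup>2 * area"
  have Bd0: "sup_bound \<ge> 0" using sup_bound(1) by simp
  have main: "I\<Omega> (\<lambda>z. snd z ^ m1 * (t ^ wx * u1 (dil t z))\<^sup>2 + fst z ^ m2 * (t ^ wy * u2 (dil t z))\<^sup>2)
      - 2 * I\<Omega> (cross_density t) + I\<Omega> Q \<ge> - C * (1 - t)\<^sup>2" if t: "0 < t" "t \<le> 1" for t
  proof -
    have t0: "0 \<le> t" using t by simp
    define v1 where "v1 z = t ^ wx * u1 (dil t z)" for z
    define v2 where "v2 z = t ^ wy * u2 (dil t z)" for z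
    have vc: "continuous_on (closure \<Omega>) v1" "continuous_on (closure \<Omega>) v2"
      unfolding v1_def v2_def using cont t0 t by (intro continuous_intros comp_dil_continuous; simp)+
    have c1: "continuous_on (closure \<Omega>) (\<lambda>z. snd z ^ m1 * (v1 z)\<^sup>2 + fst z ^ m2 * (v2 z)\<^sup>2)"
      by (intro continuous_intros vc)
    have c3: "continuous_on (closure \<Omega>) (\<lambda>z. 2 * cross_density t z)"
      using continuous_cross_density[OF t0 t(2)] by (intro continuous_intros)
    have c4: "continuous_on (closure \<Omega>) (\<lambda>z. snd z ^ m1 * (v1 z)\<^sup>2 + fst z ^ m2 * (v2 z)\<^sup>2 - 2 * cross_density t z)"
      by (intro continuous_on_diff c1 c3)
    have c5: "continuous_on (closure \<Omega>) (\<lambda>z. snd z ^ m1 * (v1 z)\<^sup>2 + fst z ^ m2 * (v2 z)\<^sup>2 - 2 * cross_density t z + Q z)"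
      by (intro continuous_on_add c4 continuous_Q)
    have "I\<Omega> (\<lambda>z. snd z ^ m1 * (v1 z)\<^sup>2 + fst z ^ m2 * (v2 z)\<^sup>2) - 2 * I\<Omega> (cross_density t) + I\<Omega> Q
        = I\<Omega> (\<lambda>z. snd z ^ m1 * (v1 z)\<^sup>2 + fst z ^ m2 * (v2 z)\<^sup>2 - 2 * cross_density t z + Q z)"
      unfolding I\<Omega>_add[OF integrable_indicator_continuous[OF c4] integrable_indicator_continuous[OF continuous_Q]] I\<Omega>_diff[OF integrable_indicator_continuous[OF c1] integrable_indicator_continuous[OF c3]] I\<Omega>_cmult
      by simp
    moreover have "I\<Omega> (\<lambda>z. - ((sup_bound ^ m1 + sup_bound ^ m2) * (C1 * (1 - t))\<^sup>2))
        \<le> I\<Omega> (\<lambda>z. snd z ^ m1 * (v1 z)\<^sup>2 + fst z ^ m2 * (v2 z)\<^sup>2 - 2 * cross_density t z + Q z)"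
    proof (rule I\<Omega>_mono[OF integrable_indicator_continuous integrable_indicator_continuous[OF c5]])
      fix z assume z: "z \<in> \<Omega>"
      have zc: "z \<in> closure \<Omega>" "dil t z \<in> closure \<Omega>" using in_closure z dil_in t by auto
      have close: "\<bar>t ^ n * a - b\<bar> \<le> C1 * (1 - t)" if ab: "\<bar>a - b\<bar> \<le> lip * (1 - t)" "\<bar>a\<bar> \<le> sup_bound" and n: "n \<le> w" for a b n
      proof -
        have "1 - t ^ n \<le> real n * (1 - t)" using one_minus_power_le[of t n] t by simp
        also have "\<dots> \<le> real w * (1 - t)" using n t by (intro mult_right_mono) auto
        finally have "(1 - t ^ n) * \<bar>a\<bar> \<le> (real w * (1 - t)) * sup_bound"
          using ab t by (intro mult_mono) auto
        moreover have "\<bar>(1 - t ^ n) * a\<bar> = (1 - t ^ n) * \<bar>a\<bar>"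
          using t power_le_one[of t n] by (simp add: abs_mult)
        moreover have "t ^ n * a - b = (a - b) - (1 - t ^ n) * a" by (simp add: algebra_simps)
        moreover have "C1 * (1 - t) = lip * (1 - t) + (real w * (1 - t)) * sup_bound" by (simp add: C1_def algebra_simps)
        ultimately show ?thesis using ab(1) by linarith
      qed
      have d1: "\<bar>v1 z - u1 z\<bar> \<le> C1 * (1 - t)"
        unfolding v1_def by (rule close[OF increments(2)[OF z t] sup_bounds(4)[OF zc(2)]]) simp
      have d2: "\<bar>v2 z - u2 z\<bar> \<le> C1 * (1 - t)"
        unfolding v2_def by (rule close[OF increments(3)[OF z t] sup_bounds(5)[OF zc(2)]]) simp
      have term_le: "\<bar>c ^ k * d\<^sup>2\<bar> \<le> sup_bound ^ k * (C1 * (1 - t))\<^sup>2" if "\<bar>c\<bar> \<le> sup_bound" "\<bar>d\<bar> \<le> C1 * (1 - t)" for c d k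
      proof -
        have "\<bar>c\<bar> ^ k \<le> sup_bound ^ k" by (rule power_mono[OF that(1)]) simp
        moreover have "\<bar>d\<bar>\<^sup>2 \<le> (C1 * (1 - t))\<^sup>2" by (rule power_mono[OF that(2)]) simp
        ultimately show ?thesis unfolding abs_mult power_abs using Bd0 by (intro mult_mono) auto
      qed
      have "snd z ^ m1 * (v1 z)\<^sup>2 + fst z ^ m2 * (v2 z)\<^sup>2 - 2 * cross_density t z + Q z
          = snd z ^ m1 * (v1 z - u1 z)\<^sup>2 + fst z ^ m2 * (v2 z - u2 z)\<^sup>2"
        unfolding cross_density_def Q_def v1_def[symmetric] v2_def[symmetric] by (simp add: power2_eq_square algebra_simps)
      moreover have "\<bar>snd z ^ m1 * (v1 z - u1 z)\<^sup>2\<bar> \<le> sup_bound ^ m1 * (C1 * (1 - t))\<^sup>2"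
        by (rule term_le[OF sup_bounds(2)[OF zc(1)] d1])
      moreover have "\<bar>fst z ^ m2 * (v2 z - u2 z)\<^sup>2\<bar> \<le> sup_bound ^ m2 * (C1 * (1 - t))\<^sup>2"
        by (rule term_le[OF sup_bounds(1)[OF zc(1)] d2])
      moreover have "(sup_bound ^ m1 + sup_bound ^ m2) * (C1 * (1 - t))\<^sup>2 = sup_bound ^ m1 * (C1 * (1 - t))\<^sup>2 + sup_bound ^ m2 * (C1 * (1 - t))\<^sup>2"
        by (rule distrib_right)
      ultimately show "- ((sup_bound ^ m1 + sup_bound ^ m2) * (C1 * (1 - t))\<^sup>2)
          \<le> snd z ^ m1 * (v1 z)\<^sup>2 + fst z ^ m2 * (v2 z)\<^sup>2 - 2 * cross_density t z + Q z" by linarith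
    qed (intro continuous_intros)
    moreover have "I\<Omega> (\<lambda>z. - ((sup_bound ^ m1 + sup_bound ^ m2) * (C1 * (1 - t))\<^sup>2)) = - C * (1 - t)\<^sup>2"
      unfolding I\<Omega>_const by (simp add: C_def power_mult_distrib mult_ac)
    ultimately show ?thesis unfolding v1_def v2_def by linarith
  qed
  then show ?thesis by blast
qed

text \<open>\<open>tangent_bound\<close> with \<open>p = u z\<close> and \<open>q = u (dil t z)\<close>, which differ by \<open>O(1 - t)\<close>.\<close>

lemma nonlinear_term:
  assumes e: "e > 0"
  shows "\<forall>\<^sub>F t in at_left 1. I\<Omega> (\<lambda>z. u z * f (u (dil t z))) \<ge> potential + \<alpha> * I\<Omega> (\<lambda>z. F (u (dil t z))) - e * (1 - t)"
proof -
  define e' where "e' = e / ((lip + 1) * (area + 1))"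
  have e': "e' > 0" using e lip_nonneg area_nonneg by (simp add: e'_def)
  obtain d where d: "d > 0" "\<And>p q. \<bar>p\<bar> \<le> sup_bound \<Longrightarrow> \<bar>q\<bar> \<le> sup_bound \<Longrightarrow> \<bar>p - q\<bar> < d \<Longrightarrow> p * f q \<ge> F p + \<alpha> * F q - e' * \<bar>p - q\<bar>"
    using tangent_bound[OF e'] by blast
  have "((\<lambda>t. lip * (1 - t)) \<longlongrightarrow> lip * (1 - 1)) (at_left 1)" by (intro tendsto_intros)
  then have "\<forall>\<^sub>F t in at_left 1. lip * (1 - t) < d" using d by (auto dest: order_tendstoD)
  then show ?thesis using near_1
  proof eventually_elim
    case (elim t)
    then have t: "0 < t" "t \<le> 1" "0 \<le> t" by auto
    have cF: "continuous_on (closure \<Omega>) (\<lambda>z. F (u (dil t z)))"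
      using continuous_on_compose2[OF continuous_F[of UNIV] comp_dil_continuous[OF cont(1) t(3,2)]] by simp
    have c1: "continuous_on (closure \<Omega>) (\<lambda>z. \<alpha> * F (u (dil t z)))" by (intro continuous_intros cF)
    have c2: "continuous_on (closure \<Omega>) (\<lambda>z. F (u z) + \<alpha> * F (u (dil t z)))" by (intro continuous_on_add continuous_Fu c1)
    have c3: "continuous_on (closure \<Omega>) (\<lambda>z. e' * (lip * (1 - t)))" by (intro continuous_intros)
    have "I\<Omega> (\<lambda>z. F (u z) + \<alpha> * F (u (dil t z)) - e' * (lip * (1 - t))) \<le> I\<Omega> (\<lambda>z. u z * f (u (dil t z)))"
    proof (rule I\<Omega>_mono[OF integrable_indicator_continuous[OF continuous_on_diff[OF c2 c3]] integrable_indicator_continuous[OF continuous_reaction[OF t(3,2)]]])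
      fix z assume z: "z \<in> \<Omega>"
      have zc: "z \<in> closure \<Omega>" "dil t z \<in> closure \<Omega>" using in_closure z dil_in t by auto
      have i: "\<bar>u z - u (dil t z)\<bar> \<le> lip * (1 - t)" using increments(1)[OF z t(1,2)] by (simp add: abs_minus_commute)
      then have "F (u z) + \<alpha> * F (u (dil t z)) - e' * \<bar>u z - u (dil t z)\<bar> \<le> u z * f (u (dil t z))"
        using elim by (intro d(2) sup_bounds(3) zc) auto
      moreover have "e' * \<bar>u z - u (dil t z)\<bar> \<le> e' * (lip * (1 - t))" using i e' by (intro mult_left_mono) auto
      ultimately show "F (u z) + \<alpha> * F (u (dil t z)) - e' * (lip * (1 - t)) \<le> u z * f (u (dil t z))" by linarith
    qed
    moreover have "I\<Omega> (\<lambda>z. F (u z) + \<alpha> * F (u (dil t z)) - e' * (lip * (1 - t)))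
        = potential + \<alpha> * I\<Omega> (\<lambda>z. F (u (dil t z))) - e' * (lip * (1 - t)) * area"
      unfolding potential_def I\<Omega>_diff[OF integrable_indicator_continuous[OF c2] integrable_indicator_continuous[OF c3]] I\<Omega>_add[OF integrable_indicator_continuous[OF continuous_Fu] integrable_indicator_continuous[OF c1]]
        I\<Omega>_cmult I\<Omega>_const by simp
    moreover have "e' * (lip * (1 - t)) * area \<le> e * (1 - t)"
    proof -
      have "e' * (lip * (1 - t)) * area = (e * (1 - t)) * ((lip / (lip + 1)) * (area / (area + 1)))"
        by (simp add: e'_def)
      also have "\<dots> \<le> (e * (1 - t)) * (1 * 1)"
        using e t lip_nonneg area_nonneg by (intro mult_left_mono mult_mono) (auto simp: divide_le_eq)
      finally show ?thesis by simp
    qed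
    ultimately show ?case by linarith
  qed
qed

subsection \<open>First variation of the boundary term\<close>

definition bdry_square :: real where "bdry_square = \<rho> * integral {0..1} (\<lambda>s. s ^ (N + 1) * (\<psi>' s)\<^sup>2)"

lemma \<psi>_dil_continuous:
  assumes "0 < t" "t \<le> 1"
  shows "continuous_on {0..1} (\<lambda>s. \<psi> (t * s))" "continuous_on {0..1} (\<lambda>s. \<psi>' (t * s))"
proof -
  have im: "(\<lambda>s. t * s) ` {0..1} \<subseteq> {0..1}"
    using assms by (auto simp: mult_le_one)
  show "continuous_on {0..1} (\<lambda>s. \<psi> (t * s))"
    by (rule continuous_on_compose2[OF continuous_\<psi> _ im]) (intro continuous_intros)
  show "continuous_on {0..1} (\<lambda>s. \<psi>' (t * s))"
    by (rule continuous_on_compose2[OF continuous_\<psi>' _ im]) (intro continuous_intros)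
qed

text \<open>The derivative of \<open>s \<mapsto> s\<^bsup>N\<^esup> \<psi> s\<close>.\<close>

definition weighted_\<psi>' :: "real \<Rightarrow> real" where "weighted_\<psi>' s = real N * s ^ (N - 1) * \<psi> s + s ^ N * \<psi>' s"

lemma continuous_weighted_\<psi>': "continuous_on {0..1} weighted_\<psi>'"
  unfolding weighted_\<psi>'_def by (intro continuous_intros continuous_\<psi> continuous_\<psi>')

text \<open>After this step no derivative falls on the dilated factor, so that \<open>\<psi>\<close> need be differentiable only once to
  expand in \<open>1 - t\<close>. The boundary terms vanish because of \<open>\<psi> 1 = u C = 0\<close> and \<open>N \<ge> 1\<close>.\<close>

lemma bdry_by_parts:
  assumes t: "0 < t" "t \<le> 1"
  shows "bdry t = - \<rho> * integral {0..1} (\<lambda>s. \<psi> (t * s) * weighted_\<psi>' s)"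
proof -
  note tc = \<psi>_dil_continuous[OF t]
  have i1: "(\<lambda>s. s ^ N * (t * \<psi>' (t * s)) * \<psi> s) integrable_on {0..1}"
    by (intro integrable_continuous_real continuous_intros tc continuous_\<psi>)
  have i2: "(\<lambda>s. \<psi> (t * s) * weighted_\<psi>' s) integrable_on {0..1}"
    by (intro integrable_continuous_real continuous_intros tc continuous_weighted_\<psi>')
  have "((\<lambda>s. s ^ N * (t * \<psi>' (t * s)) * \<psi> s + \<psi> (t * s) * weighted_\<psi>' s) has_integral
      (1 ^ N * \<psi> (t * 1) * \<psi> 1 - 0 ^ N * \<psi> (t * 0) * \<psi> 0)) {0..1}"
  proof (rule fundamental_theorem_of_calculus_interior)
    show "continuous_on {0..1} (\<lambda>s. s ^ N * \<psi> (t * s) * \<psi> s)"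
      by (intro continuous_intros tc continuous_\<psi>)
    fix s :: real assume s: "s \<in> {0<..<1}"
    have "t * s \<le> 1 * s" using s t by (intro mult_right_mono) auto
    moreover have "s < 1" "0 < s" using s by auto
    ultimately have ts: "0 < t * s" "t * s < 1" using t by (simp, linarith)
    have d: "((\<lambda>s. \<psi> (t * s)) has_real_derivative \<psi>' (t * s) * (t * 1)) (at s)"
      by (rule DERIV_chain2[OF \<psi>_derivative[OF ts] DERIV_cmult[OF DERIV_ident]])
    have "((\<lambda>s. s ^ N * \<psi> (t * s) * \<psi> s) has_real_derivative
        ((real N * s ^ (N - 1)) * \<psi> (t * s) + s ^ N * (\<psi>' (t * s) * (t * 1))) * \<psi> s + (s ^ N * \<psi> (t * s)) * \<psi>' s) (at s)"
      using s by (auto intro!: derivative_eq_intros d \<psi>_derivative)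
    moreover have "((real N * s ^ (N - 1)) * \<psi> (t * s) + s ^ N * (\<psi>' (t * s) * (t * 1))) * \<psi> s + (s ^ N * \<psi> (t * s)) * \<psi>' s
        = s ^ N * (t * \<psi>' (t * s)) * \<psi> s + \<psi> (t * s) * weighted_\<psi>' s"
      by (simp add: weighted_\<psi>'_def algebra_simps)
    ultimately show "((\<lambda>s. s ^ N * \<psi> (t * s) * \<psi> s) has_vector_derivative
        s ^ N * (t * \<psi>' (t * s)) * \<psi> s + \<psi> (t * s) * weighted_\<psi>' s) (at s)"
      by (simp add: has_real_derivative_iff_has_vector_derivative)
  qed simp
  then have "integral {0..1} (\<lambda>s. s ^ N * (t * \<psi>' (t * s)) * \<psi> s + \<psi> (t * s) * weighted_\<psi>' s) = 0"
    using N_ge_1 \<psi>_1 by (simp add: integral_unique zero_power)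
  then have "integral {0..1} (\<lambda>s. s ^ N * (t * \<psi>' (t * s)) * \<psi> s) = - integral {0..1} (\<lambda>s. \<psi> (t * s) * weighted_\<psi>' s)"
    using Henstock_Kurzweil_Integration.integral_add[OF i1 i2] by simp
  then show ?thesis by (simp add: bdry_def)
qed

lemma bdry_expansion:
  assumes e: "e > 0"
  shows "\<forall>\<^sub>F t in at_left 1. bdry t \<ge> bdry 1 + (1 - t) * (bdry_square + real N * bdry 1) - e * (1 - t)"
proof -
  obtain k where k: "\<And>s. s \<in> {0..1} \<Longrightarrow> \<bar>weighted_\<psi>' s\<bar> \<le> k" "k \<ge> 0"
  proof -
    have "bounded (weighted_\<psi>' ` {0..1})" using continuous_weighted_\<psi>' by (intro compact_imp_bounded compact_continuous_image) auto
    then obtain k where "k > 0" "\<forall>x\<in>weighted_\<psi>' ` {0..1}. norm x \<le> k" unfolding bounded_pos by blast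
    then show ?thesis using that[of k] by auto
  qed
  define e' where "e' = e / (\<rho> * (k + 1))"
  have e': "e' > 0" using e \<rho>_pos k by (simp add: e'_def)
  have "uniformly_continuous_on {0..1} \<psi>'" by (intro compact_uniformly_continuous continuous_\<psi>') simp
  then obtain d where d: "d > 0" "\<And>x y. x \<in> {0..1} \<Longrightarrow> y \<in> {0..1} \<Longrightarrow> \<bar>y - x\<bar> < d \<Longrightarrow> \<bar>\<psi>' y - \<psi>' x\<bar> < e'"
    using e' unfolding uniformly_continuous_on_def dist_real_def by metis
  have "((\<lambda>t. 1 - t) \<longlongrightarrow> 1 - 1) (at_left (1::real))" by (intro tendsto_intros)
  then have "\<forall>\<^sub>F t in at_left (1::real). 1 - t < d" using d by (auto dest: order_tendstoD)
  then show ?thesis using near_1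
  proof eventually_elim
    case (elim t)
    then have t: "0 < t" "t \<le> 1" "t < 1" by auto
    note tc = \<psi>_dil_continuous[OF t(1,2)]
    \<comment> \<open>mean value theorem on the interval from \<open>t s\<close> to \<open>s\<close>, whose length is at most \<open>1 - t\<close>\<close>
    have approx: "\<bar>\<psi> (t * s) - \<psi> s + (1 - t) * (s * \<psi>' s)\<bar> \<le> (1 - t) * e'" if s: "s \<in> {0..1}" for s
    proof (cases "s = 0")
      case True
      then show ?thesis using t e' by simp
    next
      case False
      then have s0: "0 < s" "s \<le> 1" using s by auto
      have ts: "t * s < s" "0 < t * s" using t s0 by auto
      have "continuous_on {t * s..s} \<psi>" by (rule continuous_on_subset[OF continuous_\<psi>]) (use ts s0 in auto)
      then obtain r where r: "t * s < r" "r < s" "\<psi> s - \<psi> (t * s) = (s - t * s) * \<psi>' r"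
        using real_mvt[OF ts(1), of \<psi> \<psi>'] \<psi>_derivative ts s0 by force
      have "\<bar>s - r\<bar> < d"
      proof -
        have "(1 - t) * s \<le> (1 - t) * 1" using t s0 by (intro mult_left_mono) auto
        then show ?thesis using r elim by (simp add: algebra_simps)
      qed
      then have "\<bar>\<psi>' s - \<psi>' r\<bar> \<le> e'" using d(2)[of r s] r ts s0 by force
      then have "(1 - t) * (s * \<bar>\<psi>' s - \<psi>' r\<bar>) \<le> (1 - t) * (1 * e')"
        using t s0 by (intro mult_left_mono mult_mono) auto
      moreover have "\<psi> (t * s) - \<psi> s + (1 - t) * (s * \<psi>' s) = (1 - t) * (s * (\<psi>' s - \<psi>' r))"
        using r(3) by (simp add: algebra_simps)
      ultimately show ?thesis using t s0 by (simp add: abs_mult)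
    qed
    have i0: "(\<lambda>s. \<psi> (t * s) * weighted_\<psi>' s) integrable_on {0..1}"
      by (intro integrable_continuous_real continuous_intros tc continuous_weighted_\<psi>')
    have i1: "(\<lambda>s. \<psi> s * weighted_\<psi>' s) integrable_on {0..1}"
      by (intro integrable_continuous_real continuous_intros continuous_\<psi> continuous_weighted_\<psi>')
    have i2: "(\<lambda>s. (1 - t) * (s * \<psi>' s * weighted_\<psi>' s)) integrable_on {0..1}"
      by (intro integrable_continuous_real continuous_intros continuous_\<psi>' continuous_weighted_\<psi>')
    have i3: "(\<lambda>s. s ^ N * \<psi>' s * \<psi> s) integrable_on {0..1}" "(\<lambda>s. s ^ (N + 1) * (\<psi>' s)\<^sup>2) integrable_on {0..1}"
      by (intro integrable_continuous_real continuous_intros continuous_\<psi>' continuous_\<psi>)+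
    have "integral {0..1} (\<lambda>s. s * \<psi>' s * weighted_\<psi>' s) = integral {0..1} (\<lambda>s. real N * (s ^ N * \<psi>' s * \<psi> s) + s ^ (N + 1) * (\<psi>' s)\<^sup>2)"
    proof (rule Henstock_Kurzweil_Integration.integral_cong)
      fix s :: real
      have shift: "s * s ^ (N - 1) = s ^ N" using N_ge_1 by (simp add: power_eq_if)
      then have "s * \<psi>' s * weighted_\<psi>' s = real N * ((s * s ^ (N - 1)) * \<psi>' s * \<psi> s) + s * s ^ N * (\<psi>' s)\<^sup>2"
        by (simp add: weighted_\<psi>'_def power2_eq_square algebra_simps)
      then show "s * \<psi>' s * weighted_\<psi>' s = real N * (s ^ N * \<psi>' s * \<psi> s) + s ^ (N + 1) * (\<psi>' s)\<^sup>2"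
        using shift by simp
    qed
    also have "\<dots> = real N * integral {0..1} (\<lambda>s. s ^ N * \<psi>' s * \<psi> s) + integral {0..1} (\<lambda>s. s ^ (N + 1) * (\<psi>' s)\<^sup>2)"
      using Henstock_Kurzweil_Integration.integral_add[OF integrable_on_cmult_left[OF i3(1), of "real N"] i3(2)] by simp
    finally have PB: "\<rho> * integral {0..1} (\<lambda>s. s * \<psi>' s * weighted_\<psi>' s) = bdry_square + real N * bdry 1"
      by (simp add: bdry_square_def bdry_def algebra_simps)
    have "integral {0..1} (\<lambda>s. \<psi> (t * s) * weighted_\<psi>' s - \<psi> s * weighted_\<psi>' s + (1 - t) * (s * \<psi>' s * weighted_\<psi>' s))
        = integral {0..1} (\<lambda>s. \<psi> (t * s) * weighted_\<psi>' s) - integral {0..1} (\<lambda>s. \<psi> s * weighted_\<psi>' s) + (1 - t) * integral {0..1} (\<lambda>s. s * \<psi>' s * weighted_\<psi>' s)"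
      using Henstock_Kurzweil_Integration.integral_add[OF integrable_diff[OF i0 i1] i2]
        Henstock_Kurzweil_Integration.integral_diff[OF i0 i1] by simp
    moreover have "norm (integral {0..1} (\<lambda>s. \<psi> (t * s) * weighted_\<psi>' s - \<psi> s * weighted_\<psi>' s + (1 - t) * (s * \<psi>' s * weighted_\<psi>' s)))
        \<le> integral {0..1} (\<lambda>s::real. (1 - t) * e' * k)"
    proof (rule integral_norm_bound_integral)
      show "(\<lambda>s. \<psi> (t * s) * weighted_\<psi>' s - \<psi> s * weighted_\<psi>' s + (1 - t) * (s * \<psi>' s * weighted_\<psi>' s)) integrable_on {0..1}"
        by (intro integrable_add integrable_diff i0 i1 i2)
      fix s :: real assume s: "s \<in> {0..1}"
      have "\<psi> (t * s) * weighted_\<psi>' s - \<psi> s * weighted_\<psi>' s + (1 - t) * (s * \<psi>' s * weighted_\<psi>' s) = (\<psi> (t * s) - \<psi> s + (1 - t) * (s * \<psi>' s)) * weighted_\<psi>' s"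
        by (simp add: algebra_simps)
      then show "norm (\<psi> (t * s) * weighted_\<psi>' s - \<psi> s * weighted_\<psi>' s + (1 - t) * (s * \<psi>' s * weighted_\<psi>' s)) \<le> (1 - t) * e' * k"
        using mult_mono[OF approx[OF s] k(1)[OF s]] e' t by (simp add: abs_mult)
    qed auto
    ultimately have X: "integral {0..1} (\<lambda>s. \<psi> (t * s) * weighted_\<psi>' s) - integral {0..1} (\<lambda>s. \<psi> s * weighted_\<psi>' s)
        + (1 - t) * integral {0..1} (\<lambda>s. s * \<psi>' s * weighted_\<psi>' s) \<le> (1 - t) * e' * k" by simp
    have "\<rho> * ((1 - t) * e' * k) \<le> e * (1 - t)"
    proof -
      have "\<rho> * ((1 - t) * e' * k) = (e * (1 - t)) * (k / (k + 1))" using \<rho>_pos by (simp add: e'_def)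
      also have "\<dots> \<le> (e * (1 - t)) * 1" using e t k by (intro mult_left_mono) (auto simp: divide_le_eq)
      finally show ?thesis by simp
    qed
    moreover have "\<rho> * (integral {0..1} (\<lambda>s. \<psi> (t * s) * weighted_\<psi>' s) - integral {0..1} (\<lambda>s. \<psi> s * weighted_\<psi>' s)
        + (1 - t) * integral {0..1} (\<lambda>s. s * \<psi>' s * weighted_\<psi>' s)) = - bdry t + bdry 1 + (1 - t) * (bdry_square + real N * bdry 1)"
      unfolding PB[symmetric] using bdry_by_parts[OF t(1,2)] bdry_by_parts[of 1] by (simp add: algebra_simps)
    ultimately show ?case using mult_left_mono[OF X, of \<rho>] \<rho>_pos by linarith
  qed
qed

text \<open>With \<open>c = N / 2\<close> the left-hand side is \<open>\<rho>\<close> times the integral of \<open>s\<^bsup>N - 1\<^esup> (s \<psi>' + c \<psi>)\<^sup>2\<close>: the terms without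
  \<open>(\<psi>')\<^sup>2\<close> combine by integrating the derivative of \<open>s\<^bsup>N\<^esup> \<psi>\<^sup>2\<close>, which vanishes at both ends.\<close>

lemma boundary_nonneg: "bdry_square + real N / 2 * bdry 1 \<ge> 0"
proof -
  define c where "c = real N / 2"
  have c: "c > 0" using N_ge_1 by (simp add: c_def)
  have i1: "(\<lambda>s. s ^ (N + 1) * (\<psi>' s)\<^sup>2) integrable_on {0..1}"
    and i2: "(\<lambda>s. s ^ N * \<psi>' s * \<psi> s) integrable_on {0..1}"
    and i3: "(\<lambda>s. s ^ (N - 1) * (\<psi> s)\<^sup>2) integrable_on {0..1}"
    by (intro integrable_continuous_real continuous_intros continuous_\<psi>' continuous_\<psi>)+
  define J1 J2 J3 where "J1 = integral {0..1} (\<lambda>s. s ^ (N + 1) * (\<psi>' s)\<^sup>2)"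
    and "J2 = integral {0..1} (\<lambda>s. s ^ N * \<psi>' s * \<psi> s)" and "J3 = integral {0..1} (\<lambda>s. s ^ (N - 1) * (\<psi> s)\<^sup>2)"
  have h: "((\<lambda>s. s ^ (N + 1) * (\<psi>' s)\<^sup>2) has_integral J1) {0..1}" "((\<lambda>s. s ^ N * \<psi>' s * \<psi> s) has_integral J2) {0..1}"
    "((\<lambda>s. s ^ (N - 1) * (\<psi> s)\<^sup>2) has_integral J3) {0..1}"
    using i1 i2 i3 by (simp_all add: J1_def J2_def J3_def integrable_integral)
  have "((\<lambda>s. s ^ (N + 1) * (\<psi>' s)\<^sup>2 + (2 * c) * (s ^ N * \<psi>' s * \<psi> s) + c\<^sup>2 * (s ^ (N - 1) * (\<psi> s)\<^sup>2))
      has_integral (J1 + (2 * c) * J2 + c\<^sup>2 * J3)) {0..1}"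
    by (intro has_integral_add has_integral_mult_right h)
  then have "J1 + (2 * c) * J2 + c\<^sup>2 * J3 \<ge> 0"
  proof (rule has_integral_nonneg)
    fix s :: real assume s: "s \<in> {0..1}"
    have "s * s ^ (N - 1) = s ^ N" using N_ge_1 by (simp add: power_eq_if)
    then have "s ^ (N + 1) * (\<psi>' s)\<^sup>2 + (2 * c) * (s ^ N * \<psi>' s * \<psi> s) + c\<^sup>2 * (s ^ (N - 1) * (\<psi> s)\<^sup>2)
        = s * (s * s ^ (N - 1)) * (\<psi>' s)\<^sup>2 + (2 * c) * ((s * s ^ (N - 1)) * \<psi>' s * \<psi> s) + c\<^sup>2 * (s ^ (N - 1) * (\<psi> s)\<^sup>2)"
      by simp
    also have "\<dots> = s ^ (N - 1) * (s * \<psi>' s + c * \<psi> s)\<^sup>2"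
      by (simp add: power2_eq_square algebra_simps)
    also have "\<dots> \<ge> 0" using s by simp
    finally show "0 \<le> s ^ (N + 1) * (\<psi>' s)\<^sup>2 + (2 * c) * (s ^ N * \<psi>' s * \<psi> s) + c\<^sup>2 * (s ^ (N - 1) * (\<psi> s)\<^sup>2)" .
  qed
  moreover have "c * J3 + J2 = 0"
  proof -
    have "((\<lambda>s. (2 * c) * (s ^ (N - 1) * (\<psi> s)\<^sup>2) + 2 * (s ^ N * \<psi>' s * \<psi> s)) has_integral
        (1 ^ N * (\<psi> 1)\<^sup>2 - 0 ^ N * (\<psi> 0)\<^sup>2)) {0..1}"
    proof (rule fundamental_theorem_of_calculus_interior)
      show "continuous_on {0..1} (\<lambda>s. s ^ N * (\<psi> s)\<^sup>2)" by (intro continuous_intros continuous_\<psi>)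
      fix s :: real assume s: "s \<in> {0<..<1}"
      have "((\<lambda>s. s ^ N * (\<psi> s)\<^sup>2) has_real_derivative (real N * s ^ (N - 1)) * (\<psi> s)\<^sup>2 + s ^ N * (2 * \<psi> s * \<psi>' s)) (at s)"
        using s by (auto intro!: derivative_eq_intros \<psi>_derivative)
      then show "((\<lambda>s. s ^ N * (\<psi> s)\<^sup>2) has_vector_derivative
          (2 * c) * (s ^ (N - 1) * (\<psi> s)\<^sup>2) + 2 * (s ^ N * \<psi>' s * \<psi> s)) (at s)"
        by (simp add: has_real_derivative_iff_has_vector_derivative c_def algebra_simps)
    qed simp
    then have "((\<lambda>s. (2 * c) * (s ^ (N - 1) * (\<psi> s)\<^sup>2) + 2 * (s ^ N * \<psi>' s * \<psi> s)) has_integral 0) {0..1}"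
      using N_ge_1 \<psi>_1 by (simp add: zero_power)
    moreover have "((\<lambda>s. (2 * c) * (s ^ (N - 1) * (\<psi> s)\<^sup>2) + 2 * (s ^ N * \<psi>' s * \<psi> s)) has_integral ((2 * c) * J3 + 2 * J2)) {0..1}"
      by (intro has_integral_add has_integral_mult_right h)
    ultimately have "(2 * c) * J3 + 2 * J2 = 0" by (rule has_integral_unique[symmetric])
    then show ?thesis by simp
  qed
  then have "c * (c * J3 + J2) = 0" by simp
  then have "c\<^sup>2 * J3 = - (c * J2)" by (simp add: power2_eq_square algebra_simps)
  ultimately have "J1 + c * J2 \<ge> 0" by (simp add: algebra_simps)
  moreover have "bdry_square + real N / 2 * bdry 1 = \<rho> * (J1 + c * J2)"
    by (simp add: bdry_square_def bdry_def J1_def J2_def c_def algebra_simps)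
  ultimately show ?thesis using \<rho>_pos by simp
qed

subsection \<open>The Pohozaev inequality\<close>

text \<open>The case \<open>t = 1\<close> of \<open>green_identity\<close>.\<close>

lemma energy_identity: "I\<Omega> Q = (\<alpha> + 1) * potential + bdry 1"
proof -
  have "I\<Omega> (cross_density 1) = I\<Omega> Q"
    by (rule I\<Omega>_cong) (simp add: cross_density_def Q_def power2_eq_square mult.assoc)
  moreover have "I\<Omega> (\<lambda>z. u z * f (u z)) = (\<alpha> + 1) * potential"
    unfolding potential_def mult_f by (rule I\<Omega>_cmult)
  ultimately show ?thesis using green_identity[of 1] by simp
qed

text \<open>All expansions at \<open>t = 1\<close> are inserted into \<open>difference_energy\<close>. The terms of order \<open>0\<close> cancel by
  \<open>energy_identity\<close>; dividing by \<open>1 - t\<close> and letting \<open>t \<rightarrow> 1\<close> compares the terms of order \<open>1\<close>. Only an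
  inequality is obtained, because the energy in the layer is only estimated from below.\<close>

lemma pohozaev_inequality:
  "(real N * (\<alpha> + 1) - 2 * real w) * potential + 2 * (bdry_square + real N / 2 * bdry 1) \<le> 0"
proof -
  define A where "A = I\<Omega> Q"
  have A: "A = (\<alpha> + 1) * potential + bdry 1" unfolding A_def by (rule energy_identity)
  obtain C where C: "\<And>t. 0 < t \<Longrightarrow> t \<le> 1 \<Longrightarrow>
    I\<Omega> (\<lambda>z. snd z ^ m1 * (t ^ wx * u1 (dil t z))\<^sup>2 + fst z ^ m2 * (t ^ wy * u2 (dil t z))\<^sup>2)
      - 2 * I\<Omega> (cross_density t) + I\<Omega> Q \<ge> - C * (1 - t)\<^sup>2"
    using difference_energy by blast
  \<comment> \<open>the explicit part of the expansion, which vanishes at \<open>t = 1\<close>\<close>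
  define g where "g t = 2 * t powr E * (1 + \<alpha> * t powr - real w) * potential - (t powr - real N + 1) * A + 2 * bdry 1" for t
  define g1 where "g1 = 2 * E * (1 + \<alpha>) * potential - 2 * \<alpha> * real w * potential + real N * A"
  have g_1: "g 1 = 0" by (simp add: g_def A algebra_simps)
  have "(g has_real_derivative g1) (at 1)"
    unfolding g_def g1_def by (auto intro!: derivative_eq_intros simp: algebra_simps)
  then have "((\<lambda>t. (g t - g 1) / (t - 1)) \<longlongrightarrow> g1) (at_left 1)"
    by (simp add: has_field_derivative_iff filterlim_at_split)
  then have "((\<lambda>t. - ((g t - g 1) / (t - 1))) \<longlongrightarrow> - g1) (at_left 1)" by (rule tendsto_minus)
  moreover have "- ((g t - g 1) / (t - 1)) = g t / (1 - t)" for t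
    unfolding g_1 by (metis diff_zero minus_diff_eq minus_divide_right)
  ultimately have glim: "((\<lambda>t. g t / (1 - t)) \<longlongrightarrow> - g1) (at_left 1)" by simp
  \<comment> \<open>the factor by which the error \<open>e (1 - t)\<close> of the four expansions enters\<close>
  define Y where "Y t = 2 * t powr E * (\<alpha> * t powr - real w + 1) + 2 + t powr - real N" for t
  have Ylim: "(Y \<longlongrightarrow> Y 1) (at_left 1)"
    unfolding Y_def by (intro tendsto_intros) auto
  have Y1: "Y 1 = 2 * \<alpha> + 5" by (simp add: Y_def)
  have key: "- g1 + 2 * (bdry_square + real N * bdry 1) - e * Y 1 \<le> 0" if e: "e > 0" for e
  proof (rule tendsto_upperbound)
    show "((\<lambda>t. g t / (1 - t) + 2 * (bdry_square + real N * bdry 1) - e * Y t - C * (1 - t)) \<longlongrightarrow> - g1 + 2 * (bdry_square + real N * bdry 1) - e * Y 1) (at_left 1)"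
    proof -
      have "((\<lambda>t. g t / (1 - t) + 2 * (bdry_square + real N * bdry 1) - e * Y t - C * (1 - t)) \<longlongrightarrow> - g1 + 2 * (bdry_square + real N * bdry 1) - e * Y 1 - C * (1 - 1)) (at_left 1)"
        by (intro tendsto_intros glim Ylim)
      then show ?thesis by simp
    qed
    show "\<forall>\<^sub>F t in at_left 1. g t / (1 - t) + 2 * (bdry_square + real N * bdry 1) - e * Y t - C * (1 - t) \<le> 0"
      using energy_in_layer[OF e] potential_in_layer[OF e] nonlinear_term[OF e] bdry_expansion[OF e] near_1
    proof eventually_elim
      case (elim t)
      then have t: "0 < t" "t \<le> 1" "t < 1" by auto
      define LQ where "LQ = I\<Omega> (\<lambda>z. indicator (\<Omega> - dil t ` \<Omega>) z * Q z)"
      define LF where "LF = I\<Omega> (\<lambda>z. indicator (\<Omega> - dil t ` \<Omega>) z * F (u z))"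
      define J where "J = I\<Omega> (\<lambda>z. u z * f (u (dil t z)))"
      define IF where "IF = I\<Omega> (\<lambda>z. F (u (dil t z)))"
      define \<tau> where "\<tau> = 1 - t"
      define TE TN TW where "TE = t powr E" and "TN = t powr - real N" and "TW = t powr - real w"
      have \<tau>: "\<tau> > 0" using t by (simp add: \<tau>_def)
      have T: "TE > 0" "TN > 0" "TW > 0" using t by (auto simp: TE_def TN_def TW_def)
      have "TW * (t ^ w * IF) = TW * (potential - LF)"
        using potential_scaling[OF t(1,2)] by (simp add: IF_def LF_def)
      moreover have "TW * t ^ w = 1" using t unfolding TW_def by (simp only: powr_realpow[symmetric] powr_add[symmetric]) simp
      ultimately have "IF = TW * (potential - LF)" by (simp only: mult.assoc[symmetric] mult_1_left)
      moreover have "TW * (potential - LF) \<ge> TW * (potential - e * \<tau>)"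
        using elim(2) T by (intro mult_left_mono) (auto simp: LF_def \<tau>_def)
      ultimately have "\<alpha> * IF \<ge> \<alpha> * (TW * (potential - e * \<tau>))" using \<alpha> by (intro mult_left_mono) auto
      then have "J \<ge> potential + \<alpha> * (TW * (potential - e * \<tau>)) - e * \<tau>"
        using elim(3) by (simp add: J_def IF_def \<tau>_def)
      then have J: "TE * J \<ge> TE * (potential + \<alpha> * (TW * (potential - e * \<tau>)) - e * \<tau>)" using T by (intro mult_left_mono) auto
      have 1: "- (C * \<tau>\<^sup>2) \<le> TN * (A - LQ) - 2 * (TE * J + bdry t) + A"
        using C[OF t(1,2)] unfolding energy_scaling[OF t(1,2)] green_identity[OF t(1,2)]
        by (simp only: A_def LQ_def J_def TE_def TN_def \<tau>_def mult_minus_left)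
      have 2: "TN * (A - LQ) \<le> TN * (A + e * \<tau>)"
        using elim(1) T by (intro mult_left_mono) (auto simp: LQ_def \<tau>_def)
      have 3: "bdry 1 + \<tau> * (bdry_square + real N * bdry 1) - e * \<tau> \<le> bdry t" using elim(4) by (simp add: \<tau>_def)
      have main: "2 * (TE * (potential + \<alpha> * (TW * (potential - e * \<tau>)) - e * \<tau>)) + 2 * (bdry 1 + \<tau> * (bdry_square + real N * bdry 1) - e * \<tau>)
          \<le> TN * (A + e * \<tau>) + A + C * \<tau>\<^sup>2"
        by (rule combine_energy_inequalities[OF 1 2 3 J])
      have gt: "g t = 2 * TE * (1 + \<alpha> * TW) * potential - (TN + 1) * A + 2 * bdry 1"
        by (simp add: g_def TE_def TN_def TW_def)
      have Yt: "Y t = 2 * TE * (\<alpha> * TW + 1) + 2 + TN" by (simp add: Y_def TE_def TN_def TW_def)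
      have "g t + \<tau> * (2 * (bdry_square + real N * bdry 1) - e * Y t - C * \<tau>) \<le> 0"
        using main unfolding gt Yt by (simp add: algebra_simps power2_eq_square)
      then have "(g t + \<tau> * (2 * (bdry_square + real N * bdry 1) - e * Y t - C * \<tau>)) / \<tau> \<le> 0"
        using \<tau> by (simp add: divide_le_0_iff)
      moreover have "(g t + \<tau> * (2 * (bdry_square + real N * bdry 1) - e * Y t - C * \<tau>)) / \<tau>
          = g t / \<tau> + (2 * (bdry_square + real N * bdry 1) - e * Y t - C * \<tau>)"
        using \<tau> by (simp only: add_divide_distrib) simp
      ultimately show ?case by (simp add: \<tau>_def)
    qed
  qed simp
  have "- g1 + 2 * (bdry_square + real N * bdry 1) \<le> 0"
  proof (rule field_le_epsilon)
    fix e :: real assume "e > 0"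
    then have "e / Y 1 > 0" "Y 1 > 0" using \<alpha> Y1 by auto
    then show "- g1 + 2 * (bdry_square + real N * bdry 1) \<le> 0 + e" using key[of "e / Y 1"] by simp
  qed
  moreover have "- g1 + 2 * (bdry_square + real N * bdry 1) = (real N * (\<alpha> + 1) - 2 * real w) * potential + 2 * (bdry_square + real N / 2 * bdry 1)"
    unfolding g1_def A E_eq by (simp add: algebra_simps)
  ultimately show ?thesis by simp
qed

text \<open>The critical exponent is \<open>2 w / N\<close>, as \<open>w = m1 + m2 + 4\<close>.\<close>

lemma supercritical: "real N * (\<alpha> + 1) - 2 * real w > 0"
proof -
  have Np: "real N > 0" using N_ge_1 by simp
  have "critical_exponent m1 m2 = 2 * real w / real N"
    by (simp add: critical_exponent_def N_def wx_def wy_def)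
  then have "2 * real w / real N < \<alpha> + 1" using \<alpha> by simp
  then show ?thesis using Np by (simp add: divide_less_eq mult.commute)
qed

lemma potential_zero: "potential = 0"
proof -
  have "potential \<ge> 0" unfolding potential_def I\<Omega>_def by (intro integral_nonneg_AE) (auto simp: F_nonneg)
  moreover have "(real N * (\<alpha> + 1) - 2 * real w) * potential \<le> 0"
  proof -
    have "a \<le> 0" if "a + 2 * b \<le> 0" "0 \<le> b" for a b :: real using that by linarith
    from this[OF pohozaev_inequality boundary_nonneg] show ?thesis .
  qed
  ultimately show ?thesis using supercritical by (simp add: mult_le_0_iff)
qed

lemma solution_vanishes: "AE z in lebesgue_on \<Omega>. u z = 0"
proof -
  have "AE z in lborel. indicator \<Omega> z * F (u z) = 0"
    using potential_zero integral_nonneg_eq_0_iff_AE[OF integrable_indicator_continuous[OF continuous_Fu]]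
    unfolding potential_def I\<Omega>_def by (auto simp: F_nonneg)
  then have "AE z in lborel. z \<in> \<Omega> \<longrightarrow> u z = 0"
    by eventually_elim (use \<alpha> in \<open>auto simp: F_def\<close>)
  then have "AE z in lebesgue. z \<in> \<Omega> \<longrightarrow> u z = 0" by (rule AE_completion)
  then show ?thesis using open_\<Omega> by (simp add: AE_restrict_space_iff)
qed

end

section \<open>Nonexistence of nontrivial supercritical solutions\<close>

theorem theorem2:
  fixes m1 m2 :: nat and x0 \<alpha> :: real
    and \<sigma> \<Omega> :: "(real \<times> real) set" and u :: "real \<times> real \<Rightarrow> real"
  assumes "odd m1"
    and "even m2" and "even (m2 div 2)"
    and "tricomi_domain m1 m2 x0 \<sigma> \<Omega>"
    and "D_star_shaped m1 m2 \<Omega>"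
    and "\<alpha> > 0" and "\<alpha> > critical_exponent m1 m2 - 1"
    and "C2_closure \<Omega> u"
    and "\<forall>z\<in>\<Omega>. tricomi_operator m1 m2 u z = u z * \<bar>u z\<bar> powr (\<alpha> - 1)"
    and "\<forall>z \<in> char_AC m1 m2 x0 \<union> \<sigma>. u z = 0"
  shows "AE z in lebesgue_on \<Omega>. u z = 0"
proof -
  have o: "open \<Omega>" using assms(4) by (simp add: tricomi_domain_def)
  have C2: "continuous_on (closure \<Omega>) u" "C1_up_to_boundary \<Omega> u"
    "C1_up_to_boundary \<Omega> (partial_x u)" "C1_up_to_boundary \<Omega> (partial_y u)"
    using assms(8) by (auto simp: C2_closure_def)
  obtain u1 where u1: "continuous_on (closure \<Omega>) u1" "\<And>z. z \<in> \<Omega> \<Longrightarrow> u1 z = partial_x u z"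
    using C2(2) extends_continuouslyE unfolding C1_up_to_boundary_def by blast
  obtain u2 where u2: "continuous_on (closure \<Omega>) u2" "\<And>z. z \<in> \<Omega> \<Longrightarrow> u2 z = partial_y u z"
    using C2(2) extends_continuouslyE unfolding C1_up_to_boundary_def by blast
  obtain u11 where u11: "continuous_on (closure \<Omega>) u11" "\<And>z. z \<in> \<Omega> \<Longrightarrow> u11 z = partial_x (partial_x u) z"
    using C2(3) extends_continuouslyE unfolding C1_up_to_boundary_def by blast
  obtain u12 where u12: "continuous_on (closure \<Omega>) u12" "\<And>z. z \<in> \<Omega> \<Longrightarrow> u12 z = partial_y (partial_x u) z"
    using C2(3) extends_continuouslyE unfolding C1_up_to_boundary_def by blast
  obtain u21 where u21: "continuous_on (closure \<Omega>) u21" "\<And>z. z \<in> \<Omega> \<Longrightarrow> u21 z = partial_x (partial_y u) z"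
    using C2(4) extends_continuouslyE unfolding C1_up_to_boundary_def by blast
  obtain u22 where u22: "continuous_on (closure \<Omega>) u22" "\<And>z. z \<in> \<Omega> \<Longrightarrow> u22 z = partial_y (partial_y u) z"
    using C2(4) extends_continuouslyE unfolding C1_up_to_boundary_def by blast
  interpret tricomi_solution m1 m2 x0 \<sigma> \<Omega> u u1 u2 u11 u12 u21 u22 \<alpha>
  proof
    fix z assume z: "z \<in> \<Omega>"
    show "(u has_derivative (\<lambda>h. u1 z * fst h + u2 z * snd h)) (at z)"
      using partial_derivative_representation[of u z] C2(2) z u1 u2 by (simp add: C1_up_to_boundary_def)
    have "(partial_x u has_derivative (\<lambda>h. u11 z * fst h + u12 z * snd h)) (at z)"
      using partial_derivative_representation[of "partial_x u" z] C2(3) z u11 u12 by (simp add: C1_up_to_boundary_def)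
    then show "(u1 has_derivative (\<lambda>h. u11 z * fst h + u12 z * snd h)) (at z)"
      by (rule has_derivative_transform_within_open[OF _ o z]) (simp add: u1)
    have "(partial_y u has_derivative (\<lambda>h. u21 z * fst h + u22 z * snd h)) (at z)"
      using partial_derivative_representation[of "partial_y u" z] C2(4) z u21 u22 by (simp add: C1_up_to_boundary_def)
    then show "(u2 has_derivative (\<lambda>h. u21 z * fst h + u22 z * snd h)) (at z)"
      by (rule has_derivative_transform_within_open[OF _ o z]) (simp add: u2)
    have "tricomi_operator m1 m2 u z = u z * \<bar>u z\<bar> powr (\<alpha> - 1)" using assms(9) z by blast
    then show "snd z ^ m1 * u11 z + fst z ^ m2 * u22 z = - (u z * \<bar>u z\<bar> powr (\<alpha> - 1))"
      using u11(2)[OF z] u22(2)[OF z] by (cases z) (simp add: tricomi_operator_def)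
  qed (use assms C2 u1 u2 u11 u12 u21 u22 in auto)
  show ?thesis by (rule solution_vanishes)
qed

end
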